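(* Let $w\in\mathcal S'(\mathbb R^m)$, $\gamma$ an admissible scaling, and $\chi\in\mathcal S(\mathbb R^m)$ with $\int\chi=1$. Then $WF^\gamma_g(\iota^\gamma_\chi(w))=WF(w)$, where $WF(w)$ is the usual (smooth) wave front set of $w$.
   Context: Colombeau framework: for $q\in\mathbb N_0$, $\mathcal A_q(\mathbb R)$ is the set of $\phi_0\in\mathcal D(\mathbb R)$ with $\int\phi_0=1$ and $\int t^j\phi_0(t)\,dt=0$ for $1\le j\le q$; $\mathcal A_q(\mathbb R^m)$ is the set of $\phi=\phi_0\otimes\cdots\otimes\phi_0$ ($m$ factors) with $\phi_0\in\mathcal A_q(\mathbb R)$. For $\varepsilon>0$, $\phi_\varepsilon(x)=\varepsilon^{-m}\phi(x/\varepsilon)$, and $l(\phi_0)=\sup\{|t|:\phi_0(t)\ne0\}$. $\mathcal G(\mathbb R^m)$ is the (special-variant) Colombeau algebra: classes of moderate maps $U:\mathcal A_0(\mathbb R^m)\times\mathbb R^m\to\mathbb C$, smooth in $x$, modulo negligible ones; $U(\phi,x)$ denotes a representative. An admissible scaling is a continuous $\gamma:(0,1)\to\mathbb R_+$ with $\gamma(r)=O(1/r)$, $\gamma(r)\to\infty$, and $\gamma(sr)=O(\gamma(r))$ for each fixed $0<s<1$, as $r\to0$. Embedding: for $\chi\in\mathcal S(\mathbb R^m)$ with $\int\chi=1$ and $u\in\mathcal S'(\mathbb R^m)$, $\iota^\gamma_\chi(u)$ is the class of $(\phi,x)\mapsto u*\chi^\gamma(\phi,\cdot)(x)$, where $\chi^\gamma(\phi,x)=\gamma(l(\phi_0))^m\chi(\gamma(l(\phi_0))x)$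 for $\phi=\phi_0\otimes\cdots\otimes\phi_0\in\mathcal A_0(\mathbb R^m)$. Write $\gamma_\varepsilon:=\gamma(\varepsilon l(\phi_0))$. $\gamma$-wave front set: for $U\in\mathcal G(\mathbb R^m)$ and $\psi\in\mathcal D(\mathbb R^m)$, a direction $\xi_0\ne0$ is not in $\Sigma^\gamma_g(\psi U)$ if there are an open conic neighbourhood $\Gamma$ of $\xi_0$ and $N\in\mathbb N_0$ such that for every $k\in\mathbb N_0$ there is $M\in\mathbb N_0$ with $\sup_{\xi\in\Gamma}(1+|\xi|)^k|\mathcal F(\psi U(\phi_\varepsilon,\cdot))(\xi)|=O(\gamma_\varepsilon^N)$ as $\varepsilon\to0$ for all $\phi\in\mathcal A_M(\mathbb R^m)$. Then $WF^\gamma_g(U)$ is the set of $(x_0,\xi_0)\in\mathbb R^m\times(\mathbb R^m\setminus0)$ such that $\xi_0\in\Sigma^\gamma_g(\psi U)$ for every $\psi\in\mathcal D(\mathbb R^m)$ with $\psi(x_0)\ne0$. *)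

theory Defs
  imports "HOL-Analysis.Analysis" "HOL-Library.Landau_Symbols"
begin

fun dderivs :: "'a::real_normed_vector list \<Rightarrow> ('a \<Rightarrow> 'b::real_normed_vector) \<Rightarrow> 'a \<Rightarrow> 'b" where
  "dderivs [] f = f"
| "dderivs (v # vs) f = (\<lambda>x. frechet_derivative (dderivs vs f) (at x) v)"

definition smooth_fun :: "('a::real_normed_vector \<Rightarrow> 'b::real_normed_vector) \<Rightarrow> bool" where
  "smooth_fun f \<longleftrightarrow> (\<forall>vs x. dderivs vs f differentiable (at x))"

definition fsupp :: "('a::real_normed_vector \<Rightarrow> 'b::zero) \<Rightarrow> 'a set" where
  "fsupp f = closure {x. f x \<noteq> 0}"

definition test_fun :: "('a::euclidean_space \<Rightarrow> complex) \<Rightarrow> bool" where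
  "test_fun f \<longleftrightarrow> smooth_fun f \<and> compact (fsupp f)"

definition dirs_upto :: "nat \<Rightarrow> 'a::euclidean_space list set" where
  "dirs_upto N = {vs. set vs \<subseteq> Basis \<and> length vs \<le> N}"

definition schwartz :: "('a::euclidean_space \<Rightarrow> complex) \<Rightarrow> bool" where
  "schwartz f \<longleftrightarrow> smooth_fun f \<and>
     (\<forall>vs. set vs \<subseteq> Basis \<longrightarrow> (\<forall>k::nat. bounded (range (\<lambda>x. (1 + norm x) ^ k * norm (dderivs vs f x)))))"

definition schwartz_seminorm :: "nat \<Rightarrow> ('a::euclidean_space \<Rightarrow> complex) \<Rightarrow> real" where
  "schwartz_seminorm N f =
     (\<Sum>vs\<in>dirs_upto N. Sup (range (\<lambda>x. (1 + norm x) ^ N * norm (dderivs vs f x))))"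

text \<open>Tempered distributions: continuous linear functionals on S (values of the
  functional outside S are irrelevant).\<close>
definition tempered :: "(('a::euclidean_space \<Rightarrow> complex) \<Rightarrow> complex) \<Rightarrow> bool" where
  "tempered u \<longleftrightarrow>
     (\<forall>f g. schwartz f \<longrightarrow> schwartz g \<longrightarrow> u (\<lambda>x. f x + g x) = u f + u g) \<and>
     (\<forall>c f. schwartz f \<longrightarrow> u (\<lambda>x. c * f x) = c * u f) \<and>
     (\<exists>C N. \<forall>f. schwartz f \<longrightarrow> norm (u f) \<le> C * schwartz_seminorm N f)"

definition mollA :: "nat \<Rightarrow> (real \<Rightarrow> complex) set" where
  "mollA q = {\<phi>0. test_fun \<phi>0 \<and> integral\<^sup>L lborel \<phi>0 = 1 \<and>
      (\<forall>j\<in>{1..q}. integral\<^sup>L lborel (\<lambda>t. of_real (t ^ j) * \<phi>0 t) = 0)}"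

definition lsupp :: "(real \<Rightarrow> complex) \<Rightarrow> real" where
  "lsupp \<phi>0 = Sup {\<bar>t\<bar> | t. \<phi>0 t \<noteq> 0}"

text \<open>(phi0)_eps(t) = phi0(t/eps)/eps; the tensor power of it is phi_eps.\<close>
definition dil :: "real \<Rightarrow> (real \<Rightarrow> complex) \<Rightarrow> real \<Rightarrow> complex" where
  "dil \<epsilon> \<phi>0 t = \<phi>0 (t / \<epsilon>) / of_real \<epsilon>"

definition admissible_scaling :: "(real \<Rightarrow> real) \<Rightarrow> bool" where
  "admissible_scaling \<gamma> \<longleftrightarrow>
     continuous_on {0<..<1} \<gamma> \<and> (\<forall>r\<in>{0<..<1}. \<gamma> r > 0) \<and>
     \<gamma> \<in> O[at_right 0](\<lambda>r. 1 / r) \<and>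
     filterlim \<gamma> at_top (at_right 0) \<and>
     (\<forall>s\<in>{0<..<1}. (\<lambda>r. \<gamma> (s * r)) \<in> O[at_right 0](\<gamma>))"

text \<open>chi^gamma(phi, x) for phi = phi0 (x) ... (x) phi0, parametrised by phi0.\<close>
definition chi_gamma :: "(real \<Rightarrow> real) \<Rightarrow> (real^'m \<Rightarrow> complex) \<Rightarrow> (real \<Rightarrow> complex) \<Rightarrow> real^'m \<Rightarrow> complex" where
  "chi_gamma \<gamma> chi \<phi>0 x =
     of_real (\<gamma> (lsupp \<phi>0) ^ CARD('m)) * chi (\<gamma> (lsupp \<phi>0) *\<^sub>R x)"

definition dconv :: "((real^'m \<Rightarrow> complex) \<Rightarrow> complex) \<Rightarrow> (real^'m \<Rightarrow> complex) \<Rightarrow> real^'m \<Rightarrow> complex" where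
  "dconv u f x = u (\<lambda>y. f (x - y))"

text \<open>The canonical representative of iota^gamma_chi(u): (phi, x) |-> u * chi^gamma(phi,.)(x),
  with phi = phi0 (x) ... (x) phi0 parametrised by phi0.\<close>
definition embed_rep :: "(real \<Rightarrow> real) \<Rightarrow> (real^'m \<Rightarrow> complex) \<Rightarrow> ((real^'m \<Rightarrow> complex) \<Rightarrow> complex)
    \<Rightarrow> (real \<Rightarrow> complex) \<Rightarrow> real^'m \<Rightarrow> complex" where
  "embed_rep \<gamma> chi u \<phi>0 x = dconv u (chi_gamma \<gamma> chi \<phi>0) x"

definition fourier :: "(real^'m \<Rightarrow> complex) \<Rightarrow> real^'m \<Rightarrow> complex" where
  "fourier f \<xi> = integral\<^sup>L lborel (\<lambda>x. f x * exp (- \<i> * of_real (x \<bullet> \<xi>)))"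

definition conic_nbhd :: "(real^'m) set \<Rightarrow> real^'m \<Rightarrow> bool" where
  "conic_nbhd \<Gamma> \<xi>0 \<longleftrightarrow> open \<Gamma> \<and> \<xi>0 \<in> \<Gamma> \<and> 0 \<notin> \<Gamma> \<and>
     (\<forall>\<xi>\<in>\<Gamma>. \<forall>t>0. t *\<^sub>R \<xi> \<in> \<Gamma>)"

text \<open>xi0 is NOT in Sigma^gamma_g(psi U), for a representative U (parametrised by phi0).
  The O-estimate of the supremum over Gamma is written out explicitly.\<close>
definition not_in_Sigma_g :: "(real \<Rightarrow> real) \<Rightarrow> (real^'m \<Rightarrow> complex)
    \<Rightarrow> ((real \<Rightarrow> complex) \<Rightarrow> real^'m \<Rightarrow> complex) \<Rightarrow> real^'m \<Rightarrow> bool" where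
  "not_in_Sigma_g \<gamma> \<psi> U \<xi>0 \<longleftrightarrow>
     (\<exists>\<Gamma>. conic_nbhd \<Gamma> \<xi>0 \<and>
       (\<exists>N::nat. \<forall>k::nat. \<exists>M::nat. \<forall>\<phi>0\<in>mollA M.
          (\<exists>C \<epsilon>0. \<epsilon>0 > 0 \<and> (\<forall>\<epsilon>. 0 < \<epsilon> \<and> \<epsilon> < \<epsilon>0 \<longrightarrow> (\<forall>\<xi>\<in>\<Gamma>.
             (1 + norm \<xi>) ^ k * norm (fourier (\<lambda>x. \<psi> x * U (dil \<epsilon> \<phi>0) x) \<xi>)
               \<le> C * \<bar>\<gamma> (\<epsilon> * lsupp \<phi>0)\<bar> ^ N)))))"

definition WF_gamma_g :: "(real \<Rightarrow> real) \<Rightarrow> ((real \<Rightarrow> complex) \<Rightarrow> real^'m \<Rightarrow> complex)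
    \<Rightarrow> ((real^'m) \<times> (real^'m)) set" where
  "WF_gamma_g \<gamma> U = {(x0, \<xi>0). \<xi>0 \<noteq> 0 \<and>
     (\<forall>\<psi>. test_fun \<psi> \<and> \<psi> x0 \<noteq> 0 \<longrightarrow> \<not> not_in_Sigma_g \<gamma> \<psi> U \<xi>0)}"

text \<open>The usual (smooth) wave front set of a distribution u; the Fourier transform of
  psi u at xi is u(x |-> psi(x) e^{-i x.xi}).\<close>
definition WF :: "((real^'m \<Rightarrow> complex) \<Rightarrow> complex) \<Rightarrow> ((real^'m) \<times> (real^'m)) set" where
  "WF u = {(x0, \<xi>0). \<xi>0 \<noteq> 0 \<and>
     \<not> (\<exists>\<psi>. test_fun \<psi> \<and> \<psi> x0 \<noteq> 0 \<and>
          (\<exists>\<Gamma>. conic_nbhd \<Gamma> \<xi>0 \<and> (\<forall>k::nat. \<exists>C. \<forall>\<xi>\<in>\<Gamma>.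
             (1 + norm \<xi>) ^ k * norm (u (\<lambda>x. \<psi> x * exp (- \<i> * of_real (x \<bullet> \<xi>)))) \<le> C)))}"

end

(*
  Testing w * chi^gamma against psi and transforming gives, with l = gamma_eps,
     F(psi (w * chi^gamma))(xi) = int chi(s) w(psi e_{-xi} (. + s/l)) ds,
  where e_{-xi}(y) = exp(-i y.xi); the interchange of w with integrals is justified by
  approximating the parameter by simple functions.

  If the left-hand side is O(l^N (1 + |xi|)^-k) with N independent of k, then letting l be a high
  power of 1 + |xi| makes the error O((1 + |xi|)^K / l) of replacing the right-hand side by
  w(psi e_{-xi}) negligible, so psi w decays rapidly.  Mollifiers with M vanishing moments exist,
  and gamma attains all large values since it is continuous and unbounded.

  Conversely, let psi w decay rapidly in a cone.  Shrink psi to psi' such that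
  psi rho = 1 on the supports of all small translates of psi', with rho a test function.  Fourier
  inversion of rho psi'(. + h) shows that psi'(. + h) w decays rapidly in a smaller cone, uniformly
  in small h.  For 1 + |xi| <= l^2 the remaining part |s| > delta l of the integral is controlled by
  the decay of chi; for 1 + |xi| > l^2 integration by parts suffices, each derivative
  costing only a factor l <= (1 + |xi|)^(1/2).
*)
theory Submission
  imports Defs
begin

section \<open>Smooth functions\<close>

text \<open>The kernel chi is rapidly decreasing but need not have compact support, so the
  regularization near x0 also sees w far away. That contribution is smaller than any negative power
  of l times a fixed power of 1 + |xi|; it is harmless only while 1 + |xi| is at most a fixed power
  of l. This forces the split by the size of xi. The exponent 2 works because L integrations by
  parts gain |xi|^-L and cost about l^L, at most (1 + |xi|)^(L/2), so half of the gain survives. The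
  bound obtained is uniform in l, hence the witnesses N = 0 and M = 0 in that direction. The cutoff
  has to shrink there because the argument s/l moves it: the decay must be known for all small
  translates, not just for \<psi> itself. In the other direction cutoff and cone stay the same, and
  the freedom to pick a different epsilon for each xi does the work. A distribution is here a bare
  functional with a bound by one seminorm. An integral may be pulled out of it only if the integral
  is itself a Schwartz function approximated in that seminorm; \<open>lipfam\<close> (families) and
  \<open>rapid\<close> (densities) isolate what this needs.\<close>

definition ddir :: "'a::real_normed_vector \<Rightarrow> ('a \<Rightarrow> 'b::real_normed_vector) \<Rightarrow> 'a \<Rightarrow> 'b" where
  "ddir v f x = frechet_derivative f (at x) v"

lemma dderivs_Cons_ddir: "dderivs (v # vs) f = ddir v (dderivs vs f)"
  by (simp add: ddir_def fun_eq_iff)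

text \<open>In \<open>dderivs\<close> the head of the list is the outermost derivative. Moving the
  innermost one into the function lets smoothness pass to \<open>ddir v f\<close> and supports
  inductions in which the function changes.\<close>

lemma dderivs_snoc: "dderivs (vs @ [v]) f = dderivs vs (ddir v f)"
  by (induction vs) (simp_all add: ddir_def[abs_def])

lemma smooth_fun_differentiable: "smooth_fun f \<Longrightarrow> f differentiable (at x)"
  unfolding smooth_fun_def by (metis dderivs.simps(1))

lemma smooth_fun_ddir: "smooth_fun f \<Longrightarrow> smooth_fun (ddir v f)"
  unfolding smooth_fun_def by (metis dderivs_snoc)

lemma smooth_fun_dderivs: "smooth_fun f \<Longrightarrow> smooth_fun (dderivs vs f)"
  by (induction vs) (simp_all add: dderivs_Cons_ddir smooth_fun_ddir del: dderivs.simps(2))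

text \<open>Iterated derivatives of \<open>f\<close> never leave a set closed under
  \<open>ddir\<close>. Exhibiting such a set replaces a separate induction over derivative lists for
  each closure property.\<close>

lemma smooth_fun_coinduct:
  assumes "f \<in> S"
    and "\<And>g x. g \<in> S \<Longrightarrow> g differentiable (at x)"
    and "\<And>g v. g \<in> S \<Longrightarrow> ddir v g \<in> S"
  shows "smooth_fun f"
proof -
  have "dderivs vs f \<in> S" for vs
    by (induction vs) (simp_all add: dderivs_Cons_ddir assms del: dderivs.simps(2))
  then show ?thesis
    unfolding smooth_fun_def using assms(2) by blast
qed

lemma differentiable_has_derivative_ddir:
  "f differentiable (at x) \<Longrightarrow> (f has_derivative (\<lambda>v. ddir v f x)) (at x)"
  unfolding ddir_def by (simp add: frechet_derivative_works[symmetric])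

lemma has_derivative_ddir:
  "smooth_fun f \<Longrightarrow> (f has_derivative (\<lambda>v. ddir v f x)) (at x)"
  by (simp add: differentiable_has_derivative_ddir smooth_fun_differentiable)

lemma ddir_eqI: "(f has_derivative D) (at x) \<Longrightarrow> ddir v f x = D v"
  unfolding ddir_def by (metis frechet_derivative_at)

lemma smooth_fun_continuous_on: "smooth_fun f \<Longrightarrow> continuous_on A f"
  by (meson continuous_at_imp_continuous_on differentiable_imp_continuous_within smooth_fun_differentiable)

lemma smooth_fun_borel_measurable [measurable_dest]:
  fixes f :: "'a::euclidean_space \<Rightarrow> complex"
  shows "smooth_fun f \<Longrightarrow> f \<in> borel_measurable borel"
  by (simp add: borel_measurable_continuous_onI smooth_fun_continuous_on)

lemma ddir_add:
  assumes "smooth_fun f" "smooth_fun g"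
  shows "ddir v (\<lambda>x. f x + g x) = (\<lambda>x. ddir v f x + ddir v g x)"
  by (rule ext, rule ddir_eqI) (intro derivative_intros has_derivative_ddir assms)

lemma ddir_diff:
  assumes "smooth_fun f" "smooth_fun g"
  shows "ddir v (\<lambda>x. f x - g x) = (\<lambda>x. ddir v f x - ddir v g x)"
  by (rule ext, rule ddir_eqI) (intro derivative_intros has_derivative_ddir assms)

lemma ddir_mult:
  fixes f g :: "'a::real_normed_vector \<Rightarrow> complex"
  assumes "smooth_fun f" "smooth_fun g"
  shows "ddir v (\<lambda>x. f x * g x) = (\<lambda>x. f x * ddir v g x + ddir v f x * g x)"
  by (rule ext, rule ddir_eqI) (intro derivative_intros has_derivative_ddir assms)

lemma ddir_const: "ddir v (\<lambda>x. c) = (\<lambda>x. 0)"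
  by (rule ext, rule ddir_eqI) (rule has_derivative_const)

lemma ddir_linear:
  assumes "bounded_linear h"
  shows "ddir v h = (\<lambda>x. h v)"
  by (rule ext, rule ddir_eqI) (rule bounded_linear_imp_has_derivative[OF assms])

lemma ddir_compose_linear:
  assumes "bounded_linear h" "smooth_fun f"
  shows "ddir v (\<lambda>x. h (f x)) = (\<lambda>x. h (ddir v f x))"
  by (rule ext, rule ddir_eqI) (intro bounded_linear.has_derivative[OF assms(1)] has_derivative_ddir assms)

lemma ddir_compose_affine:
  assumes "smooth_fun f"
  shows "ddir v (\<lambda>x. f (a *\<^sub>R x + z)) = (\<lambda>x. a *\<^sub>R ddir v f (a *\<^sub>R x + z))"
proof (rule ext, rule ddir_eqI)
  fix x
  have "((\<lambda>x. f (a *\<^sub>R x + z)) has_derivative (\<lambda>v. ddir (a *\<^sub>R v) f (a *\<^sub>R x + z))) (at x)"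
    by (rule has_derivative_compose[OF _ has_derivative_ddir[OF assms]])
       (auto intro!: derivative_eq_intros)
  moreover have "ddir (a *\<^sub>R v) f y = a *\<^sub>R ddir v f y" for v y
    using linear_scale[OF has_derivative_linear[OF has_derivative_ddir[OF assms]]] .
  ultimately show "((\<lambda>x. f (a *\<^sub>R x + z)) has_derivative (\<lambda>v. a *\<^sub>R ddir v f (a *\<^sub>R x + z))) (at x)"
    by simp
qed

lemma smooth_fun_const: "smooth_fun (\<lambda>x. c)"
  by (rule smooth_fun_coinduct[where S = "range (\<lambda>c x. c)"]) (auto simp: ddir_const)

lemma smooth_fun_linear: "bounded_linear h \<Longrightarrow> smooth_fun h"
  by (rule smooth_fun_coinduct[where S = "insert h (range (\<lambda>c x. c))"])
     (auto simp: ddir_const ddir_linear differentiable_def intro: bounded_linear_imp_has_derivative has_derivative_const)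

lemma smooth_fun_add:
  assumes "smooth_fun f" "smooth_fun g"
  shows "smooth_fun (\<lambda>x. f x + g x)"
  by (rule smooth_fun_coinduct[where S = "{\<lambda>x. f x + g x |f g. smooth_fun f \<and> smooth_fun g}"])
     (use assms in \<open>fastforce simp: ddir_add intro: differentiable_add smooth_fun_differentiable smooth_fun_ddir\<close>)+

lemma smooth_fun_compose_linear:
  assumes "bounded_linear h" "smooth_fun f"
  shows "smooth_fun (\<lambda>x. h (f x))"
proof (rule smooth_fun_coinduct[where S = "{\<lambda>x. h (f x) |f. smooth_fun f}"])
  show "g differentiable at x" if "g \<in> {\<lambda>x. h (f x) |f. smooth_fun f}" for g x
    using that bounded_linear.has_derivative[OF assms(1) has_derivative_ddir]
    by (auto simp: differentiable_def)
qed (use assms in \<open>auto simp: ddir_compose_linear intro: smooth_fun_ddir\<close>)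

lemma smooth_fun_cmult: "smooth_fun f \<Longrightarrow> smooth_fun (\<lambda>x. c * f x :: complex)"
  by (rule smooth_fun_compose_linear[OF bounded_linear_mult_right])

lemma ddir_cmult: "smooth_fun f \<Longrightarrow> ddir v (\<lambda>x. c * f x :: complex) = (\<lambda>x. c * ddir v f x)"
  by (rule ddir_compose_linear[OF bounded_linear_mult_right])

lemma smooth_fun_diff:
  assumes "smooth_fun f" "smooth_fun g"
  shows "smooth_fun (\<lambda>x. f x - g x)"
  using smooth_fun_add[OF assms(1) smooth_fun_compose_linear[OF bounded_linear_minus[OF bounded_linear_ident] assms(2)]]
  by simp

lemma smooth_fun_sum:
  "finite I \<Longrightarrow> (\<And>i. i \<in> I \<Longrightarrow> smooth_fun (f i)) \<Longrightarrow> smooth_fun (\<lambda>x. \<Sum>i\<in>I. f i x)"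
  by (induction I rule: finite_induct) (auto intro: smooth_fun_const smooth_fun_add)

lemma smooth_fun_compose_affine:
  assumes "smooth_fun f"
  shows "smooth_fun (\<lambda>x. f (a *\<^sub>R x + z))"
proof (rule smooth_fun_coinduct[where S = "{\<lambda>x. f (a *\<^sub>R x + z) |f. smooth_fun f}"])
  show "g differentiable at x" if gS: "g \<in> {\<lambda>x. f (a *\<^sub>R x + z) |f. smooth_fun f}" for g x
  proof -
    obtain f where f: "g = (\<lambda>x. f (a *\<^sub>R x + z))" "smooth_fun f"
      using gS by blast
    have "((\<lambda>x. f (a *\<^sub>R x + z)) has_derivative (\<lambda>v. ddir (a *\<^sub>R v) f (a *\<^sub>R x + z))) (at x)"
      by (rule has_derivative_compose[OF _ has_derivative_ddir[OF f(2)]])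
         (auto intro!: derivative_eq_intros)
    then show ?thesis unfolding f(1) differentiable_def by blast
  qed
  show "ddir v g \<in> {\<lambda>x. f (a *\<^sub>R x + z) |f. smooth_fun f}"
    if gS: "g \<in> {\<lambda>x. f (a *\<^sub>R x + z) |f. smooth_fun f}" for g v
  proof -
    obtain f where f: "g = (\<lambda>x. f (a *\<^sub>R x + z))" "smooth_fun f"
      using gS by blast
    have "smooth_fun (\<lambda>x. a *\<^sub>R ddir v f x)"
      by (rule smooth_fun_compose_linear[OF bounded_linear_scaleR_right smooth_fun_ddir[OF f(2)]])
    then show ?thesis unfolding f(1) ddir_compose_affine[OF f(2)] mem_Collect_eq
      by (rule exI[where x = "\<lambda>x. a *\<^sub>R ddir v f x", OF conjI[OF refl]])
  qed
qed (use assms in auto)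

text \<open>The module generated by \<open>S\<close> over the smooth functions. Sums are included
  because the Leibniz rule turns one product into two.\<close>

inductive_set mod_span :: "('a::real_normed_vector \<Rightarrow> complex) set \<Rightarrow> ('a \<Rightarrow> complex) set" for S where
  base: "smooth_fun a \<Longrightarrow> f \<in> S \<Longrightarrow> (\<lambda>x. a x * f x) \<in> mod_span S"
| add: "f \<in> mod_span S \<Longrightarrow> g \<in> mod_span S \<Longrightarrow> (\<lambda>x. f x + g x) \<in> mod_span S"

text \<open>Products of smooth functions are not closed under \<open>ddir\<close>, but finite sums
  of such products are, so the coinduction set is the span of all smooth functions.\<close>

lemma smooth_fun_mult:
  fixes f g :: "'a::real_normed_vector \<Rightarrow> complex"
  assumes "smooth_fun f" "smooth_fun g"
  shows "smooth_fun (\<lambda>x. f x * g x)"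
proof (rule smooth_fun_coinduct[where S = "mod_span {g. smooth_fun g}"])
  let ?S = "mod_span {g :: 'a \<Rightarrow> complex. smooth_fun g}"
  have D: "(\<forall>x. h differentiable at x) \<and> ddir v h \<in> ?S" if "h \<in> ?S" for h v
    using that
  proof induction
    case (base a f)
    then have sm: "smooth_fun a" "smooth_fun f" by auto
    then have "(\<lambda>x. a x * ddir v f x + ddir v a x * f x) \<in> ?S"
      by (intro mod_span.intros) (auto intro: smooth_fun_ddir)
    then show ?case using sm by (auto simp: ddir_mult intro: smooth_fun_differentiable differentiable_mult)
  next
    case (add f g)
    have "((\<lambda>x. f x + g x) has_derivative (\<lambda>v. ddir v f x + ddir v g x)) (at x)" for x
      by (intro derivative_intros differentiable_has_derivative_ddir) (use add in auto)
    then have "ddir v (\<lambda>x. f x + g x) = (\<lambda>x. ddir v f x + ddir v g x)"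
      by (intro ext ddir_eqI)
    then show ?case using add by (auto intro: mod_span.intros)
  qed
  then show "h differentiable at x" if "h \<in> ?S" for h x using that by auto
  show "ddir v h \<in> ?S" if "h \<in> ?S" for h v using D that by auto
  show "(\<lambda>x. f x * g x) \<in> ?S" using assms by (auto intro: mod_span.intros)
qed

text \<open>Coinduction up to smooth coefficients: derivatives of generators need only return to
  their span, since Leibniz then keeps the whole span closed. This suits functions that satisfy a
  differential equation, such as characters, reciprocals and exp(-1/t).\<close>

lemma smooth_fun_upto:
  fixes S :: "('a::real_normed_vector \<Rightarrow> complex) set"
  assumes "f \<in> S"
    and diff: "\<And>g x. g \<in> S \<Longrightarrow> g differentiable (at x)"
    and der: "\<And>g v. g \<in> S \<Longrightarrow> ddir v g \<in> mod_span S"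
  shows "smooth_fun f"
proof (rule smooth_fun_coinduct[where S = "mod_span S"])
  have mul: "(\<lambda>x. a x * h x) \<in> mod_span S" if "h \<in> mod_span S" "smooth_fun a" for a h
    using that
  proof induction
    case (base b f)
    then show ?case using mod_span.base[OF smooth_fun_mult[of a b], of f S] by (simp add: mult.assoc)
  next
    case (add f g)
    then show ?case using mod_span.add[of "\<lambda>x. a x * f x" S "\<lambda>x. a x * g x"] by (simp add: distrib_left)
  qed
  have D: "(\<forall>x. h differentiable at x) \<and> (\<forall>v. ddir v h \<in> mod_span S)" if "h \<in> mod_span S" for h
    using that
  proof induction
    case (base a f)
    have d: "((\<lambda>x. a x * f x) has_derivative (\<lambda>v. a x * ddir v f x + ddir v a x * f x)) (at x)" for x
      using base by (intro derivative_intros differentiable_has_derivative_ddir) (auto intro: smooth_fun_differentiable diff)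
    then have "ddir v (\<lambda>x. a x * f x) = (\<lambda>x. a x * ddir v f x + ddir v a x * f x)" for v
      by (intro ext ddir_eqI)
    moreover have "(\<lambda>x. a x * ddir v f x + ddir v a x * f x) \<in> mod_span S" for v
      using base by (intro mod_span.add mod_span.base[of "ddir v a"] mul der smooth_fun_ddir)
    ultimately show ?case using d by (auto simp: differentiable_def)
  next
    case (add f g)
    have d: "((\<lambda>x. f x + g x) has_derivative (\<lambda>v. ddir v f x + ddir v g x)) (at x)" for x
      by (intro derivative_intros differentiable_has_derivative_ddir) (use add in auto)
    then have "ddir v (\<lambda>x. f x + g x) = (\<lambda>x. ddir v f x + ddir v g x)" for v
      by (intro ext ddir_eqI)
    then show ?case using add d by (auto intro: mod_span.intros)
  qed
  show "h differentiable at x" if "h \<in> mod_span S" for h x using that D by auto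
  show "ddir v h \<in> mod_span S" if "h \<in> mod_span S" for h v using D that by auto
  show "f \<in> mod_span S"
    using mod_span.base[OF smooth_fun_const[of 1] \<open>f \<in> S\<close>] by simp
qed

text \<open>The powers of 1/q serve as generators: differentiating the n-th power gives the smooth
  coefficient -n \<open>ddir v q\<close> times the next power.\<close>

lemma smooth_fun_inverse:
  fixes q :: "'a::real_normed_vector \<Rightarrow> complex"
  assumes "smooth_fun q" "\<And>x. q x \<noteq> 0"
  shows "smooth_fun (\<lambda>x. inverse (q x))"
proof (rule smooth_fun_upto[where S = "range (\<lambda>n::nat. \<lambda>x. inverse (q x) ^ n)"])
  let ?S = "range (\<lambda>n::nat. \<lambda>x. inverse (q x) ^ n)"
  show "(\<lambda>x. inverse (q x)) \<in> ?S" by (auto intro!: image_eqI[of _ _ 1])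
  have d: "((\<lambda>x. inverse (q x) ^ n) has_derivative (\<lambda>v. (- of_nat n * ddir v q x) * inverse (q x) ^ Suc n)) (at x)" for n x
  proof (cases n)
    case (Suc m)
    show ?thesis unfolding Suc
      by (rule derivative_eq_intros has_derivative_ddir assms refl)+
         (auto simp: fun_eq_iff algebra_simps)
  qed (auto simp: has_derivative_const)
  then show "g differentiable at x" if "g \<in> ?S" for g x using that by (auto simp: differentiable_def)
  show "ddir v g \<in> mod_span ?S" if gS: "g \<in> ?S" for g v
  proof -
    obtain n where n: "g = (\<lambda>x. inverse (q x) ^ n)" using gS by blast
    have "ddir v g = (\<lambda>x. (- of_nat n * ddir v q x) * inverse (q x) ^ Suc n)"
      unfolding n by (intro ext ddir_eqI d)
    also have "\<dots> \<in> mod_span ?S"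
      by (rule mod_span.base[OF smooth_fun_cmult[OF smooth_fun_ddir[OF assms(1)]]]) (rule rangeI)
    finally show ?thesis .
  qed
qed

section \<open>Characters exp(-i x.xi)\<close>

definition echar :: "'a::euclidean_space \<Rightarrow> 'a \<Rightarrow> complex" where
  "echar \<xi> x = exp (- \<i> * of_real (x \<bullet> \<xi>))"

lemma norm_echar [simp]: "norm (echar \<xi> x) = 1"
  by (simp add: echar_def)

lemma echar_add: "echar \<xi> (x + y) = echar \<xi> x * echar \<xi> y"
  by (simp add: echar_def inner_left_distrib distrib_left mult_exp_exp)

lemma echar_add_freq: "echar (\<xi> + \<zeta>) x = echar \<xi> x * echar \<zeta> x"
  by (simp add: echar_def inner_right_distrib distrib_left mult_exp_exp)

lemma echar_commute: "echar \<xi> x = echar x \<xi>"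
  by (simp add: echar_def inner_commute)

lemma has_derivative_echar:
  "(echar \<xi> has_derivative (\<lambda>v. (- \<i> * of_real (v \<bullet> \<xi>)) * echar \<xi> x)) (at x)"
proof -
  have "((\<lambda>x. - \<i> * complex_of_real (x \<bullet> \<xi>)) has_derivative (\<lambda>v. - \<i> * of_real (v \<bullet> \<xi>))) (at x)"
    by (intro bounded_linear_imp_has_derivative bounded_linear_const_mult
        bounded_linear_compose[OF bounded_linear_of_real bounded_linear_inner_left])
  from has_derivative_compose[OF this DERIV_exp[unfolded has_field_derivative_def]] show ?thesis
    unfolding echar_def[abs_def] by (simp only: mult.commute[of "exp _"])
qed

lemma ddir_echar: "ddir v (echar \<xi>) = (\<lambda>x. (- \<i> * of_real (v \<bullet> \<xi>)) * echar \<xi> x)"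
  by (intro ext ddir_eqI has_derivative_echar)

lemma smooth_fun_echar: "smooth_fun (echar \<xi>)"
proof (rule smooth_fun_upto[where S = "{echar \<xi>}"])
  show "ddir v g \<in> mod_span {echar \<xi>}" if "g \<in> {echar \<xi>}" for g v
    using that mod_span.base[of "\<lambda>x. - \<i> * of_real (v \<bullet> \<xi>)" "echar \<xi>" "{echar \<xi>}"]
    by (simp add: ddir_echar smooth_fun_const)
qed (use has_derivative_echar[of \<xi>] in \<open>auto simp: differentiable_def\<close>)

text \<open>By the symmetry of x.xi the character can be differentiated in the frequency, where its
  derivative has norm at most \<open>norm x\<close>.\<close>

lemma norm_echar_diff_le: "norm (echar \<xi> x - echar \<zeta> x) \<le> norm (\<xi> - \<zeta>) * norm x"
proof -
  have "norm (echar x \<xi> - echar x \<zeta>) \<le> norm x * norm (\<xi> - \<zeta>)"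
  proof (rule differentiable_bound[where S = UNIV and f' = "\<lambda>\<xi> v. (- \<i> * of_real (v \<bullet> x)) * echar x \<xi>"])
    show "onorm (\<lambda>v. (- \<i> * of_real (v \<bullet> x)) * echar x \<zeta>) \<le> norm x" for \<zeta>
      by (rule onorm_le) (simp add: norm_mult, metis Cauchy_Schwarz_ineq2 mult.commute)
    show "(echar x has_derivative (\<lambda>v. (- \<i> * of_real (v \<bullet> x)) * echar x \<zeta>)) (at \<zeta> within UNIV)" for \<zeta>
      by (rule has_derivative_echar)
  qed simp_all
  then show ?thesis by (simp add: echar_commute mult.commute)
qed

section \<open>Iterated derivatives and the mean value inequality\<close>

lemma dderivs_add:
  "smooth_fun f \<Longrightarrow> smooth_fun g \<Longrightarrow> dderivs vs (\<lambda>x. f x + g x) = (\<lambda>x. dderivs vs f x + dderivs vs g x)"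
  by (induction vs) (simp_all add: dderivs_Cons_ddir ddir_add smooth_fun_dderivs del: dderivs.simps(2))

lemma dderivs_diff:
  "smooth_fun f \<Longrightarrow> smooth_fun g \<Longrightarrow> dderivs vs (\<lambda>x. f x - g x) = (\<lambda>x. dderivs vs f x - dderivs vs g x)"
  by (induction vs) (simp_all add: dderivs_Cons_ddir ddir_diff smooth_fun_dderivs del: dderivs.simps(2))

lemma dderivs_cmult:
  "smooth_fun f \<Longrightarrow> dderivs vs (\<lambda>x. c * f x :: complex) = (\<lambda>x. c * dderivs vs f x)"
  by (induction vs) (simp_all add: dderivs_Cons_ddir ddir_cmult smooth_fun_dderivs del: dderivs.simps(2))

lemma dderivs_const0: "dderivs vs (\<lambda>x. 0) = (\<lambda>x. 0)"
  by (induction vs) (simp_all add: dderivs_Cons_ddir ddir_const del: dderivs.simps(2))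

lemma dderivs_sum:
  "finite I \<Longrightarrow> (\<And>i. i \<in> I \<Longrightarrow> smooth_fun (f i)) \<Longrightarrow>
    dderivs vs (\<lambda>x. \<Sum>i\<in>I. f i x) = (\<lambda>x. \<Sum>i\<in>I. dderivs vs (f i) x)"
  by (induction I rule: finite_induct) (auto simp: dderivs_const0 dderivs_add smooth_fun_sum)

lemma dderivs_compose_affine:
  assumes "smooth_fun f"
  shows "dderivs vs (\<lambda>x. f (a *\<^sub>R x + z)) = (\<lambda>x. a ^ length vs *\<^sub>R dderivs vs f (a *\<^sub>R x + z))"
proof (induction vs)
  case (Cons v vs)
  have "smooth_fun (\<lambda>x. dderivs vs f (a *\<^sub>R x + z))"
    by (intro smooth_fun_compose_affine smooth_fun_dderivs assms)
  then show ?case using Cons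
    by (simp add: dderivs_Cons_ddir ddir_compose_linear[OF bounded_linear_scaleR_right]
        ddir_compose_affine smooth_fun_dderivs assms mult.commute del: dderivs.simps(2))
qed simp

text \<open>Schwartz seminorms only involve directions in \<open>Basis\<close>; linearity of the
  derivative recovers all other directions.\<close>

lemma ddir_Basis_sum:
  fixes f :: "'a::euclidean_space \<Rightarrow> 'b::real_normed_vector"
  assumes "smooth_fun f"
  shows "ddir v f x = (\<Sum>b\<in>Basis. (v \<bullet> b) *\<^sub>R ddir b f x)"
proof -
  interpret linear "\<lambda>v. ddir v f x"
    using has_derivative_linear[OF has_derivative_ddir[OF assms]] .
  show ?thesis
    by (subst euclidean_representation[of v, symmetric]) (simp only: sum scale)
qed

lemma norm_ddir_le:
  fixes f :: "'a::euclidean_space \<Rightarrow> 'b::real_normed_vector"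
  assumes "smooth_fun f"
  shows "norm (ddir v f x) \<le> norm v * (\<Sum>b\<in>Basis. norm (ddir b f x))"
  unfolding ddir_Basis_sum[OF assms, of v] sum_distrib_left
  by (rule sum_norm_le) (auto intro!: mult_right_mono Basis_le_norm)

text \<open>The bound is asked for on the segment only, so that a bound depending on the base point
  \<open>x\<close> can be inserted when weighted norms of differences are estimated.\<close>

lemma norm_diff_le_ddir:
  fixes f :: "'a::euclidean_space \<Rightarrow> 'b::real_normed_vector"
  assumes "smooth_fun f" and B: "\<And>y. y \<in> closed_segment x (x + h) \<Longrightarrow> (\<Sum>b\<in>Basis. norm (ddir b f y)) \<le> B"
  shows "norm (f (x + h) - f x) \<le> B * norm h"
proof -
  let ?S = "closed_segment x (x + h)"
  have "norm (f (x + h) - f x) \<le> B * norm ((x + h) - x)"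
  proof (rule differentiable_bound[where S = ?S and f' = "\<lambda>y v. ddir v f y"])
    show "(f has_derivative (\<lambda>v. ddir v f y)) (at y within ?S)" for y
      using has_derivative_ddir[OF assms(1)] has_derivative_at_withinI by blast
    show "onorm (\<lambda>v. ddir v f y) \<le> B" if "y \<in> ?S" for y
    proof (rule onorm_le)
      fix v
      from B[OF that] norm_ddir_le[OF assms(1), of v y] show "norm (ddir v f y) \<le> B * norm v"
        by (metis mult.commute mult_left_mono norm_ge_zero order_trans)
    qed
  qed auto
  then show ?thesis by simp
qed

section \<open>Bump functions and mollifiers\<close>

text \<open>\<open>flat 0\<close> is the standard smooth function exp(-1/t) that vanishes to
  infinite order at 0. The powers of 1/t make the family closed under differentiation up to linear
  combinations, as \<open>smooth_fun_upto\<close> requires.\<close>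

definition flat :: "nat \<Rightarrow> real \<Rightarrow> real" where
  "flat n t = (if t > 0 then exp (- (1 / t)) / t ^ n else 0)"

lemma flat_nonneg: "flat n t \<ge> 0"
  by (simp add: flat_def)

lemma flat_has_derivative:
  "(flat n has_real_derivative flat (n + 2) t - of_nat n * flat (n + 1) t) (at t)"
proof -
  consider "t < 0" | "t = 0" | "t > 0" by linarith
  then show ?thesis
  proof cases
    case 1
    have "((\<lambda>t::real. 0) has_real_derivative 0) (at t)" by simp
    then have "(flat n has_real_derivative 0) (at t)"
      by (rule has_field_derivative_transform_within_open[of _ _ _ "{..<0}"])
         (use 1 in \<open>auto simp: flat_def\<close>)
    then show ?thesis using 1 by (simp add: flat_def)
  next
    case 3
    have "((\<lambda>t. exp (- (1 / t)) / t ^ n) has_real_derivative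
        exp (- (1 / t)) / t ^ (n + 2) - of_nat n * (exp (- (1 / t)) / t ^ (n + 1))) (at t)"
    proof (cases n)
      case (Suc m)
      show ?thesis unfolding Suc using 3
        by (auto intro!: derivative_eq_intros simp: field_simps power2_eq_square) (cases m, auto)
    qed (use 3 in \<open>auto intro!: derivative_eq_intros simp: field_simps power2_eq_square\<close>)
    then have "(flat n has_real_derivative
        exp (- (1 / t)) / t ^ (n + 2) - of_nat n * (exp (- (1 / t)) / t ^ (n + 1))) (at t)"
      by (rule has_field_derivative_transform_within_open[of _ _ _ "{0<..}"])
         (use 3 in \<open>auto simp: flat_def\<close>)
    then show ?thesis using 3 by (simp add: flat_def)
  next
    case 2
    \<comment> \<open>At the origin the right difference quotient is \<open>flat n h / h\<close>;
      with s = 1/h it becomes s^(n+1) / exp s, and the exponential wins.\<close>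
    have "((\<lambda>s. s ^ Suc n / exp s :: real) \<longlongrightarrow> 0) at_top"
      by (rule tendsto_power_div_exp_0)
    then have "((\<lambda>h. inverse h ^ Suc n / exp (inverse h) :: real) \<longlongrightarrow> 0) (at_right 0)"
      by (rule filterlim_compose[OF _ filterlim_inverse_at_top_right])
    then have r: "((\<lambda>h. flat n h / h) \<longlongrightarrow> 0) (at_right 0)"
      by (rule Lim_transform_eventually)
         (auto simp: flat_def exp_minus field_simps eventually_at_right_less intro: eventually_mono[OF eventually_at_right_less])
    have l: "((\<lambda>h. flat n h / h) \<longlongrightarrow> 0) (at_left 0)"
      by (rule Lim_transform_eventually[OF tendsto_const])
         (auto simp: flat_def eventually_at_filter)
    have "((\<lambda>h. (flat n (0 + h) - flat n 0) / h) \<longlongrightarrow> 0) (at 0)"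
      using l r by (simp add: filterlim_split_at flat_def)
    then show ?thesis using 2 by (simp add: DERIV_def flat_def)
  qed
qed

text \<open>For positive \<open>r\<close>, \<open>c = 1\<close> gives a bump that is nonzero exactly
  on the open ball and \<open>c = -1\<close> a smooth function that is nonzero exactly off the
  closed ball. The squared norm keeps both smooth at the centre.\<close>

definition rad :: "real \<Rightarrow> real \<Rightarrow> 'a::euclidean_space \<Rightarrow> 'a \<Rightarrow> complex" where
  "rad c r x0 x = of_real (flat 0 (c * (r\<^sup>2 - (norm (x - x0))\<^sup>2)))"

lemma smooth_fun_rad: "smooth_fun (rad c r x0)"
proof (rule smooth_fun_upto[where S = "range (\<lambda>n x. of_real (flat n (c * (r\<^sup>2 - (norm (x - x0))\<^sup>2))))"])
  let ?g = "\<lambda>n x. complex_of_real (flat n (c * (r\<^sup>2 - (norm (x - x0))\<^sup>2)))"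
  let ?a = "\<lambda>v x. complex_of_real (- 2 * c * ((x - x0) \<bullet> v))"
  show "rad c r x0 \<in> range ?g" by (auto simp: rad_def[abs_def])
  have d: "(?g n has_derivative (\<lambda>v. ?a v x * ?g (n + 2) x + - of_nat n * ?a v x * ?g (n + 1) x)) (at x)" for n x
  proof -
    have "((\<lambda>x. c * (r\<^sup>2 - (norm (x - x0))\<^sup>2)) has_derivative (\<lambda>v. - 2 * c * ((x - x0) \<bullet> v))) (at x)"
      unfolding power2_norm_eq_inner
      by (auto intro!: derivative_eq_intros simp: fun_eq_iff inner_commute algebra_simps)
    then have "(?g n has_derivative (\<lambda>v. of_real (- 2 * c * ((x - x0) \<bullet> v) *
        (flat (n + 2) (c * (r\<^sup>2 - (norm (x - x0))\<^sup>2)) - of_nat n * flat (n + 1) (c * (r\<^sup>2 - (norm (x - x0))\<^sup>2)))))) (at x)"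
      by (intro has_derivative_of_real DERIV_compose_FDERIV[OF flat_has_derivative])
    then show ?thesis by (simp add: algebra_simps)
  qed
  have sa: "smooth_fun (?a v)" for v
  proof -
    have "?a v = (\<lambda>x. of_real (- 2 * c * (x \<bullet> v)) + of_real (2 * c * (x0 \<bullet> v)))"
      by (auto simp: fun_eq_iff algebra_simps)
    moreover have "smooth_fun (\<lambda>x. complex_of_real (- 2 * c * (x \<bullet> v)))"
      by (intro smooth_fun_linear bounded_linear_compose[OF bounded_linear_of_real] bounded_linear_const_mult
          bounded_linear_inner_left)
    ultimately show ?thesis by (simp only: smooth_fun_add smooth_fun_const)
  qed
  show "g differentiable at x" if "g \<in> range ?g" for g x
    using that d by (auto simp: differentiable_def)
  show "ddir v g \<in> mod_span (range ?g)" if gS: "g \<in> range ?g" for g v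
  proof -
    obtain n where n: "g = ?g n" using gS by blast
    have "ddir v g = (\<lambda>x. ?a v x * ?g (n + 2) x + - of_nat n * ?a v x * ?g (n + 1) x)"
      unfolding n by (intro ext ddir_eqI d)
    also have "\<dots> \<in> mod_span (range ?g)"
      by (intro mod_span.add mod_span.base smooth_fun_cmult sa rangeI)
    finally show ?thesis .
  qed
qed

lemma rad_inside: "0 < r \<Longrightarrow> rad 1 r x0 x \<noteq> 0 \<longleftrightarrow> dist x x0 < r"
proof -
  assume "0 < r"
  then have "(dist x x0)\<^sup>2 < r\<^sup>2 \<longleftrightarrow> dist x x0 < r"
    by (metis less_eq_real_def power2_less_imp_less power_strict_mono zero_le_dist zero_less_numeral)
  then show ?thesis by (simp add: rad_def flat_def dist_norm)
qed

lemma rad_outside: "0 < r \<Longrightarrow> rad (-1) r x0 x \<noteq> 0 \<longleftrightarrow> r < dist x x0"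
proof -
  assume "0 < r"
  then have "r\<^sup>2 < (dist x x0)\<^sup>2 \<longleftrightarrow> r < dist x x0"
    by (metis less_eq_real_def power2_less_imp_less power_strict_mono zero_le_dist zero_less_numeral)
  then show ?thesis by (simp add: rad_def flat_def dist_norm)
qed

section \<open>Test functions and their integrals\<close>

lemma test_fun_iff:
  "test_fun f \<longleftrightarrow> smooth_fun f \<and> (\<exists>R. \<forall>x. f x \<noteq> 0 \<longrightarrow> norm x \<le> R)"
proof -
  have "compact (fsupp f) \<longleftrightarrow> bounded {x. f x \<noteq> 0}"
    unfolding fsupp_def compact_eq_bounded_closed
    using bounded_closure bounded_subset[OF _ closure_subset] by auto
  then show ?thesis by (simp add: test_fun_def bounded_iff)
qed

lemma test_fun_bound:
  assumes "test_fun f"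
  shows "\<exists>R>0. \<forall>x. norm x > R \<longrightarrow> f x = 0"
proof -
  obtain R where "\<forall>x. f x \<noteq> 0 \<longrightarrow> norm x \<le> R"
    using assms unfolding test_fun_iff by blast
  then show ?thesis by (intro exI[of _ "max R 1"]) force
qed

lemma test_fun_smooth_fun: "test_fun f \<Longrightarrow> smooth_fun f"
  by (simp add: test_fun_def)

lemma test_fun_mult: "test_fun f \<Longrightarrow> smooth_fun g \<Longrightarrow> test_fun (\<lambda>x. f x * g x)"
  unfolding test_fun_iff by (auto simp: smooth_fun_mult)

lemma test_fun_rad: "test_fun (rad 1 r x0)"
proof -
  have "norm x \<le> norm x0 + \<bar>r\<bar>" if "rad 1 r x0 x \<noteq> 0" for x
  proof -
    have "(norm (x - x0))\<^sup>2 \<le> \<bar>r\<bar>\<^sup>2" using that by (auto simp: rad_def flat_def split: if_splits)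
    then have "norm (x - x0) \<le> \<bar>r\<bar>" by (rule power2_le_imp_le) simp
    then show ?thesis using norm_triangle_ineq2[of x x0] by linarith
  qed
  then show ?thesis unfolding test_fun_iff using smooth_fun_rad by blast
qed

lemma ddir_eq_0_outside:
  assumes "\<And>x. norm x > R \<Longrightarrow> f x = 0" "norm x > R"
  shows "ddir v f x = 0"
proof (rule ddir_eqI)
  have "open {x::'a. R < norm x}" by (intro open_Collect_less continuous_intros)
  then show "(f has_derivative (\<lambda>v. 0)) (at x)"
    using has_derivative_transform_within_open[of "\<lambda>_. 0" "\<lambda>_. 0" x UNIV "{x. R < norm x}" f] assms by auto
qed

lemma test_fun_ddir: "test_fun f \<Longrightarrow> test_fun (ddir v f)"
  unfolding test_fun_iff using smooth_fun_ddir ddir_eq_0_outside[of _ f] by (metis linorder_not_less)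

lemma test_fun_dderivs: "test_fun f \<Longrightarrow> test_fun (dderivs vs f)"
  by (induction vs) (simp_all add: dderivs_Cons_ddir test_fun_ddir del: dderivs.simps(2))

lemma test_fun_affine:
  assumes "test_fun f" "a \<noteq> 0"
  shows "test_fun (\<lambda>x. f (a *\<^sub>R x + z))"
proof -
  obtain R where R: "R > 0" "\<And>x. norm x > R \<Longrightarrow> f x = 0" using test_fun_bound[OF assms(1)] by blast
  have "norm x \<le> (R + norm z) / \<bar>a\<bar>" if "f (a *\<^sub>R x + z) \<noteq> 0" for x
  proof -
    have "norm (a *\<^sub>R x + z) \<le> R" using R(2) that by force
    then have "\<bar>a\<bar> * norm x \<le> R + norm z" using norm_triangle_ineq4[of "a *\<^sub>R x + z" z] by simp
    then show ?thesis using assms(2) by (simp add: field_simps)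
  qed
  then show ?thesis
    unfolding test_fun_iff using smooth_fun_compose_affine test_fun_smooth_fun[OF assms(1)] by blast
qed

lemma integrable_test_fun:
  assumes "test_fun (f :: 'a::euclidean_space \<Rightarrow> complex)"
  shows "integrable lborel f"
proof -
  obtain R where R: "R > 0" "\<And>x. norm x > R \<Longrightarrow> f x = 0" using test_fun_bound[OF assms] by blast
  have "integrable lborel (\<lambda>x. indicator (cball 0 R) x *\<^sub>R f x)"
    by (rule borel_integrable_compact) (auto intro: smooth_fun_continuous_on test_fun_smooth_fun assms)
  moreover have "(\<lambda>x. indicator (cball 0 R) x *\<^sub>R f x) = f"
    using R(2) by (auto simp: indicator_def fun_eq_iff)
  ultimately show ?thesis by simp
qed

text \<open>The set where \<open>f\<close> is nonzero is open, and a nonempty open set is never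
  Lebesgue null.\<close>

lemma continuous_AE_zero:
  fixes f :: "'a::euclidean_space \<Rightarrow> complex"
  assumes "continuous_on UNIV f" "AE x in lborel. f x = 0"
  shows "f x = 0"
proof (rule ccontr)
  assume "f x \<noteq> 0"
  have "open {x. f x \<noteq> 0}" using assms(1) by (intro open_Collect_neq) auto
  moreover have "{x. f x \<noteq> 0} \<in> null_sets lborel"
    using assms(2) AE_iff_null_sets[of "{x. f x \<noteq> 0}" lborel] \<open>open _\<close> by (auto simp: eventually_mono)
  ultimately show False
    using open_not_negligible[of "{x. f x \<noteq> 0}"] \<open>f x \<noteq> 0\<close>
    by (auto simp: negligible_iff_null_sets null_sets_completionI)
qed

lemma integral_pos_if_continuous:
  fixes f :: "'a::euclidean_space \<Rightarrow> real"
  assumes "continuous_on UNIV f" "integrable lborel f" "\<And>x. f x \<ge> 0" "f x0 \<noteq> 0"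
  shows "integral\<^sup>L lborel f > 0"
proof -
  have "integral\<^sup>L lborel f \<noteq> 0"
  proof
    assume "integral\<^sup>L lborel f = 0"
    then have "AE x in lborel. f x = 0"
      using assms by (simp add: integral_nonneg_eq_0_iff_AE)
    then have "complex_of_real (f x0) = 0"
      by (intro continuous_AE_zero[of "\<lambda>x. complex_of_real (f x)"]) (auto intro!: continuous_intros assms)
    then show False using assms(4) by simp
  qed
  then show ?thesis using assms(3) by (simp add: less_le integral_nonneg_AE)
qed

lemma integral_rad_nonzero:
  assumes "r > 0"
  shows "integral\<^sup>L lborel (rad 1 r (x0::'a::euclidean_space)) \<noteq> 0"
proof -
  let ?f = "\<lambda>x::'a. Re (rad 1 r x0 x)"
  have "integral\<^sup>L lborel ?f > 0"
  proof (rule integral_pos_if_continuous[of _ x0])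
    show "continuous_on UNIV ?f" by (intro continuous_intros smooth_fun_continuous_on smooth_fun_rad)
    show "integrable lborel ?f" by (intro integrable_Re integrable_test_fun test_fun_rad)
    show "?f x0 \<noteq> 0" using rad_inside[OF assms, of x0 x0] assms by (simp add: rad_def)
  qed (simp add: rad_def flat_nonneg)
  moreover have "integral\<^sup>L lborel ?f = Re (integral\<^sup>L lborel (rad 1 r x0))"
    by (rule integral_Re[OF integrable_test_fun[OF test_fun_rad]])
  ultimately show ?thesis by auto
qed

section \<open>Moments of mollifiers\<close>

lemma smooth_fun_of_real_power: "smooth_fun (\<lambda>t::real. of_real (t ^ j) :: complex)"
proof (induction j)
  case (Suc j)
  have "smooth_fun (\<lambda>t. complex_of_real t * of_real (t ^ j))"
    by (intro smooth_fun_mult smooth_fun_linear bounded_linear_of_real Suc)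
  then show ?case by simp
qed (simp add: smooth_fun_const)

lemma integral_dil:
  assumes "\<epsilon> > 0"
  shows "integral\<^sup>L lborel (\<lambda>t. of_real (t ^ j) * dil \<epsilon> \<phi> t) = of_real (\<epsilon> ^ j) * integral\<^sup>L lborel (\<lambda>t. of_real (t ^ j) * \<phi> t)"
proof -
  have "integral\<^sup>L lborel (\<lambda>t. of_real (t ^ j) * dil \<epsilon> \<phi> t) =
      \<epsilon> *\<^sub>R integral\<^sup>L lborel (\<lambda>t. of_real ((\<epsilon> * t) ^ j) * dil \<epsilon> \<phi> (\<epsilon> * t))"
    using lborel_integral_real_affine[of \<epsilon> "\<lambda>t. of_real (t ^ j) * dil \<epsilon> \<phi> t" 0] assms by simp
  also have "\<dots> = integral\<^sup>L lborel (\<lambda>t. of_real (\<epsilon> ^ j) * (of_real (t ^ j) * \<phi> t))"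
    unfolding integral_scaleR_right[symmetric]
    by (intro Bochner_Integration.integral_cong) (use assms in \<open>auto simp: dil_def power_mult_distrib scaleR_conv_of_real\<close>)
  finally show ?thesis by simp
qed

text \<open>Dilation by 2 multiplies the j-th moment by 2^j, so an affine combination of \<phi> and
  its dilate keeps total mass 1 and the vanishing of moments 1 to q, while its coefficient can be
  tuned to kill moment q + 1.\<close>

lemma mollA_nonempty: "mollA q \<noteq> {}"
proof (induction q)
  case 0
  define I where "I = integral\<^sup>L lborel (rad 1 1 (0::real))"
  have "I \<noteq> 0" unfolding I_def by (rule integral_rad_nonzero) simp
  then have "(\<lambda>t. rad 1 1 0 t * inverse I) \<in> mollA 0"
    by (auto simp: mollA_def test_fun_mult test_fun_rad smooth_fun_const I_def)
  then show ?case by blast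
next
  case (Suc q)
  then obtain \<phi> where \<phi>: "\<phi> \<in> mollA q" by auto
  have t: "test_fun \<phi>" and one: "integral\<^sup>L lborel \<phi> = 1"
    and mom: "\<And>j. j \<in> {1..q} \<Longrightarrow> integral\<^sup>L lborel (\<lambda>t. of_real (t ^ j) * \<phi> t) = 0"
    using \<phi> by (auto simp: mollA_def)
  \<comment> \<open>The solution of 1 - b + b 2^(q+1) = 0; the left side is the factor by which
    moment q + 1 changes.\<close>
  define b :: complex where "b = 1 / (1 - 2 ^ Suc q)"
  define \<psi> where "\<psi> = (\<lambda>t. (1 - b) * \<phi> t + b * dil 2 \<phi> t)"
  have td: "test_fun (dil 2 \<phi>)"
  proof -
    have "dil 2 \<phi> = (\<lambda>t. \<phi> ((1/2) *\<^sub>R t + 0) * (1/2))" by (auto simp: dil_def fun_eq_iff)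
    moreover have "test_fun (\<lambda>t. \<phi> ((1/2) *\<^sub>R t + 0) * (1/2))"
      by (intro test_fun_mult test_fun_affine t smooth_fun_const) simp
    ultimately show ?thesis by (simp only:)
  qed
  have "(2::real) ^ Suc q > 1" by (rule one_less_power) auto
  then have "complex_of_real (2 ^ Suc q) \<noteq> of_real 1" by (simp only: of_real_eq_iff)
  then have b: "1 - b + b * 2 ^ Suc q = 0" by (simp add: b_def field_simps)
  have i1: "integrable lborel (\<lambda>t. of_real (t ^ j) * \<phi> t)" 
    and i2: "integrable lborel (\<lambda>t. of_real (t ^ j) * dil 2 \<phi> t)" for j
    using integrable_test_fun[OF test_fun_mult[OF t smooth_fun_of_real_power]]
      integrable_test_fun[OF test_fun_mult[OF td smooth_fun_of_real_power]] by (simp_all add: mult.commute)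
  have eq: "integral\<^sup>L lborel (\<lambda>t. of_real (t ^ j) * \<psi> t) =
      (1 - b + b * 2 ^ j) * integral\<^sup>L lborel (\<lambda>t. of_real (t ^ j) * \<phi> t)" for j
  proof -
    have "integral\<^sup>L lborel (\<lambda>t. of_real (t ^ j) * \<psi> t) =
      integral\<^sup>L lborel (\<lambda>t. (1 - b) * (of_real (t ^ j) * \<phi> t) + b * (of_real (t ^ j) * dil 2 \<phi> t))"
      by (simp add: \<psi>_def algebra_simps)
    also have "\<dots> = (1 - b) * integral\<^sup>L lborel (\<lambda>t. of_real (t ^ j) * \<phi> t)
        + b * integral\<^sup>L lborel (\<lambda>t. of_real (t ^ j) * dil 2 \<phi> t)"
      using i1 i2 by (subst Bochner_Integration.integral_add) auto
    also have "\<dots> = (1 - b + b * 2 ^ j) * integral\<^sup>L lborel (\<lambda>t. of_real (t ^ j) * \<phi> t)"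
      by (subst integral_dil) (auto simp: algebra_simps)
    finally show ?thesis .
  qed
  have "test_fun \<psi>"
  proof -
    obtain R where R: "R > 0" "\<And>x. norm x > R \<Longrightarrow> \<phi> x = 0" using test_fun_bound[OF t] by blast
    obtain R' where R': "R' > 0" "\<And>x. norm x > R' \<Longrightarrow> dil 2 \<phi> x = 0" using test_fun_bound[OF td] by blast
    have "\<psi> x = 0" if "norm x > max R R'" for x using that R(2)[of x] R'(2)[of x] by (simp add: \<psi>_def)
    then have "\<forall>x. \<psi> x \<noteq> 0 \<longrightarrow> norm x \<le> max R R'" by (metis not_le)
    moreover have "smooth_fun \<psi>" unfolding \<psi>_def
      by (intro smooth_fun_add smooth_fun_cmult test_fun_smooth_fun t td)
    ultimately show ?thesis unfolding test_fun_iff by blast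
  qed
  moreover have "integral\<^sup>L lborel \<psi> = 1" using eq[of 0] one by simp
  moreover have "integral\<^sup>L lborel (\<lambda>t. of_real (t ^ j) * \<psi> t) = 0" if "j \<in> {1..Suc q}" for j
  proof (cases "j = Suc q")
    case True
    then show ?thesis unfolding eq using b by simp
  next
    case False
    then show ?thesis unfolding eq using mom[of j] that by simp
  qed
  ultimately have "\<psi> \<in> mollA (Suc q)" by (simp add: mollA_def)
  then show ?case by blast
qed

lemma lsupp_props:
  assumes "\<phi> \<in> mollA q"
  shows lsupp_pos: "lsupp \<phi> > 0"
    and lsupp_dil: "\<epsilon> > 0 \<Longrightarrow> lsupp (dil \<epsilon> \<phi>) = \<epsilon> * lsupp \<phi>"
proof -
  have t: "test_fun \<phi>" and one: "integral\<^sup>L lborel \<phi> = 1" using assms by (auto simp: mollA_def)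
  obtain R where R: "R > 0" "\<And>x. norm x > R \<Longrightarrow> \<phi> x = 0" using test_fun_bound[OF t] by blast
  define S where "S = {\<bar>t\<bar> | t. \<phi> t \<noteq> 0}"
  have bdd: "bdd_above S" using R(2) by (intro bdd_aboveI[of _ R]) (force simp: S_def)
  \<comment> \<open>A function that vanishes off the single point 0 has integral 0, so the integral
    1 forces a nonzero value elsewhere. This excludes \<open>lsupp \<phi> = 0\<close>.\<close>
  obtain t0 where t0: "\<phi> t0 \<noteq> 0" "t0 \<noteq> 0"
  proof (rule ccontr)
    assume "\<not> thesis"
    with that have "\<phi> t = 0" if "t \<noteq> 0" for t using \<open>t \<noteq> 0\<close> by blast
    then have "AE t in lborel. \<phi> t = 0" using AE_lborel_singleton[of 0] by (auto elim!: eventually_mono)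
    then have "integral\<^sup>L lborel \<phi> = 0" by (simp add: integral_eq_zero_AE)
    then show False using one by simp
  qed
  then have inS: "\<bar>t0\<bar> \<in> S" by (auto simp: S_def)
  then have "\<bar>t0\<bar> \<le> Sup S" using bdd by (rule cSup_upper)
  then show "lsupp \<phi> > 0" using t0 by (simp add: lsupp_def S_def)
  assume e: "\<epsilon> > 0"
  have "{\<bar>t\<bar> | t. dil \<epsilon> \<phi> t \<noteq> 0} = (\<lambda>s. \<epsilon> * s) ` S" (is "?L = ?R")
  proof
    show "?L \<subseteq> ?R"
    proof
      fix s assume "s \<in> ?L"
      then obtain t where "s = \<bar>t\<bar>" "dil \<epsilon> \<phi> t \<noteq> 0" by auto
      then show "s \<in> ?R" using e
        by (auto simp: S_def dil_def intro!: image_eqI[of _ _ "\<bar>t / \<epsilon>\<bar>"] exI[of _ "t / \<epsilon>"])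
    qed
    show "?R \<subseteq> ?L"
    proof
      fix s assume "s \<in> ?R"
      then obtain t where "s = \<epsilon> * \<bar>t\<bar>" "\<phi> t \<noteq> 0" by (auto simp: S_def)
      then show "s \<in> ?L" using e by (auto simp: dil_def abs_mult intro!: exI[of _ "\<epsilon> * t"])
    qed
  qed
  moreover have "Sup ((\<lambda>s. \<epsilon> * s) ` S) = \<epsilon> * Sup S"
  proof -
    have bdd': "bdd_above ((\<lambda>s. \<epsilon> * s) ` S)"
      by (rule bdd_above_image_mono[OF _ bdd]) (use e in \<open>auto intro: monoI\<close>)
    have "Sup S \<le> Sup ((\<lambda>s. \<epsilon> * s) ` S) / \<epsilon>"
    proof (rule cSup_least)
      fix s assume "s \<in> S"
      then have "\<epsilon> * s \<le> Sup ((\<lambda>s. \<epsilon> * s) ` S)" using bdd' by (intro cSup_upper) auto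
      then show "s \<le> Sup ((\<lambda>s. \<epsilon> * s) ` S) / \<epsilon>" using e by (simp add: field_simps)
    qed (use inS in auto)
    moreover have "Sup ((\<lambda>s. \<epsilon> * s) ` S) \<le> \<epsilon> * Sup S"
      using inS e bdd by (intro cSup_least) (auto intro!: mult_left_mono cSup_upper)
    ultimately show ?thesis using e by (simp add: field_simps)
  qed
  ultimately show "lsupp (dil \<epsilon> \<phi>) = \<epsilon> * lsupp \<phi>" by (simp add: lsupp_def S_def)
qed

section \<open>Schwartz functions and integrals of tempered distributions over parameters\<close>

text \<open>An upper-bound form of the Schwartz seminorms. It avoids the \<open>Sup\<close> in
  \<open>schwartz_seminorm\<close>, which says nothing before boundedness is known, and lets
  estimates be combined as inequalities. One index limits both the order of derivatives and the
  weight.\<close>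

definition sbd :: "nat \<Rightarrow> ('a::euclidean_space \<Rightarrow> complex) \<Rightarrow> real \<Rightarrow> bool" where
  "sbd N f B \<longleftrightarrow> (\<forall>vs\<in>dirs_upto N. \<forall>x. (1 + norm x) ^ N * norm (dderivs vs f x) \<le> B)"

lemma finite_dirs_upto: "finite (dirs_upto N)"
  unfolding dirs_upto_def by (rule finite_lists_length_le) simp

lemma Nil_dirs_upto [simp]: "[] \<in> dirs_upto N"
  by (simp add: dirs_upto_def)

lemma sbdD: "sbd N f B \<Longrightarrow> vs \<in> dirs_upto N \<Longrightarrow> (1 + norm x) ^ N * norm (dderivs vs f x) \<le> B"
  by (simp add: sbd_def)

lemma sbd_nonneg: "sbd N f B \<Longrightarrow> 0 \<le> B"
  using sbdD[of N f B "[]" 0] by simp (metis norm_ge_zero order_trans)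

lemma sbd_mono: "sbd N f B \<Longrightarrow> B \<le> B' \<Longrightarrow> sbd N f B'"
  unfolding sbd_def by (meson order_trans)

lemma sbd_deriv_norm: "sbd N f B \<Longrightarrow> vs \<in> dirs_upto N \<Longrightarrow> norm (dderivs vs f x) \<le> B"
proof -
  assume a: "sbd N f B" "vs \<in> dirs_upto N"
  have "1 * norm (dderivs vs f x) \<le> (1 + norm x) ^ N * norm (dderivs vs f x)"
    by (intro mult_right_mono one_le_power) auto
  with sbdD[OF a, of x] show ?thesis by simp
qed

lemma sbd_norm: "sbd N f B \<Longrightarrow> norm (f x) \<le> B"
  using sbd_deriv_norm[of N f B "[]" x] by simp

lemma sbd_le:
  assumes "sbd N f B" "k \<le> N"
  shows "sbd k f B"
  unfolding sbd_def
proof (intro ballI allI)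
  fix vs :: "'a list" and x :: 'a assume "vs \<in> dirs_upto k"
  then have "vs \<in> dirs_upto N" using assms(2) by (auto simp: dirs_upto_def)
  have "(1 + norm x) ^ k * norm (dderivs vs f x) \<le> (1 + norm x) ^ N * norm (dderivs vs f x)"
    by (intro mult_right_mono power_increasing assms) auto
  also have "\<dots> \<le> B" by (rule sbdD) fact+
  finally show "(1 + norm x) ^ k * norm (dderivs vs f x) \<le> B" .
qed

lemma sbd_add:
  assumes "smooth_fun f" "smooth_fun g" "sbd N f B" "sbd N g B'"
  shows "sbd N (\<lambda>x. f x + g x) (B + B')"
  unfolding sbd_def
proof (intro ballI allI)
  fix vs :: "'a list" and x :: 'a assume vs: "vs \<in> dirs_upto N"
  have "(1 + norm x) ^ N * norm (dderivs vs f x + dderivs vs g x)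
      \<le> (1 + norm x) ^ N * norm (dderivs vs f x) + (1 + norm x) ^ N * norm (dderivs vs g x)"
    unfolding distrib_left[symmetric] by (intro mult_left_mono norm_triangle_ineq) auto
  also have "\<dots> \<le> B + B'" by (intro add_mono sbdD[OF _ vs] assms)
  finally show "(1 + norm x) ^ N * norm (dderivs vs (\<lambda>x. f x + g x) x) \<le> B + B'"
    by (simp add: dderivs_add assms)
qed

lemma sbd_cmult:
  assumes "smooth_fun f" "sbd N f B"
  shows "sbd N (\<lambda>x. c * f x) (norm c * B)"
  unfolding sbd_def
proof (intro ballI allI)
  fix vs :: "'a list" and x :: 'a assume vs: "vs \<in> dirs_upto N"
  have "norm c * ((1 + norm x) ^ N * norm (dderivs vs f x)) \<le> norm c * B"
    by (intro mult_left_mono sbdD[OF _ vs] assms) auto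
  then show "(1 + norm x) ^ N * norm (dderivs vs (\<lambda>x. c * f x) x) \<le> norm c * B"
    by (simp add: dderivs_cmult assms norm_mult mult_ac)
qed

text \<open>One unit of the index pays for the extra derivative; the sum comes from expanding
  \<open>v\<close> in the basis.\<close>

lemma sbd_ddir:
  assumes "smooth_fun f" "sbd (Suc N) f B"
  shows "sbd N (ddir v f) ((\<Sum>b\<in>Basis. \<bar>v \<bullet> b\<bar>) * B)"
  unfolding sbd_def
proof (intro ballI allI)
  fix vs :: "'a list" and x :: 'a assume vs: "vs \<in> dirs_upto N"
  have "ddir v f = (\<lambda>x. \<Sum>b\<in>Basis. of_real (v \<bullet> b) * ddir b f x)"
    by (intro ext) (simp add: ddir_Basis_sum[OF assms(1), of v] scaleR_conv_of_real)
  then have "dderivs vs (ddir v f) x = (\<Sum>b\<in>Basis. of_real (v \<bullet> b) * dderivs vs (ddir b f) x)"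
    by (simp add: dderivs_sum dderivs_cmult smooth_fun_cmult smooth_fun_ddir assms)
  then have "(1 + norm x) ^ N * norm (dderivs vs (ddir v f) x)
      \<le> (1 + norm x) ^ N * (\<Sum>b\<in>Basis. \<bar>v \<bullet> b\<bar> * norm (dderivs vs (ddir b f) x))"
    by (intro mult_left_mono) (auto intro!: sum_norm_le simp: norm_mult)
  also have "\<dots> = (\<Sum>b\<in>Basis. \<bar>v \<bullet> b\<bar> * ((1 + norm x) ^ N * norm (dderivs (vs @ [b]) f x)))"
    by (simp add: sum_distrib_left dderivs_snoc mult_ac)
  also have "\<dots> \<le> (\<Sum>b\<in>Basis. \<bar>v \<bullet> b\<bar> * B)"
  proof (intro sum_mono mult_left_mono)
    fix b :: 'a assume b: "b \<in> Basis"
    have "(1 + norm x) ^ N * norm (dderivs (vs @ [b]) f x) \<le> (1 + norm x) ^ Suc N * norm (dderivs (vs @ [b]) f x)"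
      by (intro mult_right_mono power_increasing) auto
    also have "\<dots> \<le> B" by (rule sbdD[OF assms(2)]) (use vs b in \<open>auto simp: dirs_upto_def\<close>)
    finally show "(1 + norm x) ^ N * norm (dderivs (vs @ [b]) f x) \<le> B" .
  qed auto
  finally show "(1 + norm x) ^ N * norm (dderivs vs (ddir v f) x) \<le> (\<Sum>b\<in>Basis. \<bar>v \<bullet> b\<bar>) * B"
    by (simp add: sum_distrib_right)
qed

lemma schwartz_iff: "schwartz f \<longleftrightarrow> smooth_fun f \<and> (\<forall>N. \<exists>B. sbd N f B)"
proof
  assume s: "schwartz f"
  have "\<exists>B. sbd N f B" for N
  proof -
    have "\<exists>B. \<forall>x. (1 + norm x) ^ N * norm (dderivs vs f x) \<le> B" if "vs \<in> dirs_upto N" for vs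
    proof -
      have "bounded (range (\<lambda>x. (1 + norm x) ^ N * norm (dderivs vs f x)))"
        using s that by (auto simp: schwartz_def dirs_upto_def)
      then obtain B where "\<forall>x. \<bar>(1 + norm x) ^ N * norm (dderivs vs f x)\<bar> \<le> B"
        by (auto simp: bounded_iff)
      then show ?thesis by (meson abs_le_D1)
    qed
    then obtain B where B: "\<And>vs x. vs \<in> dirs_upto N \<Longrightarrow> (1 + norm x) ^ N * norm (dderivs vs f x) \<le> B vs"
      by metis
    have pos: "0 \<le> B vs" if "vs \<in> dirs_upto N" for vs
      using B[OF that, of 0] by simp (metis norm_ge_zero order_trans)
    have "sbd N f (\<Sum>vs\<in>dirs_upto N. B vs)"
      unfolding sbd_def
      by (meson B finite_dirs_upto member_le_sum order_trans pos DiffD1)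
    then show ?thesis by blast
  qed
  then show "smooth_fun f \<and> (\<forall>N. \<exists>B. sbd N f B)" using s by (auto simp: schwartz_def)
next
  assume s: "smooth_fun f \<and> (\<forall>N. \<exists>B. sbd N f B)"
  show "schwartz f"
    unfolding schwartz_def
  proof (intro conjI allI impI)
    fix vs :: "'a list" and k assume vs: "set vs \<subseteq> Basis"
    let ?N = "max k (length vs)"
    obtain B where B: "sbd ?N f B" using s by blast
    have "(1 + norm x) ^ k * norm (dderivs vs f x) \<le> B" for x
    proof -
      have "(1 + norm x) ^ k * norm (dderivs vs f x) \<le> (1 + norm x) ^ ?N * norm (dderivs vs f x)"
        by (intro mult_right_mono power_increasing) auto
      also have "\<dots> \<le> B" by (rule sbdD[OF B]) (use vs in \<open>auto simp: dirs_upto_def\<close>)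
      finally show ?thesis .
    qed
    then show "bounded (range (\<lambda>x. (1 + norm x) ^ k * norm (dderivs vs f x)))"
      by (auto simp: bounded_iff intro!: exI[of _ B])
  qed (use s in blast)
qed

lemma schwartz_smooth_fun: "schwartz f \<Longrightarrow> smooth_fun f"
  by (simp add: schwartz_def)

lemma schwartz_add: "schwartz f \<Longrightarrow> schwartz g \<Longrightarrow> schwartz (\<lambda>x. f x + g x)"
  unfolding schwartz_iff using smooth_fun_add sbd_add by blast

lemma schwartz_cmult: "schwartz f \<Longrightarrow> schwartz (\<lambda>x. c * f x)"
  unfolding schwartz_iff using smooth_fun_cmult sbd_cmult by blast

lemma schwartz_diff: "schwartz f \<Longrightarrow> schwartz g \<Longrightarrow> schwartz (\<lambda>x. f x - g x)"
  using schwartz_add[OF _ schwartz_cmult[of g "-1"]] by simp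

lemma schwartz_ddir: "schwartz f \<Longrightarrow> schwartz (ddir v f)"
  unfolding schwartz_iff using smooth_fun_ddir sbd_ddir by blast

lemma schwartz_zero: "schwartz (\<lambda>x. 0)"
  by (auto simp: schwartz_iff smooth_fun_const sbd_def dderivs_const0)

lemma schwartz_sum:
  "finite I \<Longrightarrow> (\<And>i. i \<in> I \<Longrightarrow> schwartz (f i)) \<Longrightarrow> schwartz (\<lambda>x. \<Sum>i\<in>I. f i x)"
  by (induction I rule: finite_induct) (auto simp: schwartz_zero schwartz_add)

lemma test_fun_schwartz:
  assumes "test_fun f"
  shows "schwartz f"
  unfolding schwartz_def
proof (intro conjI allI impI)
  fix vs :: "'a list" and k
  have t: "test_fun (dderivs vs f)" by (rule test_fun_dderivs[OF assms])
  obtain R where R: "R > 0" "\<And>x. norm x > R \<Longrightarrow> dderivs vs f x = 0" using test_fun_bound[OF t] by blast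
  let ?h = "\<lambda>x. (1 + norm x) ^ k * norm (dderivs vs f x)"
  have "compact (?h ` cball 0 R)"
    by (intro compact_continuous_image continuous_intros smooth_fun_continuous_on test_fun_smooth_fun t) auto
  then have "bounded (insert 0 (?h ` cball 0 R))" by (simp add: compact_imp_bounded)
  moreover have "range ?h \<subseteq> insert 0 (?h ` cball 0 R)" using R(2) by force
  ultimately show "bounded (range ?h)" by (rule bounded_subset)
qed (rule test_fun_smooth_fun[OF assms])

section \<open>Tempered distributions\<close>

lemma tempered_add: "tempered w \<Longrightarrow> schwartz f \<Longrightarrow> schwartz g \<Longrightarrow> w (\<lambda>x. f x + g x) = w f + w g"
  by (simp add: tempered_def)

lemma tempered_cmult: "tempered w \<Longrightarrow> schwartz f \<Longrightarrow> w (\<lambda>x. c * f x) = c * w f"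
  by (simp add: tempered_def)

lemma tempered_diff: "tempered w \<Longrightarrow> schwartz f \<Longrightarrow> schwartz g \<Longrightarrow> w (\<lambda>x. f x - g x) = w f - w g"
  using tempered_add[of w f "\<lambda>x. -1 * g x"] tempered_cmult[of w g "-1"] schwartz_cmult[of g "-1"] by simp

lemma tempered_sum:
  assumes "tempered w"
  shows "finite I \<Longrightarrow> (\<And>i. i \<in> I \<Longrightarrow> schwartz (f i)) \<Longrightarrow> w (\<lambda>x. \<Sum>i\<in>I. f i x) = (\<Sum>i\<in>I. w (f i))"
proof (induction I rule: finite_induct)
  case empty
  then show ?case using tempered_cmult[OF assms schwartz_zero, of 0] by simp
next
  case (insert i I)
  then show ?case by (simp add: tempered_add[OF assms] schwartz_sum)
qed

text \<open>The seminorm is a sum of one supremum for each list in \<open>dirs_upto N\<close>, each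
  at most \<open>B\<close>; hence the cardinality in the constant. The absolute value of
  \<open>C\<close> is taken because its sign is not prescribed.\<close>

lemma tempered_bound:
  assumes "tempered (w :: ('a::euclidean_space \<Rightarrow> complex) \<Rightarrow> complex)"
  obtains C N where "C \<ge> 0" "\<And>f B. schwartz f \<Longrightarrow> sbd N f B \<Longrightarrow> norm (w f) \<le> C * B"
proof -
  obtain C N where CN: "\<And>f. schwartz f \<Longrightarrow> norm (w f) \<le> C * schwartz_seminorm N f"
    using assms by (auto simp: tempered_def)
  let ?C = "\<bar>C\<bar> * card (dirs_upto N :: 'a list set)"
  have "norm (w f) \<le> ?C * B" if f: "schwartz f" and B: "sbd N f B" for f B
  proof -
    let ?S = "\<lambda>vs. Sup (range (\<lambda>x. (1 + norm x) ^ N * norm (dderivs vs f x)))"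
    have le: "?S vs \<le> B" if "vs \<in> dirs_upto N" for vs
      by (rule cSUP_least) (auto intro: sbdD[OF B that])
    have nonneg: "0 \<le> ?S vs" if "vs \<in> dirs_upto N" for vs
    proof -
      have "bdd_above (range (\<lambda>x. (1 + norm x) ^ N * norm (dderivs vs f x)))"
        by (rule bdd_aboveI2) (rule sbdD[OF B that])
      then have "(1 + norm (0::'a)) ^ N * norm (dderivs vs f 0) \<le> ?S vs" by (rule cSUP_upper[OF UNIV_I])
      moreover have "0 \<le> (1 + norm (0::'a)) ^ N * norm (dderivs vs f 0)" by simp
      ultimately show ?thesis by linarith
    qed
    have "norm (w f) \<le> C * schwartz_seminorm N f" by (rule CN[OF f])
    also have "\<dots> \<le> \<bar>C\<bar> * schwartz_seminorm N f"
      unfolding schwartz_seminorm_def by (intro mult_right_mono sum_nonneg nonneg) auto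
    also have "\<dots> \<le> \<bar>C\<bar> * (\<Sum>vs\<in>(dirs_upto N :: 'a list set). B)"
      unfolding schwartz_seminorm_def by (intro mult_left_mono sum_mono le) auto
    finally show ?thesis by simp
  qed
  then show ?thesis using that[of ?C N] by auto
qed

text \<open>Families that are locally Lipschitz in the parameter, in every Schwartz seminorm, with
  polynomially growing constants. This is strong enough to control replacing the parameter by a
  simple function, and it holds for translates and modulations of a Schwartz function and survives
  derivatives and affine reparametrization.\<close>

definition lipfam :: "('b::euclidean_space \<Rightarrow> 'a::euclidean_space \<Rightarrow> complex) \<Rightarrow> bool" where
  "lipfam g \<longleftrightarrow> (\<forall>z. schwartz (g z)) \<and>
     (\<forall>N. \<exists>C K::nat. \<forall>z z'. sbd N (\<lambda>y. g z y - g z' y) (C * norm (z - z') * (1 + norm z + norm z') ^ K))"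

lemma lipfam_schwartz: "lipfam g \<Longrightarrow> schwartz (g z)"
  by (simp add: lipfam_def)

lemma lipfam_smooth_fun: "lipfam g \<Longrightarrow> smooth_fun (g z)"
  by (simp add: lipfam_schwartz schwartz_smooth_fun)

lemma lipfamE:
  assumes "lipfam g"
  obtains C K where "C \<ge> 0" "\<And>z z'. sbd N (\<lambda>y. g z y - g z' y) (C * norm (z - z') * (1 + norm z + norm z') ^ K)"
proof -
  obtain C K where CK: "\<And>z z'. sbd N (\<lambda>y. g z y - g z' y) (C * norm (z - z') * (1 + norm z + norm z') ^ K)"
    using assms unfolding lipfam_def by metis
  have "sbd N (\<lambda>y. g z y - g z' y) (\<bar>C\<bar> * norm (z - z') * (1 + norm z + norm z') ^ K)" for z z'
    by (rule sbd_mono[OF CK]) (intro mult_right_mono, auto)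
  then show ?thesis using that[of "\<bar>C\<bar>" K] by auto
qed

text \<open>Comparison with the member at parameter 0; one more power absorbs the factor
  \<open>norm z\<close>.\<close>

lemma lipfam_growth:
  assumes "lipfam g"
  obtains C K where "C \<ge> 0" "\<And>z. sbd N (g z) (C * (1 + norm z) ^ K)"
proof -
  obtain C K where C: "C \<ge> 0"
    and CK: "\<And>z z'. sbd N (\<lambda>y. g z y - g z' y) (C * norm (z - z') * (1 + norm z + norm z') ^ K)"
    using lipfamE[OF assms] by metis
  obtain B where B: "sbd N (g 0) B" using lipfam_schwartz[OF assms, of 0] unfolding schwartz_iff by blast
  have "sbd N (g z) ((B + C) * (1 + norm z) ^ Suc K)" for z
  proof -
    have "sbd N (\<lambda>y. g 0 y + (g z y - g 0 y)) (B + C * norm (z - 0) * (1 + norm z + norm (0::'a)) ^ K)"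
      by (intro sbd_add B CK smooth_fun_diff lipfam_smooth_fun assms)
    then have "sbd N (g z) (B + C * norm z * (1 + norm z) ^ K)" by simp
    moreover have "B * 1 + C * (norm z * (1 + norm z) ^ K) \<le> B * (1 + norm z) ^ Suc K + C * ((1 + norm z) * (1 + norm z) ^ K)"
      by (intro add_mono mult_left_mono mult_right_mono one_le_power C sbd_nonneg[OF B]) auto
    ultimately show ?thesis by (elim sbd_mono) (simp add: algebra_simps)
  qed
  then show ?thesis using that[of "B + C" "Suc K"] C sbd_nonneg[OF B] by auto
qed

lemma lipfam_ddir:
  assumes "lipfam g"
  shows "lipfam (\<lambda>z. ddir v (g z))"
  unfolding lipfam_def
proof (intro conjI allI)
  fix N
  obtain C K where "\<And>z z'. sbd (Suc N) (\<lambda>y. g z y - g z' y) (C * norm (z - z') * (1 + norm z + norm z') ^ K)"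
    using lipfamE[OF assms] by metis
  then have "sbd N (ddir v (\<lambda>y. g z y - g z' y)) ((\<Sum>b\<in>Basis. \<bar>v \<bullet> b\<bar>) * (C * norm (z - z') * (1 + norm z + norm z') ^ K))" for z z'
    by (intro sbd_ddir smooth_fun_diff lipfam_smooth_fun assms)
  then show "\<exists>C K. \<forall>z z'. sbd N (\<lambda>y. ddir v (g z) y - ddir v (g z') y) (C * norm (z - z') * (1 + norm z + norm z') ^ K)"
    by (intro exI[of _ "(\<Sum>b\<in>Basis. \<bar>v \<bullet> b\<bar>) * C"] exI[of _ K])
       (simp add: ddir_diff lipfam_smooth_fun assms mult.assoc)
qed (simp add: schwartz_ddir lipfam_schwartz assms)

lemma lipfam_dderivs: "lipfam g \<Longrightarrow> lipfam (\<lambda>z. dderivs vs (g z))"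
  by (induction vs) (simp_all add: dderivs_Cons_ddir lipfam_ddir del: dderivs.simps(2))

lemma continuous_on_local_lipschitz:
  fixes F :: "'b::euclidean_space \<Rightarrow> complex"
  assumes "\<And>z z'. norm (F z - F z') \<le> C * norm (z - z') * (1 + norm z + norm z') ^ (K::nat)"
  shows "continuous_on UNIV F"
proof (rule continuous_at_imp_continuous_on, rule ballI)
  fix z :: 'b
  have "((\<lambda>y. C * norm (y - z) * (1 + norm y + norm z) ^ K) \<longlongrightarrow> C * norm (z - z) * (1 + norm z + norm z) ^ K) (at z)"
    by (intro tendsto_intros)
  then have "((\<lambda>y. F y - F z) \<longlongrightarrow> 0) (at z)"
    by (intro Lim_null_comparison[OF always_eventually[OF allI[OF assms]]]) simp
  then show "isCont F z" by (simp add: isCont_def LIM_zero_iff)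
qed

lemma lipfam_continuous:
  assumes "lipfam g"
  shows "continuous_on UNIV (\<lambda>z. g z y)"
proof -
  obtain C K where CK: "\<And>z z'. sbd 0 (\<lambda>y. g z y - g z' y) (C * norm (z - z') * (1 + norm z + norm z') ^ K)"
    using lipfamE[OF assms] by metis
  show ?thesis by (rule continuous_on_local_lipschitz) (rule sbd_norm[OF CK])
qed

lemma tempered_lipfam:
  assumes "tempered w" "lipfam g"
  obtains C K where "C \<ge> 0" "\<And>z. norm (w (g z)) \<le> C * (1 + norm z) ^ K" "continuous_on UNIV (\<lambda>z. w (g z))"
proof -
  obtain D N where D: "D \<ge> 0" "\<And>f B. schwartz f \<Longrightarrow> sbd N f B \<Longrightarrow> norm (w f) \<le> D * B"
    using tempered_bound[OF assms(1)] by blast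
  obtain C K where CK: "\<And>z z'. sbd N (\<lambda>y. g z y - g z' y) (C * norm (z - z') * (1 + norm z + norm z') ^ K)"
    using lipfamE[OF assms(2)] by metis
  have "norm (w (g z) - w (g z')) \<le> (D * C) * norm (z - z') * (1 + norm z + norm z') ^ K" for z z'
    using D(2)[OF schwartz_diff[OF lipfam_schwartz lipfam_schwartz] CK, OF assms(2) assms(2)]
    by (simp add: tempered_diff assms lipfam_schwartz mult_ac)
  then have c: "continuous_on UNIV (\<lambda>z. w (g z))" by (rule continuous_on_local_lipschitz)
  obtain C' K' where C': "C' \<ge> 0" "\<And>z. sbd N (g z) (C' * (1 + norm z) ^ K')"
    using lipfam_growth[OF assms(2)] by metis
  have "norm (w (g z)) \<le> (D * C') * (1 + norm z) ^ K'" for z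
    using D(2)[OF lipfam_schwartz[OF assms(2)] C'(2)] by (simp add: mult_ac)
  then show ?thesis using that[of "D * C'" K'] c D(1) C'(1) by auto
qed

text \<open>Integrability against all polynomial weights is what pairing with a
  \<open>lipfam\<close> family consumes. No smoothness is asked, so that transforms
  \<open>ft \<eta>\<close> can act as densities once their decay is known, without estimates on
  their derivatives.\<close>

definition rapid :: "('b::euclidean_space \<Rightarrow> complex) \<Rightarrow> bool" where
  "rapid c \<longleftrightarrow> c \<in> borel_measurable borel \<and>
     (\<forall>K::nat. integrable lborel (\<lambda>z. norm (c z) * (1 + norm z) ^ K))"

lemma rapid_measurable [measurable_dest]: "rapid c \<Longrightarrow> c \<in> borel_measurable borel"
  by (simp add: rapid_def)

lemma rapid_integrable:
  fixes F :: "'b::euclidean_space \<Rightarrow> complex"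
  assumes "rapid c" "F \<in> borel_measurable borel" "\<And>z. norm (F z) \<le> C * (1 + norm z) ^ (K::nat)"
  shows "integrable lborel (\<lambda>z. c z * F z)"
proof (rule Bochner_Integration.integrable_bound)
  show "integrable lborel (\<lambda>z. C * (norm (c z) * (1 + norm z) ^ K))"
    using assms(1) by (auto simp: rapid_def)
  have "norm (c z * F z) \<le> norm (C * (norm (c z) * (1 + norm z) ^ K))" for z
  proof -
    have "norm (c z * F z) \<le> norm (c z) * (C * (1 + norm z) ^ K)"
      unfolding norm_mult by (intro mult_left_mono assms) auto
    then show ?thesis by (simp add: mult_ac)
  qed
  then show "AE z in lborel. norm (c z * F z) \<le> norm (C * (norm (c z) * (1 + norm z) ^ K))" by auto
  show "(\<lambda>z. c z * F z) \<in> borel_measurable lborel"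
    using assms(1,2) by (auto simp: rapid_def)
qed

lemma rapid_integrable_real:
  fixes F :: "'b::euclidean_space \<Rightarrow> real"
  assumes "rapid c" "F \<in> borel_measurable borel" "\<And>z. \<bar>F z\<bar> \<le> C * (1 + norm z) ^ (K::nat)"
  shows "integrable lborel (\<lambda>z. norm (c z) * F z)"
proof -
  have "integrable lborel (\<lambda>z. norm (c z * of_real (F z)))"
    by (intro integrable_norm rapid_integrable[where C = C and K = K] assms) (use assms in auto)
  then show ?thesis
    by (rule Bochner_Integration.integrable_bound) (use assms in \<open>auto simp: rapid_def norm_mult abs_mult\<close>)
qed

definition cint :: "('b::euclidean_space \<Rightarrow> complex) \<Rightarrow> ('b \<Rightarrow> 'a \<Rightarrow> complex) \<Rightarrow> 'a \<Rightarrow> complex" where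
  "cint c g y = (\<integral>z. c z * g z y \<partial>lborel)"

lemma lipfam_integrable:
  assumes "rapid c" "lipfam g"
  shows "integrable lborel (\<lambda>z. c z * g z y)"
proof -
  obtain C K where "\<And>z. sbd 0 (g z) (C * (1 + norm z) ^ K)" using lipfam_growth[OF assms(2)] by metis
  then show ?thesis
    by (intro rapid_integrable[OF assms(1), where C = C and K = K])
       (auto intro: sbd_norm borel_measurable_continuous_onI lipfam_continuous assms)
qed

text \<open>Differentiation under the integral sign. Dominated convergence is applied to the full
  remainder quotient, not just to directional quotients, so that a Frechet derivative
  results.\<close>

lemma cint_has_derivative:
  fixes g :: "'b::euclidean_space \<Rightarrow> 'a::euclidean_space \<Rightarrow> complex"
  assumes c: "rapid c" and g: "lipfam g"
  shows "(cint c g has_derivative (\<lambda>v. cint c (\<lambda>z. ddir v (g z)) y)) (at y)"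
proof -
  have int: "integrable lborel (\<lambda>z. c z * g z x)" "integrable lborel (\<lambda>z. c z * ddir v (g z) x)" for x v
    by (intro lipfam_integrable lipfam_ddir c g)+
  have lin: "linear (\<lambda>v. ddir v (g z) x)" for z x
    by (rule has_derivative_linear[OF has_derivative_ddir[OF lipfam_smooth_fun[OF g]]])
  have "linear (\<lambda>v. cint c (\<lambda>z. ddir v (g z)) y)"
    by (rule linearI)
       (simp_all add: cint_def linear_add[OF lin] linear_scale[OF lin] distrib_left int
          flip: Bochner_Integration.integral_add integral_scaleR_right)
  then have bl: "bounded_linear (\<lambda>v. cint c (\<lambda>z. ddir v (g z)) y)" by (simp add: linear_conv_bounded_linear)
  obtain C K where C: "C \<ge> 0" and CK: "\<And>z. sbd 1 (g z) (C * (1 + norm z) ^ K)"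
    using lipfam_growth[OF g] by metis
  \<comment> \<open>The growth bound for seminorm 1 is uniform in the point, so the mean value
    inequality bounds the increment and the linear term by \<open>?M z\<close> each; the sum
    \<open>2 * ?M z\<close> dominates independently of \<open>x\<close>.\<close>
  let ?M = "\<lambda>z. real DIM('a) * (C * (1 + norm z) ^ K)"
  have sumb: "(\<Sum>b\<in>Basis. norm (ddir b (g z) x)) \<le> ?M z" for z x
  proof (rule order_trans[OF sum_mono])
    show "norm (ddir b (g z) x) \<le> C * (1 + norm z) ^ K" if "b \<in> Basis" for b
      using sbd_deriv_norm[OF CK[of z], of "[b]" x] that by (simp add: dirs_upto_def ddir_def)
  qed simp
  let ?q = "\<lambda>z x. (g z x - g z y - ddir (x - y) (g z) y) /\<^sub>R norm (x - y)"
  have bound: "norm (?q z x) \<le> 2 * ?M z" if "x \<noteq> y" for z x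
  proof -
    have "norm (g z (y + (x - y)) - g z y) \<le> ?M z * norm (x - y)"
      by (rule norm_diff_le_ddir[OF lipfam_smooth_fun[OF g] sumb])
    moreover have "norm (ddir (x - y) (g z) y) \<le> norm (x - y) * ?M z"
      using norm_ddir_le[OF lipfam_smooth_fun[OF g], of "x - y" z y] sumb[of z y]
      by (meson mult_left_mono norm_ge_zero order_trans)
    ultimately have "norm (g z x - g z y - ddir (x - y) (g z) y) \<le> (2 * ?M z) * norm (x - y)"
      using norm_triangle_ineq4[of "g z x - g z y" "ddir (x - y) (g z) y"] by (simp add: mult_ac)
    then show ?thesis using that by (simp add: divide_simps)
  qed
  have lim: "(?q z \<longlongrightarrow> 0) (at y)" for z
    using has_derivative_ddir[OF lipfam_smooth_fun[OF g], of z y] unfolding has_derivative_at_within by simp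
  have eq: "(cint c g x - cint c g y - cint c (\<lambda>z. ddir (x - y) (g z)) y) /\<^sub>R norm (x - y) = (\<integral>z. c z * ?q z x \<partial>lborel)" for x
  proof -
    have "(\<integral>z. c z * ?q z x \<partial>lborel) = (\<integral>z. (c z * g z x - c z * g z y - c z * ddir (x - y) (g z) y) /\<^sub>R norm (x - y) \<partial>lborel)"
      by (intro Bochner_Integration.integral_cong) (auto simp: algebra_simps)
    then show ?thesis using int by (simp add: cint_def) metis
  qed
  have "((\<lambda>x. \<integral>z. c z * ?q z x \<partial>lborel) \<longlongrightarrow> 0) (at y)"
    unfolding tendsto_at_iff_sequentially comp_def
  proof (intro allI impI)
    fix X :: "nat \<Rightarrow> 'a" assume X: "\<forall>i. X i \<in> UNIV - {y}" "X \<longlonglongrightarrow> y"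
    have "(\<lambda>i. \<integral>z. c z * ?q z (X i) \<partial>lborel) \<longlonglongrightarrow> (\<integral>z. (0::complex) \<partial>(lborel :: 'b measure))"
    proof (rule integral_dominated_convergence[where w = "\<lambda>z. norm (c z) * (2 * ?M z)"])
      show "integrable lborel (\<lambda>z. norm (c z) * (2 * ?M z))"
        using C by (intro rapid_integrable_real[OF c, where C = "2 * (real DIM('a) * C)" and K = K]) auto
      have "(\<lambda>i. ?q z (X i)) \<longlonglongrightarrow> 0" for z
        using lim[of z, unfolded tendsto_at_iff_sequentially comp_def] X by blast
      then show "AE z in lborel. (\<lambda>i. c z * ?q z (X i)) \<longlonglongrightarrow> 0"
        by (intro AE_I2 tendsto_mult_right_zero)
      show "AE z in lborel. norm (c z * ?q z (X i)) \<le> norm (c z) * (2 * ?M z)" for i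
        unfolding norm_mult using X(1) by (intro AE_I2 mult_left_mono bound) auto
      have eq': "(\<lambda>z. c z * ?q z (X i)) = (\<lambda>z. (c z * g z (X i) - c z * g z y - c z * ddir (X i - y) (g z) y) /\<^sub>R norm (X i - y))" for i
        by (auto simp: algebra_simps)
      have int': "integrable lborel (\<lambda>z. (c z * g z (X i) - c z * g z y - c z * ddir (X i - y) (g z) y) /\<^sub>R norm (X i - y))" for i
        by (intro integrable_scaleR_right Bochner_Integration.integrable_diff int)
      show "(\<lambda>z. c z * ?q z (X i)) \<in> borel_measurable lborel" for i
        unfolding eq' by (rule borel_measurable_integrable[OF int'])
    qed simp
    then show "(\<lambda>i. \<integral>z. c z * ?q z (X i) \<partial>lborel) \<longlonglongrightarrow> 0" by simp
  qed
  then show ?thesis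
    unfolding has_derivative_at_within eq using bl by simp
qed

lemma ddir_cint: "rapid c \<Longrightarrow> lipfam g \<Longrightarrow> ddir v (cint c g) = cint c (\<lambda>z. ddir v (g z))"
  by (intro ext ddir_eqI cint_has_derivative)

lemma dderivs_cint: "rapid c \<Longrightarrow> lipfam g \<Longrightarrow> dderivs vs (cint c g) = cint c (\<lambda>z. dderivs vs (g z))"
  by (induction vs) (simp_all add: dderivs_Cons_ddir ddir_cint lipfam_dderivs del: dderivs.simps(2))

lemma smooth_fun_cint:
  assumes "rapid c" "lipfam g"
  shows "smooth_fun (cint c g)"
proof (rule smooth_fun_coinduct[where S = "{cint c g |g. lipfam g}"])
  show "h differentiable at x" if "h \<in> {cint c g |g. lipfam g}" for h x
    using that cint_has_derivative[OF assms(1)] by (auto simp: differentiable_def)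
qed (use assms in \<open>auto simp: ddir_cint lipfam_ddir\<close>)

text \<open>Stated for a general \<open>h\<close> whose derivatives are integrals of some
  \<open>H\<close>, because it is used twice: with \<open>h = 0\<close> it bounds
  \<open>cint c g\<close> itself, and with a finite sum for \<open>h\<close> it measures the error
  of the simple-function approximation.\<close>

lemma sbd_cint_diff:
  fixes g :: "'b::euclidean_space \<Rightarrow> 'a::euclidean_space \<Rightarrow> complex"
  assumes c: "rapid c" and g: "lipfam g" and h: "smooth_fun h"
    and dh: "\<And>vs y. vs \<in> dirs_upto N \<Longrightarrow> dderivs vs h y = (\<integral>z. c z * H vs z y \<partial>lborel)"
    and iH: "\<And>vs y. vs \<in> dirs_upto N \<Longrightarrow> integrable lborel (\<lambda>z. c z * H vs z y)"
    and bd: "\<And>vs z y. vs \<in> dirs_upto N \<Longrightarrow> (1 + norm y) ^ N * norm (H vs z y - dderivs vs (g z) y) \<le> b z"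
    and ib: "integrable lborel (\<lambda>z. norm (c z) * b z)"
  shows "sbd N (\<lambda>y. h y - cint c g y) (\<integral>z. norm (c z) * b z \<partial>lborel)"
  unfolding sbd_def
proof (intro ballI allI)
  fix vs :: "'a list" and y :: 'a assume vs: "vs \<in> dirs_upto N"
  have i2: "integrable lborel (\<lambda>z. c z * dderivs vs (g z) y)"
    by (intro lipfam_integrable lipfam_dderivs c g)
  have "dderivs vs (\<lambda>y. h y - cint c g y) y = (\<integral>z. c z * (H vs z y - dderivs vs (g z) y) \<partial>lborel)"
    using iH[OF vs] i2
    by (simp add: dderivs_diff h smooth_fun_cint c g dh[OF vs] dderivs_cint right_diff_distrib) (simp add: cint_def)
  then have "(1 + norm y) ^ N * norm (dderivs vs (\<lambda>y. h y - cint c g y) y) =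
      norm (\<integral>z. (1 + norm y) ^ N *\<^sub>R (c z * (H vs z y - dderivs vs (g z) y)) \<partial>lborel)"
    by simp
  also have "\<dots> \<le> (\<integral>z. norm (c z) * b z \<partial>lborel)"
  proof (rule Bochner_Integration.integral_norm_bound_integral)
    show "integrable lborel (\<lambda>z. (1 + norm y) ^ N *\<^sub>R (c z * (H vs z y - dderivs vs (g z) y)))"
      unfolding right_diff_distrib by (intro integrable_scaleR_right Bochner_Integration.integrable_diff iH[OF vs] i2)
    have "norm (c z) * ((1 + norm y) ^ N * norm (H vs z y - dderivs vs (g z) y)) \<le> norm (c z) * b z" for z
      by (intro mult_left_mono bd vs) auto
    then show "norm ((1 + norm y) ^ N *\<^sub>R (c z * (H vs z y - dderivs vs (g z) y))) \<le> norm (c z) * b z" for z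
      by (simp add: norm_mult mult_ac)
  qed (rule ib)
  finally show "(1 + norm y) ^ N * norm (dderivs vs (\<lambda>y. h y - cint c g y) y) \<le> (\<integral>z. norm (c z) * b z \<partial>lborel)" .
qed

lemma schwartz_cint:
  assumes c: "rapid c" and g: "lipfam g"
  shows "schwartz (cint c g)"
  unfolding schwartz_iff
proof (intro conjI allI)
  show "smooth_fun (cint c g)" by (rule smooth_fun_cint[OF assms])
  fix N
  obtain C K where C: "C \<ge> 0" "\<And>z. sbd N (g z) (C * (1 + norm z) ^ K)" using lipfam_growth[OF g] by metis
  have "sbd N (\<lambda>y. 0 - cint c g y) (\<integral>z. norm (c z) * (C * (1 + norm z) ^ K) \<partial>lborel)"
    by (rule sbd_cint_diff[OF c g, where H = "\<lambda>vs z y. 0"])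
       (use C in \<open>auto simp: smooth_fun_const dderivs_const0 intro: sbdD intro!: rapid_integrable_real[OF c]\<close>)
  from sbd_cmult[OF smooth_fun_diff[OF smooth_fun_const smooth_fun_cint[OF c g]] this, of "-1"]
  show "\<exists>B. sbd N (cint c g) B" by auto
qed

text \<open>The parameter is approximated by simple functions, for which the integral is a finite sum;
  the Lipschitz bound of the family controls the error in every seminorm.\<close>

lemma tempered_cint:
  fixes g :: "'b::euclidean_space \<Rightarrow> 'a::euclidean_space \<Rightarrow> complex"
  assumes w: "tempered w" and c: "rapid c" and g: "lipfam g"
  shows "w (cint c g) = (\<integral>z. c z * w (g z) \<partial>lborel)"
proof -
  obtain D N where D: "D \<ge> 0" "\<And>f B. schwartz f \<Longrightarrow> sbd N f B \<Longrightarrow> norm (w f) \<le> D * B"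
    using tempered_bound[OF w] by blast
  obtain C K where C: "C \<ge> 0" and CK: "\<And>z z'. sbd N (\<lambda>y. g z y - g z' y) (C * norm (z - z') * (1 + norm z + norm z') ^ K)"
    using lipfamE[OF g] by metis
  obtain C' K' where C': "C' \<ge> 0" "\<And>z. norm (w (g z)) \<le> C' * (1 + norm z) ^ K'" and wc: "continuous_on UNIV (\<lambda>z. w (g z))"
    using tempered_lipfam[OF w g] by metis
  \<comment> \<open>Simple functions tending to the identity of the parameter space. The bound by
    \<open>2 * norm z\<close> keeps polynomial growth in the approximated parameter integrable
    against \<open>c\<close>.\<close>
  obtain s where s: "\<And>i. simple_function (lborel :: 'b measure) (s i)" "\<And>z. (\<lambda>i. s i z) \<longlonglongrightarrow> z"
      "\<And>i z. norm (s i z) \<le> 2 * norm z"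
    using borel_measurable_implies_sequence_metric[of "\<lambda>z::'b. z" lborel 0] by auto
  have fin: "finite (range (s i))" and sm [measurable]: "s i \<in> borel_measurable borel" for i
    using s(1)[of i] borel_measurable_simple_function[OF s(1)[of i]] by (auto simp: simple_function_def)
  define a where "a i r = (\<integral>z. c z * indicator {z. s i z = r} z \<partial>lborel)" for i r
  have ia: "integrable lborel (\<lambda>z. c z * indicator {z. s i z = r} z)" for i r
    by (rule rapid_integrable[OF c, where C = 1 and K = 0]) (auto simp: indicator_def)
  \<comment> \<open>\<open>F\<close> is arbitrary so that one identity serves both the values
    \<open>w (g r)\<close> and the pointwise derivatives of \<open>g r\<close>.\<close>
  have step: "(\<Sum>r\<in>range (s i). a i r * F r) = (\<integral>z. c z * F (s i z) \<partial>lborel)"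
    and int_step: "integrable lborel (\<lambda>z. c z * F (s i z))" for i and F :: "'b \<Rightarrow> complex"
  proof -
    have "c z * F (s i z) = (\<Sum>r\<in>range (s i). (c z * indicator {z. s i z = r} z) * F r)" for z
    proof -
      have "(\<Sum>r\<in>range (s i). (c z * indicator {z. s i z = r} z) * F r)
          = (\<Sum>r\<in>range (s i). if r = s i z then c z * F r else 0)"
        by (intro sum.cong) auto
      also have "\<dots> = c z * F (s i z)" using fin by (subst sum.delta) auto
      finally show ?thesis by simp
    qed
    then have *: "(\<lambda>z. c z * F (s i z)) = (\<lambda>z. \<Sum>r\<in>range (s i). (c z * indicator {z. s i z = r} z) * F r)" by auto
    show "(\<Sum>r\<in>range (s i). a i r * F r) = (\<integral>z. c z * F (s i z) \<partial>lborel)"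
      unfolding * a_def using ia by (subst Bochner_Integration.integral_sum) auto
    show "integrable lborel (\<lambda>z. c z * F (s i z))"
      unfolding * using ia by (intro Bochner_Integration.integrable_sum integrable_mult_left) auto
  qed
  define A where "A i y = (\<Sum>r\<in>range (s i). a i r * g r y)" for i y
  have A_schwartz: "schwartz (A i)" for i
    unfolding A_def by (intro schwartz_sum fin schwartz_cmult lipfam_schwartz g)
  have wA: "w (A i) = (\<integral>z. c z * w (g (s i z)) \<partial>lborel)" for i
  proof -
    have "w (A i) = (\<Sum>r\<in>range (s i). a i r * w (g r))"
      unfolding A_def by (simp add: tempered_sum[OF w fin] tempered_cmult[OF w] schwartz_cmult lipfam_schwartz g)
    then show ?thesis by (simp add: step)
  qed
  have dA: "dderivs vs (A i) y = (\<integral>z. c z * dderivs vs (g (s i z)) y \<partial>lborel)" for vs i y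
    using step[of i "\<lambda>r. dderivs vs (g r) y"]
    by (simp add: A_def[abs_def] dderivs_sum fin smooth_fun_cmult lipfam_smooth_fun g dderivs_cmult)
  define b where "b i z = C * norm (s i z - z) * (1 + norm (s i z) + norm z) ^ K" for i z
  have [measurable]: "b i \<in> borel_measurable borel" for i unfolding b_def by measurable
  \<comment> \<open>The 3 comes from \<open>norm (s i z) \<le> 2 * norm z\<close>: both the distance
    to \<open>z\<close> and the weight are at most three times \<open>1 + norm z\<close>.\<close>
  have b_bound: "\<bar>b i z\<bar> \<le> (C * 3 ^ Suc K) * (1 + norm z) ^ Suc K" for i z
  proof -
    have "norm (s i z - z) \<le> 3 * (1 + norm z)"
      by (rule order_trans[OF norm_triangle_ineq4]) (use s(3)[of i z] in simp)
    moreover have "1 + norm (s i z) + norm z \<le> 3 * (1 + norm z)"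
      using s(3)[of i z] by simp
    ultimately have "b i z \<le> C * (3 * (1 + norm z)) * (3 * (1 + norm z)) ^ K"
      unfolding b_def using C by (intro mult_mono power_mono) auto
    moreover have "b i z \<ge> 0" unfolding b_def using C by auto
    moreover have "C * (3 * (1 + norm z)) * (3 * (1 + norm z)) ^ K = (C * 3 ^ Suc K) * (1 + norm z) ^ Suc K"
      unfolding power_mult_distrib by (simp only: power_Suc mult_ac)
    ultimately show ?thesis by (metis abs_of_nonneg)
  qed
  have ib: "integrable lborel (\<lambda>z. norm (c z) * b i z)" for i
    by (rule rapid_integrable_real[OF c _ b_bound]) simp
  have "sbd N (\<lambda>y. A i y - cint c g y) (\<integral>z. norm (c z) * b i z \<partial>lborel)" for i
  proof (rule sbd_cint_diff[OF c g schwartz_smooth_fun[OF A_schwartz] dA])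
    show "(1 + norm y) ^ N * norm (dderivs vs (g (s i z)) y - dderivs vs (g z) y) \<le> b i z"
      if "vs \<in> dirs_upto N" for vs z y
      using sbdD[OF CK that, of y "s i z" z] unfolding b_def
      by (simp add: dderivs_diff lipfam_smooth_fun g)
  qed (use ib int_step in auto)
  then have dist_le: "norm (w (A i) - w (cint c g)) \<le> D * (\<integral>z. norm (c z) * b i z \<partial>lborel)" for i
    using D(2)[OF schwartz_diff[OF A_schwartz schwartz_cint[OF c g]]]
    by (simp add: tempered_diff w A_schwartz schwartz_cint c g)
  have "(\<lambda>i. \<integral>z. norm (c z) * b i z \<partial>lborel) \<longlonglongrightarrow> (\<integral>z. (0::real) \<partial>(lborel :: 'b measure))"
  proof (rule integral_dominated_convergence[where w = "\<lambda>z. norm (c z) * ((C * 3 ^ Suc K) * (1 + norm z) ^ Suc K)"])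
    show "integrable lborel (\<lambda>z. norm (c z) * ((C * 3 ^ Suc K) * (1 + norm z) ^ Suc K))"
      by (rule rapid_integrable_real[OF c, where C = "C * 3 ^ Suc K" and K = "Suc K"]) (use C in \<open>auto simp: abs_mult\<close>)
    have "(\<lambda>i. b i z) \<longlonglongrightarrow> C * norm (z - z) * (1 + norm z + norm z) ^ K" for z
      unfolding b_def by (intro tendsto_intros s)
    then have "(\<lambda>i. b i z) \<longlonglongrightarrow> 0" for z by simp
    then show "AE z in lborel. (\<lambda>i. norm (c z) * b i z) \<longlonglongrightarrow> 0"
      by (intro AE_I2 tendsto_mult_right_zero)
    show "AE z in lborel. norm (norm (c z) * b i z) \<le> norm (c z) * ((C * 3 ^ Suc K) * (1 + norm z) ^ Suc K)" for i
      unfolding norm_mult by (intro AE_I2 mult_mono) (use b_bound[of i] in \<open>auto simp del: power_Suc\<close>)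
  qed (use c in \<open>auto simp: rapid_def\<close>)
  then have "(\<lambda>i. D * (\<integral>z. norm (c z) * b i z \<partial>lborel)) \<longlonglongrightarrow> 0"
    by (intro tendsto_mult_right_zero) simp
  then have "(\<lambda>i. w (A i) - w (cint c g)) \<longlonglongrightarrow> 0"
    by (rule Lim_null_comparison[OF always_eventually[OF allI[OF dist_le]]])
  then have lim1: "(\<lambda>i. w (A i)) \<longlonglongrightarrow> w (cint c g)" by (simp add: LIM_zero_iff)
  have "(\<lambda>i. \<integral>z. c z * w (g (s i z)) \<partial>lborel) \<longlonglongrightarrow> (\<integral>z. c z * w (g z) \<partial>lborel)"
  proof (rule integral_dominated_convergence[where w = "\<lambda>z. norm (c z) * ((C' * 2 ^ K') * (1 + norm z) ^ K')"])
    show "integrable lborel (\<lambda>z. norm (c z) * ((C' * 2 ^ K') * (1 + norm z) ^ K'))"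
      by (rule rapid_integrable_real[OF c, where C = "C' * 2 ^ K'" and K = K']) (use C' in \<open>auto simp: abs_mult\<close>)
    have "isCont (\<lambda>z. w (g z)) z" for z using wc by (simp add: continuous_on_eq_continuous_at)
    then have "(\<lambda>i. w (g (s i z))) \<longlonglongrightarrow> w (g z)" for z
      using s(2)[of z] by (rule isCont_tendsto_compose)
    then show "AE z in lborel. (\<lambda>i. c z * w (g (s i z))) \<longlonglongrightarrow> c z * w (g z)"
      by (intro AE_I2 tendsto_mult_left)
    have "norm (w (g (s i z))) \<le> (C' * 2 ^ K') * (1 + norm z) ^ K'" for i z
    proof -
      have "norm (w (g (s i z))) \<le> C' * (1 + norm (s i z)) ^ K'" by (rule C')
      also have "\<dots> \<le> C' * (2 * (1 + norm z)) ^ K'"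
        using s(3)[of i z] by (intro mult_left_mono power_mono C') auto
      finally show ?thesis by (simp only: power_mult_distrib mult.assoc)
    qed
    then show "AE z in lborel. norm (c z * w (g (s i z))) \<le> norm (c z) * ((C' * 2 ^ K') * (1 + norm z) ^ K')" for i
      unfolding norm_mult by (intro AE_I2 mult_left_mono) auto
    show "(\<lambda>z. c z * w (g (s i z))) \<in> borel_measurable lborel" for i
      by (rule borel_measurable_integrable[OF int_step[of "\<lambda>z. w (g z)"]])
    show "(\<lambda>z. c z * w (g z)) \<in> borel_measurable lborel"
      using rapid_measurable[OF c] borel_measurable_continuous_onI[OF wc] by simp
  qed
  then have "(\<lambda>i. w (A i)) \<longlonglongrightarrow> (\<integral>z. c z * w (g z) \<partial>lborel)" by (simp add: wA)
  with lim1 show ?thesis by (rule LIMSEQ_unique)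
qed

section \<open>Translations and modulations\<close>

lemma integral_translate:
  fixes f :: "'a::euclidean_space \<Rightarrow> 'b::{banach, second_countable_topology}"
  assumes "f \<in> borel_measurable borel"
  shows "(\<integral>x. f (t + x) \<partial>lborel) = (\<integral>x. f x \<partial>lborel)"
proof -
  have "(\<integral>x. f x \<partial>lborel) = (\<integral>x. f x \<partial>(distr lborel borel ((+) t)))"
    by (simp add: lborel_distr_plus)
  also have "\<dots> = (\<integral>x. f (t + x) \<partial>lborel)"
    by (rule integral_distr) (use assms in auto)
  finally show ?thesis by simp
qed

lemma integral_scale:
  fixes f :: "'a::euclidean_space \<Rightarrow> 'b::{banach, second_countable_topology}"
  assumes [measurable]: "f \<in> borel_measurable borel" and "c \<noteq> 0"
  shows "(\<integral>x. \<bar>c\<bar> ^ DIM('a) *\<^sub>R f (c *\<^sub>R x) \<partial>lborel) = (\<integral>x. f x \<partial>lborel)"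
proof -
  have "(\<integral>x. f x \<partial>lborel) = (\<integral>x. f x \<partial>(density (distr lborel borel (\<lambda>x. 0 + c *\<^sub>R x)) (\<lambda>_. ennreal (\<bar>c\<bar> ^ DIM('a)))))"
    using lborel_affine[OF assms(2), of "0::'a"] by simp
  also have "\<dots> = (\<integral>x. \<bar>c\<bar> ^ DIM('a) *\<^sub>R f x \<partial>(distr lborel borel (\<lambda>x. 0 + c *\<^sub>R x)))"
    by (rule integral_density) auto
  also have "\<dots> = (\<integral>x. \<bar>c\<bar> ^ DIM('a) *\<^sub>R f (0 + c *\<^sub>R x) \<partial>lborel)"
    by (rule integral_distr) auto
  finally show ?thesis by simp
qed

text \<open>With n the integer part of \<open>norm x\<close>, the point lies in the ball of radius 1
  + n and the integrand is at most (1 + n)^-(m+2). The ball has volume of order (1 + n)^m, so the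
  surplus 2 in the exponent leaves the convergent series of (1 + n)^-2.\<close>

lemma integrable_inverse_power_norm:
  "integrable lborel (\<lambda>x::'a::euclidean_space. 1 / (1 + norm x) ^ (DIM('a) + 2))"
proof (rule integrableI_bounded)
  let ?L = "DIM('a) + 2"
  let ?V = "unit_ball_vol (real DIM('a))"
  let ?g = "\<lambda>(n::nat) (x::'a). ennreal (1 / (1 + real n) ^ ?L) * indicator (ball 0 (1 + real n)) x"
  have sg: "(\<Sum>i\<in>{n}. F i) = F n" for F :: "nat \<Rightarrow> ennreal" and n by simp
  have le: "ennreal (norm (1 / (1 + norm x) ^ ?L)) \<le> (\<Sum>n. ?g n x)" for x
  proof -
    define n where "n = nat \<lfloor>norm x\<rfloor>"
    have n: "real n \<le> norm x" "norm x < 1 + real n"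
      unfolding n_def by (auto simp: of_nat_floor) linarith
    have "1 / (1 + norm x) ^ ?L \<le> 1 / (1 + real n) ^ ?L"
      using n by (intro divide_left_mono power_mono mult_pos_pos) auto
    then have "ennreal (norm (1 / (1 + norm x) ^ ?L)) \<le> ?g n x"
      using n by (auto intro!: ennreal_leI)
    also have "?g n x = (\<Sum>i\<in>{n}. ?g i x)" by (rule sg[symmetric])
    also have "\<dots> \<le> (\<Sum>n. ?g n x)" by (rule sum_le_suminf) auto
    finally show ?thesis .
  qed
  have s: "summable (\<lambda>n. ?V * inverse ((real (Suc n)) ^ 2))"
    by (intro summable_mult) (subst summable_Suc_iff, rule inverse_power_summable, simp)
  have "(\<integral>\<^sup>+x. ennreal (norm (1 / (1 + norm x) ^ ?L)) \<partial>(lborel :: 'a measure)) \<le> (\<integral>\<^sup>+x. (\<Sum>n. ?g n x) \<partial>lborel)"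
    by (intro nn_integral_mono le)
  also have "\<dots> = (\<Sum>n. \<integral>\<^sup>+x. ?g n x \<partial>lborel)"
    by (rule nn_integral_suminf) (rule borel_measurable_times_ennreal, rule borel_measurable_const, rule borel_measurable_indicator, simp)
  also have "\<dots> = (\<Sum>n. ennreal (?V * inverse ((real (Suc n)) ^ 2)))"
  proof (rule suminf_cong)
    fix n :: nat
    have "(\<integral>\<^sup>+x. ?g n x \<partial>lborel) = ennreal (1 / (1 + real n) ^ ?L) * emeasure lborel (ball (0::'a) (1 + real n))"
      by (rule nn_integral_cmult_indicator) auto
    also have "\<dots> = ennreal (1 / (1 + real n) ^ ?L) * ennreal (?V * (1 + real n) ^ DIM('a))"
      by (subst emeasure_ball) auto
    also have "\<dots> = ennreal (1 / (1 + real n) ^ ?L * (?V * (1 + real n) ^ DIM('a)))"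
      by (rule ennreal_mult[symmetric]) auto
    also have "1 / (1 + real n) ^ ?L * (?V * (1 + real n) ^ DIM('a)) = ?V * inverse ((real (Suc n)) ^ 2)"
      by (simp add: power_add divide_simps power2_eq_square)
    finally show "(\<integral>\<^sup>+x. ?g n x \<partial>lborel) = ennreal (?V * inverse ((real (Suc n)) ^ 2))" .
  qed
  also have "\<dots> = ennreal (\<Sum>n. ?V * inverse ((real (Suc n)) ^ 2))"
    by (rule suminf_ennreal2[OF _ s]) auto
  also have "\<dots> < \<infinity>" by simp
  finally show "(\<integral>\<^sup>+x. ennreal (norm (1 / (1 + norm x) ^ ?L)) \<partial>(lborel :: 'a measure)) < \<infinity>" .
qed auto

lemma integrable_decay:
  fixes f :: "'a::euclidean_space \<Rightarrow> 'b::{banach, second_countable_topology}"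
  assumes "f \<in> borel_measurable borel" "\<And>x. (1 + norm x) ^ (DIM('a) + 2) * norm (f x) \<le> B"
  shows "integrable lborel f"
    and "norm (\<integral>x. f x \<partial>lborel) \<le> B * (\<integral>x. 1 / (1 + norm x) ^ (DIM('a) + 2) \<partial>(lborel :: 'a measure))"
proof -
  let ?J = "\<lambda>x::'a. 1 / (1 + norm x) ^ (DIM('a) + 2)"
  have le: "norm (f x) \<le> B * ?J x" for x
  proof -
    have "(1 + norm x) ^ (DIM('a) + 2) > 0" by (intro zero_less_power add_pos_nonneg) auto
    then show ?thesis using assms(2)[of x] by (simp only: times_divide_eq_right mult_1_right pos_le_divide_eq mult.commute)
  qed
  have iJ: "integrable lborel (\<lambda>x. B * ?J x)"
    by (rule integrable_mult_right[OF integrable_inverse_power_norm])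
  show int: "integrable lborel f"
  proof (rule Bochner_Integration.integrable_bound[OF iJ])
    show "AE x in lborel. norm (f x) \<le> norm (B * ?J x)"
      by (intro AE_I2 order_trans[OF le]) (simp only: real_norm_def abs_ge_self)
  qed (use assms(1) in simp)
  show "norm (\<integral>x. f x \<partial>lborel) \<le> B * (\<integral>x. ?J x \<partial>(lborel :: 'a measure))"
    using Bochner_Integration.integral_norm_bound_integral[OF int iJ le]
    by (simp only: integral_mult_right_zero)
qed

lemma rapidI:
  fixes c :: "'b::euclidean_space \<Rightarrow> complex"
  assumes [measurable]: "c \<in> borel_measurable borel" and "\<And>K::nat. \<exists>B. \<forall>z. (1 + norm z) ^ K * norm (c z) \<le> B"
  shows "rapid c"
  unfolding rapid_def
proof (intro conjI allI)
  fix K :: nat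
  obtain B where B: "\<And>z. (1 + norm z) ^ (DIM('b) + 2 + K) * norm (c z) \<le> B" using assms(2) by meson
  show "integrable lborel (\<lambda>z. norm (c z) * (1 + norm z) ^ K)"
    by (rule integrable_decay(1)[where B = B]) (use B in \<open>auto simp: power_add mult_ac abs_mult\<close>)
qed fact

lemma schwartz_rapid:
  assumes "schwartz f"
  shows "rapid f"
proof (rule rapidI)
  show "f \<in> borel_measurable borel" by (rule smooth_fun_borel_measurable[OF schwartz_smooth_fun[OF assms]])
  fix K
  obtain B where "sbd K f B" using assms unfolding schwartz_iff by blast
  from sbdD[OF this, of "[]"] show "\<exists>B. \<forall>z. (1 + norm z) ^ K * norm (f z) \<le> B" by auto
qed

lemma rapid_integrable_self: "rapid f \<Longrightarrow> integrable lborel f"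
  using rapid_integrable[of f "\<lambda>_. 1" 1 0] by simp

lemma schwartz_integrable: "schwartz f \<Longrightarrow> integrable lborel f"
  by (rule rapid_integrable_self[OF schwartz_rapid])

text \<open>The Peetre-type inequality by which weights are moved across translations, applied with
  a negated second argument when the original point is recovered from the translated one.\<close>

lemma one_plus_norm_add_le: "1 + norm (x + y) \<le> (1 + norm x) * (1 + norm y)"
proof -
  have "(1 + norm x) * (1 + norm y) = 1 + norm x + norm y + norm x * norm y" by (simp add: algebra_simps)
  moreover have "0 \<le> norm x * norm y" by simp
  ultimately show ?thesis using norm_triangle_ineq[of x y] by linarith
qed

text \<open>Each derivative costs one factor \<open>\<bar>a\<bar>\<close>, and
  \<open>\<bar>a\<bar> \<ge> 1\<close> lets the weight at \<open>y\<close> be bounded by the weight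
  at \<open>a *\<^sub>R y\<close>, hence by that at the image point times one in
  \<open>z\<close>.\<close>

lemma sbd_affine:
  assumes f: "smooth_fun f" "sbd N f B" and a: "\<bar>a\<bar> \<ge> 1"
  shows "sbd N (\<lambda>y. f (a *\<^sub>R y + z)) (\<bar>a\<bar> ^ N * (B * (1 + norm z) ^ N))"
  unfolding sbd_def
proof (intro ballI allI)
  fix vs :: "'a list" and y assume vs: "vs \<in> dirs_upto N"
  let ?p = "a *\<^sub>R y + z"
  have "1 + norm y \<le> 1 + norm (a *\<^sub>R y)" using mult_right_mono[OF a norm_ge_zero[of y]] by simp
  also have "\<dots> \<le> (1 + norm ?p) * (1 + norm z)" using one_plus_norm_add_le[of ?p "- z"] by simp
  finally have "(1 + norm y) ^ N \<le> ((1 + norm ?p) * (1 + norm z)) ^ N" by (intro power_mono) auto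
  moreover have "\<bar>a\<bar> ^ length vs \<le> \<bar>a\<bar> ^ N" using vs a by (intro power_increasing) (auto simp: dirs_upto_def)
  ultimately have "(1 + norm y) ^ N * (\<bar>a\<bar> ^ length vs * norm (dderivs vs f ?p))
      \<le> ((1 + norm ?p) * (1 + norm z)) ^ N * (\<bar>a\<bar> ^ N * norm (dderivs vs f ?p))"
    by (intro mult_mono) auto
  also have "\<dots> = \<bar>a\<bar> ^ N * (((1 + norm ?p) ^ N * norm (dderivs vs f ?p)) * (1 + norm z) ^ N)"
    by (simp add: power_mult_distrib mult_ac)
  also have "\<dots> \<le> \<bar>a\<bar> ^ N * (B * (1 + norm z) ^ N)"
    by (intro mult_left_mono mult_right_mono sbdD[OF f(2) vs]) auto
  finally show "(1 + norm y) ^ N * norm (dderivs vs (\<lambda>y. f (a *\<^sub>R y + z)) y) \<le> \<bar>a\<bar> ^ N * (B * (1 + norm z) ^ N)"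
    by (simp add: dderivs_compose_affine f power_abs)
qed

lemma schwartz_affine: "schwartz f \<Longrightarrow> \<bar>a\<bar> \<ge> 1 \<Longrightarrow> schwartz (\<lambda>y. f (a *\<^sub>R y + z))"
  unfolding schwartz_iff using sbd_affine smooth_fun_compose_affine by blast

lemma schwartz_translate: "schwartz f \<Longrightarrow> schwartz (\<lambda>y. f (y + z))"
  using schwartz_affine[of f 1 z] by simp

text \<open>The mean value inequality on the segment between the two translated points. It uses up
  one derivative, hence \<open>Suc N\<close> in the hypothesis; points of the segment differ from
  \<open>y\<close> by at most \<open>norm z + norm z'\<close>, which fixes the weight.\<close>

lemma sbd_translate_diff:
  fixes f :: "'a::euclidean_space \<Rightarrow> complex"
  assumes f: "smooth_fun f" and B: "sbd (Suc N) f B"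
  shows "sbd N (\<lambda>y. f (y + z) - f (y + z')) (real DIM('a) * B * norm (z - z') * (1 + norm z + norm z') ^ N)"
  unfolding sbd_def
proof (intro ballI allI)
  fix vs :: "'a list" and y assume vs: "vs \<in> dirs_upto N"
  define h where "h = dderivs vs f"
  have h: "smooth_fun h" unfolding h_def by (rule smooth_fun_dderivs[OF f])
  have d: "dderivs vs (\<lambda>y. f (y + z) - f (y + z')) y = h (y + z) - h (y + z')"
    using smooth_fun_compose_affine[OF f, of 1] dderivs_compose_affine[OF f, of vs 1]
    by (simp add: dderivs_diff h_def)
  let ?M = "real DIM('a) * B * (1 + norm z + norm z') ^ N / (1 + norm y) ^ N"
  have y1: "1 + norm y \<noteq> 0" using norm_ge_zero[of y] by linarith
  have y0: "(1 + norm y) ^ N > 0" by (intro zero_less_power add_pos_nonneg) auto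
  have "norm (h ((y + z') + (z - z')) - h (y + z')) \<le> ?M * norm (z - z')"
  proof (rule norm_diff_le_ddir[OF h])
    fix p assume "p \<in> closed_segment (y + z') (y + z' + (z - z'))"
    then have "p \<in> closed_segment (y + z') (y + z)" by (simp add: algebra_simps)
    then obtain q where q: "p = y + q" "q \<in> closed_segment z' z"
      unfolding closed_segment_translation[symmetric] by (metis closed_segment_translation imageE)
    have nq: "norm q \<le> norm z + norm z'"
    proof -
      obtain u where u: "0 \<le> u" "u \<le> 1" "q = (1 - u) *\<^sub>R z' + u *\<^sub>R z" using q(2) by (auto simp: closed_segment_def)
      have "norm q \<le> (1 - u) * norm z' + u * norm z"
        unfolding u(3) by (rule order_trans[OF norm_triangle_ineq]) (use u in simp)
      also have "\<dots> \<le> 1 * norm z' + 1 * norm z" using u by (intro add_mono mult_right_mono) auto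
      finally show ?thesis by simp
    qed
    have "1 + norm y \<le> (1 + norm p) * (1 + norm q)" using one_plus_norm_add_le[of p "- q"] q(1) by simp
    also have "\<dots> \<le> (1 + norm p) * (1 + norm z + norm z')" using nq by (intro mult_left_mono) auto
    finally have yN: "(1 + norm y) ^ N \<le> ((1 + norm p) * (1 + norm z + norm z')) ^ N" by (intro power_mono) auto
    have "(1 + norm y) ^ N * norm (ddir b h p) \<le> B * (1 + norm z + norm z') ^ N" if b: "b \<in> Basis" for b
    proof -
      have "(1 + norm y) ^ N * norm (ddir b h p) \<le> ((1 + norm p) * (1 + norm z + norm z')) ^ N * norm (ddir b h p)"
        by (intro mult_right_mono yN) auto
      also have "\<dots> = ((1 + norm p) ^ N * norm (ddir b h p)) * (1 + norm z + norm z') ^ N"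
        by (simp add: power_mult_distrib)
      also have "\<dots> \<le> ((1 + norm p) ^ Suc N * norm (ddir b h p)) * (1 + norm z + norm z') ^ N"
        by (intro mult_right_mono power_increasing) auto
      also have "\<dots> \<le> B * (1 + norm z + norm z') ^ N"
        using sbdD[OF B, of "b # vs" p] vs b
        by (intro mult_right_mono) (auto simp: dirs_upto_def h_def ddir_def)
      finally show ?thesis .
    qed
    then have "(\<Sum>b\<in>Basis. (1 + norm y) ^ N * norm (ddir b h p)) \<le> (\<Sum>b\<in>(Basis::'a set). B * (1 + norm z + norm z') ^ N)"
      by (rule sum_mono)
    then have "(1 + norm y) ^ N * (\<Sum>b\<in>Basis. norm (ddir b h p)) \<le> real DIM('a) * (B * (1 + norm z + norm z') ^ N)"
      by (simp add: sum_distrib_left)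
    then show "(\<Sum>b\<in>Basis. norm (ddir b h p)) \<le> ?M"
      using y0 by (simp add: pos_le_divide_eq mult_ac)
  qed
  then have "(1 + norm y) ^ N * norm (h (y + z) - h (y + z')) \<le> (1 + norm y) ^ N * (?M * norm (z - z'))"
    using y0 by (intro mult_left_mono) (auto simp: algebra_simps)
  also have "\<dots> = real DIM('a) * B * norm (z - z') * (1 + norm z + norm z') ^ N"
    using y1 by (simp add: field_simps)
  finally show "(1 + norm y) ^ N * norm (dderivs vs (\<lambda>y. f (y + z) - f (y + z')) y)
      \<le> real DIM('a) * B * norm (z - z') * (1 + norm z + norm z') ^ N"
    unfolding d .
qed

lemma lipfam_translate:
  fixes f :: "'a::euclidean_space \<Rightarrow> complex"
  assumes "schwartz f"
  shows "lipfam (\<lambda>z y. f (y + z))"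
  unfolding lipfam_def
proof (intro conjI allI)
  fix N
  obtain B where "sbd (Suc N) f B" using assms unfolding schwartz_iff by blast
  from sbd_translate_diff[OF schwartz_smooth_fun[OF assms] this]
  show "\<exists>C K. \<forall>z z'. sbd N (\<lambda>y. f (y + z) - f (y + z')) (C * norm (z - z') * (1 + norm z + norm z') ^ K)"
    by blast
qed (simp add: schwartz_translate assms)

lemma lipfam_affine:
  fixes g :: "'b::euclidean_space \<Rightarrow> 'a::euclidean_space \<Rightarrow> complex"
  assumes "lipfam g"
  shows "lipfam (\<lambda>z. g (a *\<^sub>R z + z0))"
  unfolding lipfam_def
proof (intro conjI allI)
  fix N
  obtain C K where C: "C \<ge> 0" and CK: "\<And>z z'. sbd N (\<lambda>y. g z y - g z' y) (C * norm (z - z') * (1 + norm z + norm z') ^ K)"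
    using lipfamE[OF assms] by metis
  have "sbd N (\<lambda>y. g (a *\<^sub>R z + z0) y - g (a *\<^sub>R z' + z0) y)
      ((C * \<bar>a\<bar> * (1 + 2 * norm z0 + \<bar>a\<bar>) ^ K) * norm (z - z') * (1 + norm z + norm z') ^ K)" for z z'
  proof (rule sbd_mono[OF CK])
    have "norm (a *\<^sub>R z + z0 - (a *\<^sub>R z' + z0)) = \<bar>a\<bar> * norm (z - z')"
      by (metis add_diff_cancel_right norm_scaleR scaleR_diff_right)
    moreover have "1 + norm (a *\<^sub>R z + z0) + norm (a *\<^sub>R z' + z0) \<le> (1 + 2 * norm z0 + \<bar>a\<bar>) * (1 + norm z + norm z')"
    proof -
      have "norm (a *\<^sub>R z + z0) \<le> \<bar>a\<bar> * norm z + norm z0" "norm (a *\<^sub>R z' + z0) \<le> \<bar>a\<bar> * norm z' + norm z0"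
        using norm_triangle_ineq[of "a *\<^sub>R z" z0] norm_triangle_ineq[of "a *\<^sub>R z'" z0] by auto
      moreover have "(1 + 2 * norm z0 + \<bar>a\<bar>) * (1 + norm z + norm z') = 1 + norm z + norm z' + 2 * norm z0
          + 2 * (norm z0 * (norm z + norm z')) + \<bar>a\<bar> + \<bar>a\<bar> * norm z + \<bar>a\<bar> * norm z'"
        by (simp add: algebra_simps)
      moreover have "0 \<le> norm z0 * (norm z + norm z')" by simp
      ultimately show ?thesis using norm_ge_zero[of z] norm_ge_zero[of z'] abs_ge_zero[of a] by linarith
    qed
    ultimately have "C * norm (a *\<^sub>R z + z0 - (a *\<^sub>R z' + z0)) * (1 + norm (a *\<^sub>R z + z0) + norm (a *\<^sub>R z' + z0)) ^ K
        \<le> C * (\<bar>a\<bar> * norm (z - z')) * ((1 + 2 * norm z0 + \<bar>a\<bar>) * (1 + norm z + norm z')) ^ K"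
      using C by (intro mult_mono power_mono) auto
    then show "C * norm (a *\<^sub>R z + z0 - (a *\<^sub>R z' + z0)) * (1 + norm (a *\<^sub>R z + z0) + norm (a *\<^sub>R z' + z0)) ^ K
        \<le> (C * \<bar>a\<bar> * (1 + 2 * norm z0 + \<bar>a\<bar>) ^ K) * norm (z - z') * (1 + norm z + norm z') ^ K"
      by (simp only: power_mult_distrib mult_ac)
  qed
  then show "\<exists>C K. \<forall>z z'. sbd N (\<lambda>y. g (a *\<^sub>R z + z0) y - g (a *\<^sub>R z' + z0) y) (C * norm (z - z') * (1 + norm z + norm z') ^ K)"
    by blast
qed (simp add: lipfam_schwartz assms)

text \<open>Differentiating a character only multiplies it by a linear factor in \<tau>. The other
  Leibniz term has the same shape with \<open>ddir b \<psi>\<close> for \<psi>, so the following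
  inductions run from the right end of the list and generalize over \<psi>.\<close>

lemma dderivs_mult_echar_snoc:
  assumes "smooth_fun \<psi>"
  shows "dderivs (vs @ [b]) (\<lambda>y. \<psi> y * echar \<tau> y) =
    (\<lambda>x. (- \<i> * of_real (b \<bullet> \<tau>)) * dderivs vs (\<lambda>y. \<psi> y * echar \<tau> y) x + dderivs vs (\<lambda>y. ddir b \<psi> y * echar \<tau> y) x)"
proof -
  have "ddir b (\<lambda>y. \<psi> y * echar \<tau> y) = (\<lambda>y. (- \<i> * of_real (b \<bullet> \<tau>)) * (\<psi> y * echar \<tau> y) + ddir b \<psi> y * echar \<tau> y)"
    by (simp add: ddir_mult assms smooth_fun_echar ddir_echar fun_eq_iff mult_ac)
  then show ?thesis
    by (simp only: dderivs_snoc dderivs_add dderivs_cmult smooth_fun_cmult smooth_fun_mult smooth_fun_echar smooth_fun_ddir assms)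
qed

lemma modulation_bound:
  assumes "schwartz \<psi>" "set vs \<subseteq> Basis"
  shows "\<exists>C\<ge>0. \<forall>\<tau> x. (1 + norm x) ^ k * norm (dderivs vs (\<lambda>y. \<psi> y * echar \<tau> y) x) \<le> C * (1 + norm \<tau>) ^ length vs"
  using assms
proof (induction vs arbitrary: \<psi> rule: rev_induct)
  case Nil
  obtain B where B: "sbd k \<psi> B" using Nil(1) unfolding schwartz_iff by blast
  show ?case using sbdD[OF B, of "[]"] sbd_nonneg[OF B] by (intro exI[of _ B]) (simp add: norm_mult)
next
  case (snoc b vs)
  obtain C where C: "C \<ge> 0" "\<And>\<tau> x. (1 + norm x) ^ k * norm (dderivs vs (\<lambda>y. \<psi> y * echar \<tau> y) x) \<le> C * (1 + norm \<tau>) ^ length vs"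
    using snoc.IH[OF snoc.prems(1)] snoc.prems(2) by auto
  obtain C' where C': "C' \<ge> 0" "\<And>\<tau> x. (1 + norm x) ^ k * norm (dderivs vs (\<lambda>y. ddir b \<psi> y * echar \<tau> y) x) \<le> C' * (1 + norm \<tau>) ^ length vs"
    using snoc.IH[OF schwartz_ddir[OF snoc.prems(1)], of b] snoc.prems(2) by auto
  have "(1 + norm x) ^ k * norm (dderivs (vs @ [b]) (\<lambda>y. \<psi> y * echar \<tau> y) x) \<le> (C + C') * (1 + norm \<tau>) ^ length (vs @ [b])" for \<tau> x
  proof -
    let ?P = "dderivs vs (\<lambda>y. \<psi> y * echar \<tau> y) x" and ?Q = "dderivs vs (\<lambda>y. ddir b \<psi> y * echar \<tau> y) x"
    have b: "\<bar>b \<bullet> \<tau>\<bar> \<le> 1 + norm \<tau>" using Basis_le_norm[of b \<tau>] snoc.prems(2) by (simp add: inner_commute)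
    have "norm ((- \<i> * of_real (b \<bullet> \<tau>)) * ?P + ?Q) \<le> \<bar>b \<bullet> \<tau>\<bar> * norm ?P + norm ?Q"
      by (rule order_trans[OF norm_triangle_ineq]) (simp add: norm_mult)
    then have "(1 + norm x) ^ k * norm ((- \<i> * of_real (b \<bullet> \<tau>)) * ?P + ?Q) \<le> (1 + norm x) ^ k * (\<bar>b \<bullet> \<tau>\<bar> * norm ?P + norm ?Q)"
      by (intro mult_left_mono) auto
    also have "\<dots> = \<bar>b \<bullet> \<tau>\<bar> * ((1 + norm x) ^ k * norm ?P) + 1 * ((1 + norm x) ^ k * norm ?Q)"
      by (simp add: algebra_simps)
    also have "\<dots> \<le> (1 + norm \<tau>) * (C * (1 + norm \<tau>) ^ length vs) + (1 + norm \<tau>) * (C' * (1 + norm \<tau>) ^ length vs)"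
      by (rule add_mono[OF mult_mono[OF b C(2)] mult_mono[OF _ C'(2)]]) auto
    also have "\<dots> = (C + C') * (1 + norm \<tau>) ^ length (vs @ [b])" by (simp add: algebra_simps)
    finally show ?thesis
      unfolding dderivs_mult_echar_snoc[OF schwartz_smooth_fun[OF snoc.prems(1)]] .
  qed
  then show ?case using C(1) C'(1) by (intro exI[of _ "C + C'"]) auto
qed

lemma norm_affine_diff_le:
  fixes a :: "'b::real_normed_algebra"
  shows "norm ((a * P + Q) - (a' * P' + Q')) \<le> norm a * norm (P - P') + (norm (a - a') * norm P' + norm (Q - Q'))"
proof -
  have "(a * P + Q) - (a' * P' + Q') = a * (P - P') + ((a - a') * P' + (Q - Q'))"
    by (simp add: algebra_simps)
  then show ?thesis
    by (metis add_mono norm_mult_ineq norm_triangle_le order_refl)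
qed

lemma modulation_lipschitz:
  assumes "schwartz \<psi>" "set vs \<subseteq> Basis"
  shows "\<exists>C\<ge>0. \<forall>\<tau> \<sigma> x. (1 + norm x) ^ k * norm (dderivs vs (\<lambda>y. \<psi> y * echar \<tau> y) x - dderivs vs (\<lambda>y. \<psi> y * echar \<sigma> y) x)
     \<le> C * norm (\<tau> - \<sigma>) * (1 + norm \<tau> + norm \<sigma>) ^ length vs"
  using assms
proof (induction vs arbitrary: \<psi> rule: rev_induct)
  case Nil
  \<comment> \<open>One extra power of the weight absorbs the factor \<open>norm x\<close> in the
    Lipschitz bound for characters.\<close>
  obtain B where B: "sbd (Suc k) \<psi> B" using Nil(1) unfolding schwartz_iff by blast
  have "(1 + norm x) ^ k * norm (\<psi> x * echar \<tau> x - \<psi> x * echar \<sigma> x) \<le> B * norm (\<tau> - \<sigma>)" for \<tau> \<sigma> x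
  proof -
    have "(1 + norm x) ^ k * norm (\<psi> x * echar \<tau> x - \<psi> x * echar \<sigma> x) = (1 + norm x) ^ k * norm (\<psi> x) * norm (echar \<tau> x - echar \<sigma> x)"
      by (simp add: norm_mult right_diff_distrib[symmetric])
    also have "\<dots> \<le> (1 + norm x) ^ k * norm (\<psi> x) * (norm (\<tau> - \<sigma>) * (1 + norm x))"
      by (intro mult_left_mono order_trans[OF norm_echar_diff_le]) auto
    also have "\<dots> = ((1 + norm x) ^ Suc k * norm (\<psi> x)) * norm (\<tau> - \<sigma>)" by (simp add: mult_ac)
    also have "\<dots> \<le> B * norm (\<tau> - \<sigma>)" using sbdD[OF B, of "[]" x] by (intro mult_right_mono) auto
    finally show ?thesis .
  qed
  then show ?case using sbd_nonneg[OF B] by (intro exI[of _ B]) auto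
next
  case (snoc b vs)
  note sm = schwartz_smooth_fun[OF snoc.prems(1)]
  obtain C where C: "C \<ge> 0" "\<And>\<tau> \<sigma> x. (1 + norm x) ^ k * norm (dderivs vs (\<lambda>y. \<psi> y * echar \<tau> y) x - dderivs vs (\<lambda>y. \<psi> y * echar \<sigma> y) x)
     \<le> C * norm (\<tau> - \<sigma>) * (1 + norm \<tau> + norm \<sigma>) ^ length vs"
    using snoc.IH[OF snoc.prems(1)] snoc.prems(2) by auto
  obtain C' where C': "C' \<ge> 0" "\<And>\<tau> \<sigma> x. (1 + norm x) ^ k * norm (dderivs vs (\<lambda>y. ddir b \<psi> y * echar \<tau> y) x - dderivs vs (\<lambda>y. ddir b \<psi> y * echar \<sigma> y) x)
     \<le> C' * norm (\<tau> - \<sigma>) * (1 + norm \<tau> + norm \<sigma>) ^ length vs"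
    using snoc.IH[OF schwartz_ddir[OF snoc.prems(1)], of b] snoc.prems(2) by auto
  \<comment> \<open>Splitting a P - a' P' leaves a term (a - a') P' in which P' is not differenced;
    the growth bound takes care of it.\<close>
  obtain C2 where C2: "C2 \<ge> 0" "\<And>\<tau> x. (1 + norm x) ^ k * norm (dderivs vs (\<lambda>y. \<psi> y * echar \<tau> y) x) \<le> C2 * (1 + norm \<tau>) ^ length vs"
    using modulation_bound[OF snoc.prems(1), of vs k] snoc.prems(2) by auto
  have "(1 + norm x) ^ k * norm (dderivs (vs @ [b]) (\<lambda>y. \<psi> y * echar \<tau> y) x - dderivs (vs @ [b]) (\<lambda>y. \<psi> y * echar \<sigma> y) x)
      \<le> (C + C2 + C') * norm (\<tau> - \<sigma>) * (1 + norm \<tau> + norm \<sigma>) ^ length (vs @ [b])" for \<tau> \<sigma> x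
  proof -
    let ?P = "\<lambda>\<tau>. dderivs vs (\<lambda>y. \<psi> y * echar \<tau> y) x" and ?Q = "\<lambda>\<tau>. dderivs vs (\<lambda>y. ddir b \<psi> y * echar \<tau> y) x"
    let ?m = "1 + norm \<tau> + norm \<sigma>" and ?d = "norm (\<tau> - \<sigma>)" and ?X = "(1 + norm x) ^ k"
    have b: "\<bar>b \<bullet> \<tau>\<bar> \<le> ?m" using Basis_le_norm[of b \<tau>] snoc.prems(2) norm_ge_zero[of \<sigma>] by (simp add: inner_commute add_increasing2)
    have b': "\<bar>b \<bullet> (\<tau> - \<sigma>)\<bar> \<le> ?d" using Basis_le_norm[of b "\<tau> - \<sigma>"] snoc.prems(2) by (simp add: inner_commute)
    let ?a = "\<lambda>\<tau>. - \<i> * complex_of_real (b \<bullet> \<tau>)"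
    have "?a \<tau> - ?a \<sigma> = ?a (\<tau> - \<sigma>)" by (simp add: inner_diff_right algebra_simps)
    then have a: "norm (?a \<tau>) = \<bar>b \<bullet> \<tau>\<bar>" "norm (?a \<tau> - ?a \<sigma>) = \<bar>b \<bullet> (\<tau> - \<sigma>)\<bar>"
      by (simp_all only: norm_mult norm_minus_cancel norm_ii norm_of_real mult_1_left)
    have "norm ((?a \<tau> * ?P \<tau> + ?Q \<tau>) - (?a \<sigma> * ?P \<sigma> + ?Q \<sigma>))
        \<le> \<bar>b \<bullet> \<tau>\<bar> * norm (?P \<tau> - ?P \<sigma>) + (\<bar>b \<bullet> (\<tau> - \<sigma>)\<bar> * norm (?P \<sigma>) + norm (?Q \<tau> - ?Q \<sigma>))"
      by (rule norm_affine_diff_le[of "?a \<tau>" "?P \<tau>" "?Q \<tau>" "?a \<sigma>" "?P \<sigma>" "?Q \<sigma>", unfolded a])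
    then have "?X * norm ((?a \<tau> * ?P \<tau> + ?Q \<tau>) - (?a \<sigma> * ?P \<sigma> + ?Q \<sigma>))
        \<le> ?X * (\<bar>b \<bullet> \<tau>\<bar> * norm (?P \<tau> - ?P \<sigma>) + (\<bar>b \<bullet> (\<tau> - \<sigma>)\<bar> * norm (?P \<sigma>) + norm (?Q \<tau> - ?Q \<sigma>)))"
      by (rule mult_left_mono) simp
    also have "\<dots> = \<bar>b \<bullet> \<tau>\<bar> * (?X * norm (?P \<tau> - ?P \<sigma>)) + (\<bar>b \<bullet> (\<tau> - \<sigma>)\<bar> * (?X * norm (?P \<sigma>)) + ?X * norm (?Q \<tau> - ?Q \<sigma>))"
      by (simp add: algebra_simps)
    also have "\<dots> \<le> ?m * (C * ?d * ?m ^ length vs) + (?d * (C2 * ?m ^ Suc (length vs)) + C' * ?d * ?m ^ Suc (length vs))"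
    proof (rule add_mono[OF mult_mono[OF b C(2)] add_mono[OF mult_mono[OF b']]])
      have "?X * norm (?P \<sigma>) \<le> C2 * (1 + norm \<sigma>) ^ length vs" by (rule C2)
      also have "\<dots> \<le> C2 * ?m ^ length vs" by (intro mult_left_mono power_mono C2) auto
      also have "\<dots> \<le> C2 * ?m ^ Suc (length vs)" by (intro mult_left_mono power_increasing C2) auto
      finally show "?X * norm (?P \<sigma>) \<le> C2 * ?m ^ Suc (length vs)" .
      have "?X * norm (?Q \<tau> - ?Q \<sigma>) \<le> C' * ?d * ?m ^ length vs" by (rule C')
      also have "\<dots> \<le> C' * ?d * ?m ^ Suc (length vs)" using C' by (intro mult_left_mono power_increasing) auto
      finally show "?X * norm (?Q \<tau> - ?Q \<sigma>) \<le> C' * ?d * ?m ^ Suc (length vs)" .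
    qed (use b b' C in auto)
    also have "\<dots> = (C + C2 + C') * ?d * ?m ^ length (vs @ [b])" by (simp add: algebra_simps)
    finally show ?thesis
      unfolding dderivs_mult_echar_snoc[OF sm] .
  qed
  then show ?case using C(1) C'(1) C2(1) by (intro exI[of _ "C + C2 + C'"]) auto
qed

lemma schwartz_modulation:
  assumes "schwartz \<psi>"
  shows "schwartz (\<lambda>y. \<psi> y * echar \<tau> y)"
  unfolding schwartz_def
proof (intro conjI allI impI)
  show "smooth_fun (\<lambda>y. \<psi> y * echar \<tau> y)"
    by (intro smooth_fun_mult smooth_fun_echar schwartz_smooth_fun assms)
  fix vs :: "'a list" and k assume "set vs \<subseteq> Basis"
  from modulation_bound[OF assms this, of k]
  show "bounded (range (\<lambda>x. (1 + norm x) ^ k * norm (dderivs vs (\<lambda>y. \<psi> y * echar \<tau> y) x)))"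
    by (force simp: bounded_iff abs_mult)
qed

lemma lipfam_modulation:
  assumes "schwartz \<psi>"
  shows "lipfam (\<lambda>\<tau> y. \<psi> y * echar \<tau> y)"
  unfolding lipfam_def
proof (intro conjI allI)
  fix N
  let ?D = "dirs_upto N :: 'a list set"
  have "\<forall>vs\<in>?D. \<exists>C\<ge>0. \<forall>\<tau> \<sigma> x. (1 + norm x) ^ N * norm (dderivs vs (\<lambda>y. \<psi> y * echar \<tau> y) x - dderivs vs (\<lambda>y. \<psi> y * echar \<sigma> y) x)
     \<le> C * norm (\<tau> - \<sigma>) * (1 + norm \<tau> + norm \<sigma>) ^ length vs"
    by (intro ballI modulation_lipschitz[OF assms]) (simp add: dirs_upto_def)
  from bchoice[OF this] obtain C where C0: "\<forall>vs\<in>?D. C vs \<ge> 0 \<and> (\<forall>\<tau> \<sigma> x. (1 + norm x) ^ N * norm (dderivs vs (\<lambda>y. \<psi> y * echar \<tau> y) x - dderivs vs (\<lambda>y. \<psi> y * echar \<sigma> y) x)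
     \<le> C vs * norm (\<tau> - \<sigma>) * (1 + norm \<tau> + norm \<sigma>) ^ length vs)" ..
  then have C: "\<And>vs. vs \<in> ?D \<Longrightarrow> C vs \<ge> 0" "\<And>vs \<tau> \<sigma> x. vs \<in> ?D \<Longrightarrow> (1 + norm x) ^ N * norm (dderivs vs (\<lambda>y. \<psi> y * echar \<tau> y) x - dderivs vs (\<lambda>y. \<psi> y * echar \<sigma> y) x)
     \<le> C vs * norm (\<tau> - \<sigma>) * (1 + norm \<tau> + norm \<sigma>) ^ length vs"
    by blast+
  have sm: "smooth_fun (\<lambda>y. \<psi> y * echar \<tau> y)" for \<tau>
    by (rule schwartz_smooth_fun[OF schwartz_modulation[OF assms]])
  have "sbd N (\<lambda>y. \<psi> y * echar \<tau> y - \<psi> y * echar \<sigma> y) ((\<Sum>vs\<in>?D. C vs) * norm (\<tau> - \<sigma>) * (1 + norm \<tau> + norm \<sigma>) ^ N)" for \<tau> \<sigma>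
    unfolding sbd_def
  proof (intro ballI allI)
    fix vs x assume vs: "vs \<in> ?D"
    have "(1 + norm x) ^ N * norm (dderivs vs (\<lambda>y. \<psi> y * echar \<tau> y - \<psi> y * echar \<sigma> y) x)
        \<le> C vs * norm (\<tau> - \<sigma>) * (1 + norm \<tau> + norm \<sigma>) ^ length vs"
      using C(2)[OF vs] by (simp add: dderivs_diff sm)
    also have "\<dots> \<le> (\<Sum>vs\<in>?D. C vs) * norm (\<tau> - \<sigma>) * (1 + norm \<tau> + norm \<sigma>) ^ N"
      using vs C(1) by (intro mult_mono power_increasing member_le_sum finite_dirs_upto) (auto simp: dirs_upto_def intro!: sum_nonneg mult_nonneg_nonneg)
    finally show "(1 + norm x) ^ N * norm (dderivs vs (\<lambda>y. \<psi> y * echar \<tau> y - \<psi> y * echar \<sigma> y) x)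
      \<le> (\<Sum>vs\<in>?D. C vs) * norm (\<tau> - \<sigma>) * (1 + norm \<tau> + norm \<sigma>) ^ N" .
  qed
  then show "\<exists>C K. \<forall>\<tau> \<sigma>. sbd N (\<lambda>y. \<psi> y * echar \<tau> y - \<psi> y * echar \<sigma> y) (C * norm (\<tau> - \<sigma>) * (1 + norm \<tau> + norm \<sigma>) ^ K)"
    by blast
qed (rule schwartz_modulation[OF assms])

section \<open>Fourier transform of test functions\<close>

text \<open>Translation invariance makes the integral of every difference quotient vanish. The
  quotients are dominated by a multiple of the integrable weight, so the limit has integral 0 as
  well.\<close>

lemma integral_ddir_schwartz:
  fixes f :: "'a::euclidean_space \<Rightarrow> complex"
  assumes f: "schwartz f"
  shows "(\<integral>x. ddir v f x \<partial>lborel) = 0"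
proof -
  let ?N = "DIM('a) + 2"
  define X :: "nat \<Rightarrow> real" where "X n = 1 / (real n + 1)" for n
  have X: "0 < X n" "X n \<le> 1" for n by (auto simp: X_def divide_simps)
  have Xne: "X n \<noteq> 0" for n using X(1)[of n] by linarith
  have X0: "X \<longlonglongrightarrow> 0"
    unfolding X_def using LIMSEQ_inverse_real_of_nat by (simp add: inverse_eq_divide add.commute)
  note sm = schwartz_smooth_fun[OF f]
  obtain B where B: "sbd (Suc ?N) f B" using f unfolding schwartz_iff by blast
  define q where "q n x = (f (x + X n *\<^sub>R v) - f x) /\<^sub>R X n" for n x
  define M where "M = real DIM('a) * B * norm v * (1 + norm v) ^ ?N"
  have qb: "(1 + norm y) ^ ?N * norm (q n y) \<le> M" for n y
  proof -
    let ?z = "X n *\<^sub>R v"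
    have "(1 + norm y) ^ ?N * norm (f (y + ?z) - f (y + 0)) \<le> real DIM('a) * B * norm (?z - 0) * (1 + norm ?z + norm (0::'a)) ^ ?N"
      using sbdD[OF sbd_translate_diff[OF sm B], of "[]" y ?z 0] by (simp del: power_Suc)
    also have "\<dots> = real DIM('a) * B * (X n * norm v) * (1 + X n * norm v) ^ ?N" using X[of n] by simp
    also have "\<dots> \<le> real DIM('a) * B * (X n * norm v) * (1 + norm v) ^ ?N"
      using X[of n] sbd_nonneg[OF B] by (intro mult_left_mono power_mono) (auto simp: mult_left_le_one_le)
    also have "\<dots> = X n * M" by (simp add: M_def)
    finally have "(1 + norm y) ^ ?N * norm (f (y + ?z) - f (y + 0)) \<le> X n * M" .
    moreover have "norm (f (y + ?z) - f (y + 0)) = X n * norm (q n y)" using X[of n] by (simp add: q_def)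
    ultimately have "(1 + norm y) ^ ?N * (X n * norm (q n y)) \<le> X n * M" by (simp only:)
    then have "X n * ((1 + norm y) ^ ?N * norm (q n y)) \<le> X n * M" by (simp only: mult_ac)
    then show ?thesis using X[of n] by simp
  qed
  have fm: "f \<in> borel_measurable borel" by (rule smooth_fun_borel_measurable[OF sm])
  have qm: "q n \<in> borel_measurable borel" for n
    unfolding q_def using fm by measurable
  have q0: "(\<integral>x. q n x \<partial>lborel) = 0" for n
  proof -
    have i1: "integrable lborel (\<lambda>x. f (x + X n *\<^sub>R v))" by (rule schwartz_integrable[OF schwartz_translate[OF f]])
    have "(\<integral>x. f (x + X n *\<^sub>R v) \<partial>lborel) = (\<integral>x. f x \<partial>lborel)"
      using integral_translate[OF fm, of "X n *\<^sub>R v"] by (simp add: add.commute)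
    then show ?thesis unfolding q_def using i1 schwartz_integrable[OF f] by simp
  qed
  have lim: "(\<lambda>n. q n x) \<longlonglongrightarrow> ddir v f x" for x
  proof -
    let ?D = "\<lambda>v. ddir v f x"
    have "((\<lambda>t. f (x + t *\<^sub>R v)) has_derivative (\<lambda>t. ?D (t *\<^sub>R v))) (at 0)"
      by (rule has_derivative_compose[where f = "\<lambda>t. x + t *\<^sub>R v" and g = f])
         (use has_derivative_ddir[OF sm, of x] in \<open>auto intro!: derivative_eq_intros\<close>)
    then have "((\<lambda>t. (f (x + t *\<^sub>R v) - f (x + 0 *\<^sub>R v) - ?D ((t - 0) *\<^sub>R v)) /\<^sub>R norm (t - 0)) \<longlongrightarrow> 0) (at 0)"
      unfolding has_derivative_at_within by (rule conjunct2)
    from this[unfolded tendsto_at_iff_sequentially comp_def, THEN spec, of X]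
    have "((\<lambda>n. (f (x + X n *\<^sub>R v) - f (x + 0 *\<^sub>R v) - ?D ((X n - 0) *\<^sub>R v)) /\<^sub>R norm (X n - 0)) \<longlonglongrightarrow> 0)"
      using Xne X0 by simp
    moreover have "(f (x + X n *\<^sub>R v) - f (x + 0 *\<^sub>R v) - ?D ((X n - 0) *\<^sub>R v)) /\<^sub>R norm (X n - 0) = q n x - ?D v" for n
    proof -
      have "?D (X n *\<^sub>R v) = X n *\<^sub>R ?D v"
        by (rule linear_scale[OF has_derivative_linear[OF has_derivative_ddir[OF sm]]])
      then show ?thesis using X[of n] by (simp add: q_def scaleR_diff_right)
    qed
    ultimately show ?thesis by (simp add: LIM_zero_iff)
  qed
  have "(\<lambda>n. \<integral>x. q n x \<partial>lborel) \<longlonglongrightarrow> (\<integral>x. ddir v f x \<partial>lborel)"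
  proof (rule integral_dominated_convergence[where w = "\<lambda>x. M * (1 / (1 + norm x) ^ ?N)"])
    show "integrable lborel (\<lambda>x::'a. M * (1 / (1 + norm x) ^ ?N))"
      by (rule integrable_mult_right[OF integrable_inverse_power_norm])
    show "AE x in lborel. (\<lambda>n. q n x) \<longlonglongrightarrow> ddir v f x" by (intro AE_I2 lim)
    have "norm (q n x) \<le> M * (1 / (1 + norm x) ^ ?N)" for n x
    proof -
      have "(1 + norm x) ^ ?N > 0" by (intro zero_less_power add_pos_nonneg) auto
      then show ?thesis using qb[of x n] by (simp only: times_divide_eq_right mult_1_right pos_le_divide_eq mult.commute)
    qed
    then show "AE x in lborel. norm (q n x) \<le> M * (1 / (1 + norm x) ^ ?N)" for n by (intro AE_I2)
    show "ddir v f \<in> borel_measurable lborel"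
      using smooth_fun_borel_measurable[OF smooth_fun_ddir[OF sm]] by simp
    show "q n \<in> borel_measurable lborel" for n using qm by simp
  qed
  then show ?thesis by (simp add: q0 LIMSEQ_const_iff)
qed

text \<open>Same transform as \<open>fourier\<close>, which is tied to vectors
  \<open>real^'m\<close>; the analysis below is done over any Euclidean space.\<close>

definition ft :: "('a::euclidean_space \<Rightarrow> complex) \<Rightarrow> 'a \<Rightarrow> complex" where
  "ft f \<xi> = (\<integral>x. f x * echar \<xi> x \<partial>lborel)"

lemma integrable_echar:
  assumes "integrable lborel f"
  shows "integrable lborel (\<lambda>x. f x * echar \<xi> x)"
proof (rule Bochner_Integration.integrable_bound[OF assms])
  have [measurable]: "echar \<xi> \<in> borel_measurable borel" by (rule smooth_fun_borel_measurable[OF smooth_fun_echar])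
  have [measurable]: "f \<in> borel_measurable borel" using borel_measurable_integrable[OF assms] by simp
  show "(\<lambda>x. f x * echar \<xi> x) \<in> borel_measurable lborel" by simp
qed (simp add: norm_mult)

text \<open>The two factors are kept apart because only \<open>u\<close> has compact support, while
  \<open>v\<close> is going to be a translate or a reflected kernel whose derivatives must be
  tracked separately.\<close>

lemma ft_by_parts:
  fixes u v :: "'a::euclidean_space \<Rightarrow> complex"
  assumes u: "test_fun u" and v: "smooth_fun v"
  shows "(\<i> * of_real (b \<bullet> \<xi>)) * ft (\<lambda>x. u x * v x) \<xi> = ft (\<lambda>x. ddir b u x * v x) \<xi> + ft (\<lambda>x. u x * ddir b v x) \<xi>"
proof -
  let ?e = "echar \<xi>" and ?c = "\<i> * complex_of_real (b \<bullet> \<xi>)"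
  note su = test_fun_smooth_fun[OF u]
  have uv: "smooth_fun (\<lambda>x. u x * v x)" by (rule smooth_fun_mult[OF su v])
  have D: "ddir b (\<lambda>x. u x * v x * ?e x) = (\<lambda>x. (ddir b u x * v x) * ?e x + (u x * ddir b v x) * ?e x - ?c * ((u x * v x) * ?e x))"
    by (simp only: ddir_mult uv su v smooth_fun_echar ddir_echar) (simp add: fun_eq_iff algebra_simps)
  have i: "integrable lborel (\<lambda>x. (u x * v x) * ?e x)" "integrable lborel (\<lambda>x. (ddir b u x * v x) * ?e x)" "integrable lborel (\<lambda>x. (u x * ddir b v x) * ?e x)"
    by (intro integrable_echar integrable_test_fun test_fun_mult u v test_fun_ddir smooth_fun_ddir)+
  have "(\<integral>x. ddir b (\<lambda>x. u x * v x * ?e x) x \<partial>lborel) = 0"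
    by (intro integral_ddir_schwartz test_fun_schwartz test_fun_mult u v smooth_fun_echar)
  then have "ft (\<lambda>x. ddir b u x * v x) \<xi> + ft (\<lambda>x. u x * ddir b v x) \<xi> - ?c * ft (\<lambda>x. u x * v x) \<xi> = 0"
    unfolding D ft_def using i by simp
  then show ?thesis by simp
qed

text \<open>Uniformity in \<open>h\<close> is the purpose: bounds on the derivatives of
  \<open>v\<close> do not see the translation, and the domain of integration is fixed by
  \<open>u\<close>. Each integration by parts changes one of the factors, so the induction
  generalizes over both.\<close>

lemma ft_translate_decay_aux:
  fixes u v :: "'a::euclidean_space \<Rightarrow> complex"
  assumes "test_fun u" "smooth_fun v" "\<And>vs. set vs \<subseteq> Basis \<Longrightarrow> bounded (range (dderivs vs v))"
  shows "\<exists>C. \<forall>h \<tau>. norm \<tau> ^ L * norm (ft (\<lambda>x. u x * v (x + h)) \<tau>) \<le> C"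
  using assms
proof (induction L arbitrary: u v)
  case 0
  have "bounded (range v)" using "0.prems"(3)[of "[]"] by simp
  then obtain B where B: "\<And>x. norm (v x) \<le> B" by (auto simp: bounded_iff)
  have "norm (ft (\<lambda>x. u x * v (x + h)) \<tau>) \<le> (\<integral>x. norm (u x) * B \<partial>lborel)" for h \<tau>
    unfolding ft_def
  proof (rule Bochner_Integration.integral_norm_bound_integral)
    have "smooth_fun (\<lambda>x. v (x + h))" using smooth_fun_compose_affine[OF "0.prems"(2), of 1 h] by simp
    then show "integrable lborel (\<lambda>x. u x * v (x + h) * echar \<tau> x)"
      by (intro integrable_echar integrable_test_fun test_fun_mult "0.prems"(1))
    show "integrable lborel (\<lambda>x. norm (u x) * B)"
      by (intro integrable_mult_left integrable_norm integrable_test_fun "0.prems"(1))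
  qed (auto simp: norm_mult intro!: mult_left_mono B)
  then show ?case by auto
next
  case (Suc L)
  have bd: "bounded (range (dderivs vs (ddir b v)))" if "set vs \<subseteq> Basis" "b \<in> Basis" for vs b
    using Suc.prems(3)[of "vs @ [b]"] that by (simp add: dderivs_snoc)
  have "\<forall>b\<in>Basis. \<exists>C. \<forall>h \<tau>. norm \<tau> ^ L * norm (ft (\<lambda>x. ddir b u x * v (x + h)) \<tau>) \<le> C"
    by (intro ballI Suc.IH test_fun_ddir Suc.prems)
  from bchoice[OF this] obtain C where C: "\<forall>b\<in>Basis. \<forall>h \<tau>. norm \<tau> ^ L * norm (ft (\<lambda>x. ddir b u x * v (x + h)) \<tau>) \<le> C b" ..
  have "\<forall>b\<in>Basis. \<exists>C. \<forall>h \<tau>. norm \<tau> ^ L * norm (ft (\<lambda>x. u x * ddir b v (x + h)) \<tau>) \<le> C"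
    by (intro ballI Suc.IH Suc.prems smooth_fun_ddir bd)
  from bchoice[OF this] obtain C' where C': "\<forall>b\<in>Basis. \<forall>h \<tau>. norm \<tau> ^ L * norm (ft (\<lambda>x. u x * ddir b v (x + h)) \<tau>) \<le> C' b" ..
  have "norm \<tau> ^ Suc L * norm (ft (\<lambda>x. u x * v (x + h)) \<tau>) \<le> (\<Sum>b\<in>Basis. C b + C' b)" for h \<tau>
  proof -
    let ?F = "norm (ft (\<lambda>x. u x * v (x + h)) \<tau>)"
    have sv: "smooth_fun (\<lambda>x. v (x + h))" using smooth_fun_compose_affine[OF Suc.prems(2), of 1 h] by simp
    have dv: "ddir b (\<lambda>x. v (x + h)) = (\<lambda>x. ddir b v (x + h))" for b
      using ddir_compose_affine[OF Suc.prems(2), of b 1 h] by simp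
    have one: "norm \<tau> ^ L * (\<bar>\<tau> \<bullet> b\<bar> * ?F) \<le> C b + C' b" if b: "b \<in> Basis" for b
    proof -
      have "\<bar>\<tau> \<bullet> b\<bar> * ?F = norm ((\<i> * of_real (b \<bullet> \<tau>)) * ft (\<lambda>x. u x * v (x + h)) \<tau>)"
        by (simp add: norm_mult inner_commute)
      also have "\<dots> \<le> norm (ft (\<lambda>x. ddir b u x * v (x + h)) \<tau>) + norm (ft (\<lambda>x. u x * ddir b v (x + h)) \<tau>)"
        unfolding ft_by_parts[OF Suc.prems(1) sv] dv by (rule norm_triangle_ineq)
      finally have "norm \<tau> ^ L * (\<bar>\<tau> \<bullet> b\<bar> * ?F) \<le> norm \<tau> ^ L * (norm (ft (\<lambda>x. ddir b u x * v (x + h)) \<tau>) + norm (ft (\<lambda>x. u x * ddir b v (x + h)) \<tau>))"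
        by (rule mult_left_mono) simp
      also have "\<dots> \<le> C b + C' b"
        unfolding distrib_left using C C' b by (intro add_mono) auto
      finally show ?thesis .
    qed
    have "norm \<tau> ^ Suc L * ?F = norm \<tau> ^ L * (norm \<tau> * ?F)" by simp
    also have "\<dots> \<le> norm \<tau> ^ L * ((\<Sum>b\<in>Basis. \<bar>\<tau> \<bullet> b\<bar>) * ?F)"
      by (intro mult_left_mono mult_right_mono norm_le_l1) auto
    also have "\<dots> = (\<Sum>b\<in>Basis. norm \<tau> ^ L * (\<bar>\<tau> \<bullet> b\<bar> * ?F))"
      by (simp only: sum_distrib_left sum_distrib_right)
    also have "\<dots> \<le> (\<Sum>b\<in>Basis. C b + C' b)" by (intro sum_mono one)
    finally show ?thesis .
  qed
  then show ?case by blast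
qed

lemma one_plus_power_le: "0 \<le> t \<Longrightarrow> (1 + t) ^ K \<le> 2 ^ K * (1 + t ^ K)" for t :: real
proof (cases "t \<le> 1")
  case True
  assume "0 \<le> t"
  then have "(1 + t) ^ K \<le> 2 ^ K" using True by (intro power_mono) auto
  also have "\<dots> \<le> 2 ^ K * (1 + t ^ K)" using \<open>0 \<le> t\<close> by simp
  finally show ?thesis .
next
  case False
  assume "0 \<le> t"
  then have "(1 + t) ^ K \<le> (2 * t) ^ K" using False by (intro power_mono) auto
  also have "\<dots> = 2 ^ K * t ^ K" by (rule power_mult_distrib)
  also have "\<dots> \<le> 2 ^ K * (1 + t ^ K)" by simp
  finally show ?thesis .
qed

lemma ft_translate_decay:
  fixes u v :: "'a::euclidean_space \<Rightarrow> complex"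
  assumes "test_fun u" "smooth_fun v" "\<And>vs. set vs \<subseteq> Basis \<Longrightarrow> bounded (range (dderivs vs v))"
  shows "\<exists>C. \<forall>h \<tau>. (1 + norm \<tau>) ^ K * norm (ft (\<lambda>x. u x * v (x + h)) \<tau>) \<le> C"
proof -
  obtain C where C: "\<And>h \<tau>. norm \<tau> ^ 0 * norm (ft (\<lambda>x. u x * v (x + h)) \<tau>) \<le> C"
    using ft_translate_decay_aux[OF assms, of 0] by blast
  obtain D where D: "\<And>h \<tau>. norm \<tau> ^ K * norm (ft (\<lambda>x. u x * v (x + h)) \<tau>) \<le> D"
    using ft_translate_decay_aux[OF assms, of K] by blast
  have "(1 + norm \<tau>) ^ K * norm (ft (\<lambda>x. u x * v (x + h)) \<tau>) \<le> 2 ^ K * (C + D)" for h \<tau>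
  proof -
    let ?F = "norm (ft (\<lambda>x. u x * v (x + h)) \<tau>)"
    have "(1 + norm \<tau>) ^ K * ?F \<le> (2 ^ K * (1 + norm \<tau> ^ K)) * ?F"
      by (intro mult_right_mono one_plus_power_le) auto
    also have "\<dots> = 2 ^ K * (norm \<tau> ^ 0 * ?F + norm \<tau> ^ K * ?F)" by (simp add: algebra_simps)
    also have "\<dots> \<le> 2 ^ K * (C + D)" by (intro mult_left_mono add_mono C D) auto
    finally show ?thesis .
  qed
  then show ?thesis by blast
qed

lemma dderivs_const: "\<exists>d. dderivs vs (\<lambda>x. c) = (\<lambda>x. d)"
  by (induction vs) (auto simp: dderivs_Cons_ddir ddir_const simp del: dderivs.simps(2))

lemma ft_continuous:
  fixes f :: "'a::euclidean_space \<Rightarrow> complex"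
  assumes "rapid f"
  shows "continuous_on UNIV (ft f)"
proof (rule continuous_on_local_lipschitz)
  fix \<tau> \<sigma> :: 'a
  have i: "integrable lborel (\<lambda>x. f x * echar \<tau> x)" for \<tau> by (rule integrable_echar[OF rapid_integrable_self[OF assms]])
  have "ft f \<tau> - ft f \<sigma> = (\<integral>x. f x * (echar \<tau> x - echar \<sigma> x) \<partial>lborel)"
    using i by (simp add: ft_def right_diff_distrib)
  also have "norm \<dots> \<le> (\<integral>x. norm (\<tau> - \<sigma>) * (norm (f x) * (1 + norm x) ^ 1) \<partial>lborel)"
  proof (rule Bochner_Integration.integral_norm_bound_integral)
    show "integrable lborel (\<lambda>x. f x * (echar \<tau> x - echar \<sigma> x))" using i by (simp add: right_diff_distrib)
    show "integrable lborel (\<lambda>x. norm (\<tau> - \<sigma>) * (norm (f x) * (1 + norm x) ^ 1))"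
      by (rule integrable_mult_right[OF assms[unfolded rapid_def, THEN conjunct2, THEN spec]])
    fix x
    have "norm (f x) * norm (echar \<tau> x - echar \<sigma> x) \<le> norm (f x) * (norm (\<tau> - \<sigma>) * (1 + norm x))"
      by (intro mult_left_mono order_trans[OF norm_echar_diff_le]) auto
    then show "norm (f x * (echar \<tau> x - echar \<sigma> x)) \<le> norm (\<tau> - \<sigma>) * (norm (f x) * (1 + norm x) ^ 1)"
      by (simp only: norm_mult power_one_right mult_ac)
  qed
  also have "\<dots> = (\<integral>x. norm (f x) * (1 + norm x) ^ 1 \<partial>lborel) * norm (\<tau> - \<sigma>) * (1 + norm \<tau> + norm \<sigma>) ^ 0"
    by simp
  finally show "norm (ft f \<tau> - ft f \<sigma>) \<le> (\<integral>x. norm (f x) * (1 + norm x) ^ 1 \<partial>lborel) * norm (\<tau> - \<sigma>) * (1 + norm \<tau> + norm \<sigma>) ^ 0" .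
qed

lemma ft_measurable: "rapid f \<Longrightarrow> ft f \<in> borel_measurable borel"
  by (rule borel_measurable_continuous_onI[OF ft_continuous])

lemma rapid_ft:
  assumes "test_fun f"
  shows "rapid (ft f)"
proof (rule rapidI[OF ft_measurable[OF schwartz_rapid[OF test_fun_schwartz[OF assms]]]])
  fix K
  \<comment> \<open>Plain decay of \<open>ft f\<close> is the case in which the translated factor is
    the constant 1.\<close>
  have b: "bounded (range (dderivs vs (\<lambda>x::'a. 1::complex)))" for vs
    using dderivs_const[of vs "1::complex"] by (auto simp: bounded_iff)
  show "\<exists>B. \<forall>z. (1 + norm z) ^ K * norm (ft f z) \<le> B"
    using ft_translate_decay[OF assms smooth_fun_const b, of K] by simp
qed

text \<open>Fubini together with the symmetry of the character in position and frequency.\<close>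

lemma ft_swap:
  fixes u v :: "'a::euclidean_space \<Rightarrow> complex"
  assumes u: "rapid u" and v: "rapid v"
  shows "(\<integral>\<tau>. u \<tau> * ft v \<tau> \<partial>lborel) = (\<integral>x. v x * ft u x \<partial>lborel)"
proof -
  have [measurable]: "u \<in> borel_measurable borel" "v \<in> borel_measurable borel"
    using u v by (auto simp: rapid_def)
  have iu: "integrable lborel u" and iv: "integrable lborel v" by (intro rapid_integrable_self u v)+
  let ?f = "\<lambda>(\<tau>, x). u \<tau> * (v x * echar \<tau> x)"
  have m: "?f \<in> borel_measurable (lborel \<Otimes>\<^sub>M lborel)"
  proof -
    have "(\<lambda>p::'a \<times> 'a. echar (fst p) (snd p)) \<in> borel_measurable (lborel \<Otimes>\<^sub>M lborel)"
      unfolding echar_def by measurable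
    then show ?thesis by (simp add: case_prod_beta)
  qed
  have "integrable (lborel \<Otimes>\<^sub>M lborel) ?f"
  proof (rule lborel_pair.Fubini_integrable[OF m])
    show "integrable lborel (\<lambda>\<tau>. \<integral>x. norm (case (\<tau>, x) of (\<tau>, x) \<Rightarrow> u \<tau> * (v x * echar \<tau> x)) \<partial>lborel)"
      using iu by (simp add: norm_mult)
    show "AE \<tau> in lborel. integrable lborel (\<lambda>x. case (\<tau>, x) of (\<tau>, x) \<Rightarrow> u \<tau> * (v x * echar \<tau> x))"
      using integrable_echar[OF iv] by simp
  qed
  then have F: "(\<integral>x. (\<integral>\<tau>. u \<tau> * (v x * echar \<tau> x) \<partial>lborel) \<partial>lborel) = (\<integral>\<tau>. (\<integral>x. u \<tau> * (v x * echar \<tau> x) \<partial>lborel) \<partial>lborel)"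
    by (rule lborel_pair.Fubini_integral)
  have e1: "(\<integral>\<tau>. u \<tau> * (v x * echar \<tau> x) \<partial>lborel) = v x * ft u x" for x
  proof -
    have "(\<integral>\<tau>. u \<tau> * (v x * echar \<tau> x) \<partial>lborel) = (\<integral>\<tau>. v x * (u \<tau> * echar x \<tau>) \<partial>lborel)"
      by (intro Bochner_Integration.integral_cong) (auto simp: echar_commute mult_ac)
    then show ?thesis by (simp add: ft_def)
  qed
  have e2: "(\<integral>x. u \<tau> * (v x * echar \<tau> x) \<partial>lborel) = u \<tau> * ft v \<tau>" for \<tau>
    by (simp add: ft_def)
  show ?thesis by (rule F[unfolded e1 e2, symmetric])
qed

lemma echar_scaleR: "echar (c *\<^sub>R \<xi>) x = echar \<xi> (c *\<^sub>R x)"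
  by (simp add: echar_def)

lemma ft_swap_scaled:
  fixes a \<eta> :: "'a::euclidean_space \<Rightarrow> complex"
  assumes a: "test_fun a" and \<eta>: "test_fun \<eta>" and s: "\<sigma> > 0"
  shows "(\<integral>\<tau>. a (\<sigma> *\<^sub>R \<tau>) * ft \<eta> \<tau> \<partial>lborel) = (\<integral>x. \<eta> (\<sigma> *\<^sub>R x) * ft a x \<partial>lborel)"
proof -
  let ?a = "\<lambda>\<tau>. a (\<sigma> *\<^sub>R \<tau>)"
  have ta: "test_fun ?a" using test_fun_affine[OF a, of \<sigma> 0] s by simp
  have ra: "rapid ?a" "rapid a" "rapid \<eta>" by (intro schwartz_rapid test_fun_schwartz ta a \<eta>)+
  have [measurable]: "\<eta> \<in> borel_measurable borel" "a \<in> borel_measurable borel" "ft ?a \<in> borel_measurable borel"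
    using ra ft_measurable[OF ra(1)] by (auto simp: rapid_def)
  have ft_scale: "\<sigma> ^ DIM('a) *\<^sub>R ft ?a (\<sigma> *\<^sub>R x) = ft a x" for x
  proof -
    have [measurable]: "echar x \<in> borel_measurable borel" by (rule smooth_fun_borel_measurable[OF smooth_fun_echar])
    have "\<sigma> ^ DIM('a) *\<^sub>R ft ?a (\<sigma> *\<^sub>R x) = (\<integral>t. \<bar>\<sigma>\<bar> ^ DIM('a) *\<^sub>R (a (\<sigma> *\<^sub>R t) * echar x (\<sigma> *\<^sub>R t)) \<partial>lborel)"
      using s by (simp add: ft_def echar_scaleR)
    also have "\<dots> = ft a x" unfolding ft_def by (rule integral_scale) (use s in auto)
    finally show ?thesis .
  qed
  have "(\<integral>\<tau>. ?a \<tau> * ft \<eta> \<tau> \<partial>lborel) = (\<integral>x. \<eta> x * ft ?a x \<partial>lborel)"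
    by (rule ft_swap[OF ra(1) ra(3)])
  also have "\<dots> = (\<integral>x. \<bar>\<sigma>\<bar> ^ DIM('a) *\<^sub>R (\<eta> (\<sigma> *\<^sub>R x) * ft ?a (\<sigma> *\<^sub>R x)) \<partial>lborel)"
    by (rule integral_scale[symmetric]) (use s in auto)
  also have "\<dots> = (\<integral>x. \<eta> (\<sigma> *\<^sub>R x) * ft a x \<partial>lborel)"
  proof (rule Bochner_Integration.integral_cong[OF refl])
    fix x show "\<bar>\<sigma>\<bar> ^ DIM('a) *\<^sub>R (\<eta> (\<sigma> *\<^sub>R x) * ft ?a (\<sigma> *\<^sub>R x)) = \<eta> (\<sigma> *\<^sub>R x) * ft a x"
      using s by (simp flip: ft_scale)
  qed
  finally show ?thesis .
qed

lemma test_fun_dilation_limit: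
  fixes a g :: "'a::euclidean_space \<Rightarrow> complex"
  assumes a: "test_fun a" and g: "integrable lborel g"
  shows "(\<lambda>n. \<integral>\<tau>. a ((1 / (real n + 1)) *\<^sub>R \<tau>) * g \<tau> \<partial>lborel) \<longlonglongrightarrow> a 0 * (\<integral>\<tau>. g \<tau> \<partial>lborel)"
proof -
  note sm = test_fun_smooth_fun[OF a]
  have [measurable]: "a \<in> borel_measurable borel" by (rule smooth_fun_borel_measurable[OF sm])
  have [measurable]: "g \<in> borel_measurable borel" using borel_measurable_integrable[OF g] by simp
  obtain B where "sbd 0 a B" using test_fun_schwartz[OF a] unfolding schwartz_iff by blast
  then have B: "norm (a x) \<le> B" for x by (rule sbd_norm)
  have X0: "(\<lambda>n. 1 / (real n + 1)) \<longlonglongrightarrow> 0"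
    using LIMSEQ_inverse_real_of_nat by (simp add: inverse_eq_divide add.commute)
  have "(\<lambda>n. \<integral>\<tau>. a ((1 / (real n + 1)) *\<^sub>R \<tau>) * g \<tau> \<partial>lborel) \<longlonglongrightarrow> (\<integral>\<tau>. a 0 * g \<tau> \<partial>lborel)"
  proof (rule integral_dominated_convergence[where w = "\<lambda>\<tau>. B * norm (g \<tau>)"])
    show "integrable lborel (\<lambda>\<tau>. B * norm (g \<tau>))" using g by simp
    show "AE \<tau> in lborel. (\<lambda>n. a ((1 / (real n + 1)) *\<^sub>R \<tau>) * g \<tau>) \<longlonglongrightarrow> a 0 * g \<tau>"
    proof (rule AE_I2)
      fix \<tau> :: 'a
      have "(\<lambda>n. (1 / (real n + 1)) *\<^sub>R \<tau>) \<longlonglongrightarrow> 0 *\<^sub>R \<tau>" by (intro tendsto_intros X0)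
      then have "(\<lambda>n. (1 / (real n + 1)) *\<^sub>R \<tau>) \<longlonglongrightarrow> 0" by simp
      moreover have "isCont a 0" using smooth_fun_continuous_on[OF sm, of UNIV] by (simp add: continuous_on_eq_continuous_at)
      ultimately have "(\<lambda>n. a ((1 / (real n + 1)) *\<^sub>R \<tau>)) \<longlonglongrightarrow> a 0" by (rule isCont_tendsto_compose[rotated])
      then show "(\<lambda>n. a ((1 / (real n + 1)) *\<^sub>R \<tau>) * g \<tau>) \<longlonglongrightarrow> a 0 * g \<tau>" by (rule tendsto_mult_right)
    qed
    show "AE \<tau> in lborel. norm (a ((1 / (real n + 1)) *\<^sub>R \<tau>) * g \<tau>) \<le> B * norm (g \<tau>)" for n
      unfolding norm_mult by (intro AE_I2 mult_right_mono B) auto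
  qed auto
  then show ?thesis by simp
qed

text \<open>Both sides of \<open>ft_swap_scaled\<close> are followed along \<sigma> = 1/(n+1). The
  dilated test functions play the role of the Gaussian summability factor in the usual proof, so no
  explicit transform is ever computed.\<close>

lemma ft_inversion_at_0:
  fixes a \<eta> :: "'a::euclidean_space \<Rightarrow> complex"
  assumes a: "test_fun a" and \<eta>: "test_fun \<eta>"
  shows "a 0 * (\<integral>\<tau>. ft \<eta> \<tau> \<partial>lborel) = \<eta> 0 * (\<integral>\<tau>. ft a \<tau> \<partial>lborel)"
proof (rule LIMSEQ_unique)
  have eq: "(\<integral>\<tau>. a ((1 / (real n + 1)) *\<^sub>R \<tau>) * ft \<eta> \<tau> \<partial>lborel) = (\<integral>\<tau>. \<eta> ((1 / (real n + 1)) *\<^sub>R \<tau>) * ft a \<tau> \<partial>lborel)" for n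
    by (rule ft_swap_scaled[OF a \<eta>]) (simp add: add_nonneg_pos)
  show "(\<lambda>n. \<integral>\<tau>. a ((1 / (real n + 1)) *\<^sub>R \<tau>) * ft \<eta> \<tau> \<partial>lborel) \<longlonglongrightarrow> a 0 * (\<integral>\<tau>. ft \<eta> \<tau> \<partial>lborel)"
    by (rule test_fun_dilation_limit[OF a rapid_integrable_self[OF rapid_ft[OF \<eta>]]])
  show "(\<lambda>n. \<integral>\<tau>. a ((1 / (real n + 1)) *\<^sub>R \<tau>) * ft \<eta> \<tau> \<partial>lborel) \<longlonglongrightarrow> \<eta> 0 * (\<integral>\<tau>. ft a \<tau> \<partial>lborel)"
    unfolding eq by (rule test_fun_dilation_limit[OF \<eta> rapid_integrable_self[OF rapid_ft[OF a]]])
qed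

lemma ft_translate:
  assumes "rapid f"
  shows "ft (\<lambda>x. f (x + y)) \<tau> = ft f \<tau> * echar \<tau> (- y)"
proof -
  have [measurable]: "f \<in> borel_measurable borel" "echar \<tau> \<in> borel_measurable borel"
    using assms smooth_fun_borel_measurable[OF smooth_fun_echar] by (auto simp: rapid_def)
  have "ft f \<tau> = (\<integral>x. f (y + x) * echar \<tau> (y + x) \<partial>lborel)"
    unfolding ft_def by (rule integral_translate[symmetric]) simp
  also have "\<dots> = (\<integral>x. echar \<tau> y * (f (x + y) * echar \<tau> x) \<partial>lborel)"
    by (intro Bochner_Integration.integral_cong) (auto simp: echar_add add.commute mult_ac)
  finally have "ft f \<tau> = echar \<tau> y * ft (\<lambda>x. f (x + y)) \<tau>" by (simp add: ft_def)
  moreover have "echar \<tau> y * echar \<tau> (- y) = 1"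
    using echar_add[of \<tau> y "- y"] by (simp add: echar_def)
  ultimately show ?thesis by (simp add: mult_ac)
qed

text \<open>Fourier inversion is only needed up to the value of the constant, which is nonzero because
  otherwise Plancherel's identity would force every transform to vanish.\<close>

lemma ft_inversion:
  "\<exists>\<kappa>. \<kappa> \<noteq> 0 \<and> (\<forall>\<eta>::'a::euclidean_space \<Rightarrow> complex. test_fun \<eta> \<longrightarrow>
      (\<forall>y. (\<integral>\<tau>. ft \<eta> \<tau> * echar \<tau> (- y) \<partial>lborel) = \<kappa> * \<eta> y))"
proof -
  let ?a = "rad 1 1 0 :: 'a \<Rightarrow> complex"
  have a0: "?a 0 \<noteq> 0" by (subst rad_inside) auto
  have ta: "test_fun ?a" by (rule test_fun_rad)
  \<comment> \<open>Read off from inversion at 0 for one fixed bump. Classically the value is (2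
    pi)^m, but only that it is nonzero matters.\<close>
  define \<kappa> where "\<kappa> = (\<integral>\<tau>. ft ?a \<tau> \<partial>lborel) / ?a 0"
  have inv: "(\<integral>\<tau>. ft \<eta> \<tau> * echar \<tau> (- y) \<partial>lborel) = \<kappa> * \<eta> y" if \<eta>: "test_fun \<eta>" for \<eta> :: "'a \<Rightarrow> complex" and y
  proof -
    have "test_fun (\<lambda>x. \<eta> (x + y))" using test_fun_affine[OF \<eta>, of 1 y] by simp
    from ft_inversion_at_0[OF ta this] have "?a 0 * (\<integral>\<tau>. ft (\<lambda>x. \<eta> (x + y)) \<tau> \<partial>lborel) = \<eta> y * (\<integral>\<tau>. ft ?a \<tau> \<partial>lborel)"
      by simp
    then show ?thesis
      using a0 by (simp add: ft_translate schwartz_rapid test_fun_schwartz \<eta> \<kappa>_def field_simps)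
  qed
  have "\<kappa> \<noteq> 0"
  proof
    assume k0: "\<kappa> = 0"
    have ra: "rapid ?a" "rapid (ft ?a)" by (intro schwartz_rapid test_fun_schwartz ta rapid_ft)+
    have [measurable]: "?a \<in> borel_measurable borel" "ft ?a \<in> borel_measurable borel" using ra by (auto simp: rapid_def)
    \<comment> \<open>Reflection and conjugation are combined so that the transform of
      \<open>v\<close> is the conjugate of that of \<open>?a\<close>; \<open>ft_swap\<close> then
      produces the integral of a squared modulus.\<close>
    define v where "v x = cnj (?a (- x))" for x
    have tv: "test_fun (\<lambda>x. ?a (- x))" using test_fun_affine[OF ta, of "-1" 0] by simp
    have "test_fun v"
      using tv smooth_fun_compose_linear[OF bounded_linear_cnj, of "\<lambda>x. ?a (- x)"]
      unfolding test_fun_iff v_def by auto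
    then have rv: "rapid v" by (intro schwartz_rapid test_fun_schwartz)
    have ftv: "ft v \<tau> = cnj (ft ?a \<tau>)" for \<tau>
    proof -
      have [measurable]: "echar \<tau> \<in> borel_measurable borel" by (rule smooth_fun_borel_measurable[OF smooth_fun_echar])
      have "ft ?a \<tau> = (\<integral>x. \<bar>-1\<bar> ^ DIM('a) *\<^sub>R (?a ((-1) *\<^sub>R x) * echar \<tau> ((-1) *\<^sub>R x)) \<partial>lborel)"
        unfolding ft_def by (rule integral_scale[symmetric]) auto
      also have "\<dots> = (\<integral>x. cnj (v x * echar \<tau> x) \<partial>lborel)"
        by (intro Bochner_Integration.integral_cong) (auto simp: v_def echar_def exp_cnj)
      also have "\<dots> = cnj (ft v \<tau>)" unfolding ft_def by (rule Bochner_Integration.integral_cnj)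
      finally show ?thesis by simp
    qed
    have ff: "ft (ft ?a) x = 0" for x
      using inv[OF ta, of "- x"] k0 unfolding ft_def[of "ft _"] by (simp add: echar_commute)
    have "(\<integral>\<tau>. ft ?a \<tau> * ft v \<tau> \<partial>lborel) = (\<integral>x. v x * ft (ft ?a) x \<partial>lborel)"
      by (rule ft_swap[OF ra(2) rv])
    then have "(\<integral>\<tau>. ft ?a \<tau> * cnj (ft ?a \<tau>) \<partial>lborel) = 0" by (simp add: ftv ff)
    then have "(\<integral>\<tau>. complex_of_real ((norm (ft ?a \<tau>))\<^sup>2) \<partial>lborel) = 0"
      by (simp only: complex_norm_square)
    then have z: "(\<integral>\<tau>. (norm (ft ?a \<tau>))\<^sup>2 \<partial>lborel) = 0"
      unfolding integral_complex_of_real by simp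
    obtain B where B: "\<And>\<tau>. norm (ft ?a \<tau>) \<le> B"
    proof -
      have "norm (ft ?a \<tau>) \<le> (\<integral>x. norm (?a x) \<partial>lborel)" for \<tau>
        unfolding ft_def
        by (rule Bochner_Integration.integral_norm_bound_integral)
           (auto simp: norm_mult intro: integrable_echar integrable_test_fun[OF ta])
      then show ?thesis by (rule that)
    qed
    have "integrable lborel (\<lambda>\<tau>. norm (ft ?a \<tau>) * norm (ft ?a \<tau>))"
      by (rule rapid_integrable_real[OF ra(2), where C = B and K = 0]) (auto intro: B)
    then have isq: "integrable lborel (\<lambda>\<tau>. (norm (ft ?a \<tau>))\<^sup>2)" by (simp add: power2_eq_square)
    have "norm (ft ?a 0) = 0"
    proof (rule ccontr)
      assume "norm (ft ?a 0) \<noteq> 0"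
      then have "(\<integral>\<tau>. (norm (ft ?a \<tau>))\<^sup>2 \<partial>lborel) > 0"
        by (intro integral_pos_if_continuous[of _ 0] isq continuous_intros ft_continuous ra) auto
      then show False using z by simp
    qed
    then have "(\<integral>x. ?a x \<partial>lborel) = 0" by (simp add: ft_def echar_def)
    then show False using integral_rad_nonzero[of 1 "0::'a"] by simp
  qed
  then show ?thesis using inv by blast
qed

section \<open>Fourier transform of localized regularizations\<close>

lemma lipfam_reflect:
  assumes "schwartz f"
  shows "lipfam (\<lambda>x y. f (x - y))"
proof -
  have "schwartz (\<lambda>y. f ((-1) *\<^sub>R y + 0))" by (rule schwartz_affine[OF assms]) simp
  from lipfam_affine[OF lipfam_translate[OF this], of "-1" 0] show ?thesis by simp
qed

text \<open>\<open>ftconv w \<psi> f \<xi>\<close> is the Fourier transform of \<open>\<psi> (w * f)\<close> at \<open>\<xi>\<close>.\<close>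

definition ftconv :: "(('a::euclidean_space \<Rightarrow> complex) \<Rightarrow> complex) \<Rightarrow> ('a \<Rightarrow> complex) \<Rightarrow> ('a \<Rightarrow> complex) \<Rightarrow> 'a \<Rightarrow> complex" where
  "ftconv w \<psi> f \<xi> = w (cint (\<lambda>x. \<psi> x * echar \<xi> x) (\<lambda>x y. f (x - y)))"

lemma rapid_modulation: "test_fun \<psi> \<Longrightarrow> rapid (\<lambda>x. \<psi> x * echar \<xi> x)"
  by (intro schwartz_rapid schwartz_modulation test_fun_schwartz)

lemma ftconv_eq:
  assumes "tempered w" "test_fun \<psi>" "schwartz f"
  shows "ftconv w \<psi> f \<xi> = (\<integral>x. (\<psi> x * echar \<xi> x) * w (\<lambda>y. f (x - y)) \<partial>lborel)"
  unfolding ftconv_def by (rule tempered_cint[OF assms(1) rapid_modulation[OF assms(2)] lipfam_reflect[OF assms(3)]])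

lemma fourier_eq_ft: "fourier f \<xi> = ft f \<xi>"
  by (simp add: fourier_def ft_def echar_def)

lemma fourier_dconv:
  assumes "tempered w" "test_fun \<psi>" "schwartz f"
  shows "fourier (\<lambda>x. \<psi> x * dconv w f x) \<xi> = ftconv w \<psi> f \<xi>"
  unfolding ftconv_eq[OF assms] fourier_eq_ft ft_def dconv_def
  by (intro Bochner_Integration.integral_cong) (auto simp: mult_ac)

text \<open>The value left over once the convolution variable is called z = x - y: the distribution
  sees cutoff and character translated together.\<close>

definition shifted :: "(('a::euclidean_space \<Rightarrow> complex) \<Rightarrow> complex) \<Rightarrow> ('a \<Rightarrow> complex) \<Rightarrow> 'a \<Rightarrow> 'a \<Rightarrow> complex" where
  "shifted w \<psi> \<xi> z = w (\<lambda>y. \<psi> (y + z) * echar \<xi> (y + z))"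

text \<open>For fixed y substitute x = y + z. This moves the kernel out of the family and makes it
  the density, after which \<open>tempered_cint\<close> applies to translates of \<psi> times the
  character.\<close>

lemma ftconv_shifted:
  fixes f \<psi> :: "'a::euclidean_space \<Rightarrow> complex"
  assumes w: "tempered w" and \<psi>: "test_fun \<psi>" and f: "schwartz f"
  shows "ftconv w \<psi> f \<xi> = (\<integral>z. f z * shifted w \<psi> \<xi> z \<partial>lborel)"
proof -
  let ?E = "\<lambda>x. \<psi> x * echar \<xi> x"
  have E: "schwartz ?E" by (intro schwartz_modulation test_fun_schwartz \<psi>)
  have [measurable]: "?E \<in> borel_measurable borel" "f \<in> borel_measurable borel"
    by (intro smooth_fun_borel_measurable schwartz_smooth_fun E f)+
  have "cint ?E (\<lambda>x y. f (x - y)) = cint f (\<lambda>z y. ?E (y + z))"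
  proof
    fix y
    have "(\<integral>x. ?E x * f (x - y) \<partial>lborel) = (\<integral>z. ?E (y + z) * f ((y + z) - y) \<partial>lborel)"
      by (rule integral_translate[symmetric]) simp
    then show "cint ?E (\<lambda>x y. f (x - y)) y = cint f (\<lambda>z y. ?E (y + z)) y"
      by (simp add: cint_def mult_ac)
  qed
  then show ?thesis
    unfolding ftconv_def shifted_def
    by (simp only: tempered_cint[OF w schwartz_rapid[OF f] lipfam_translate[OF E]])
qed

lemma shifted_measurable:
  assumes "tempered w" "test_fun \<psi>"
  shows "shifted w \<psi> \<xi> \<in> borel_measurable borel"
proof -
  have "schwartz (\<lambda>x. \<psi> x * echar \<xi> x)" by (intro schwartz_modulation test_fun_schwartz assms)
  from tempered_lipfam[OF assms(1) lipfam_translate[OF this]]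
  have "continuous_on UNIV (shifted w \<psi> \<xi>)" unfolding shifted_def by metis
  then show ?thesis by (rule borel_measurable_continuous_onI)
qed

text \<open>Growth in \<xi> comes from differentiating the character, growth in \<open>z\<close>
  from moving the weight. The second bound gains \<open>norm z\<close> from the mean value
  inequality and needs one seminorm more, which is why the modulated cutoff is bounded at level
  \<open>Suc N\<close>.\<close>

lemma shifted_bounds:
  fixes \<psi> :: "'a::euclidean_space \<Rightarrow> complex"
  assumes w: "tempered w" and \<psi>: "test_fun \<psi>"
  obtains C K where "C \<ge> 0"
    "\<And>\<xi> z. norm (shifted w \<psi> \<xi> z) \<le> C * (1 + norm z) ^ K * (1 + norm \<xi>) ^ K"
    "\<And>\<xi> z. norm (shifted w \<psi> \<xi> z - shifted w \<psi> \<xi> 0) \<le> C * norm z * (1 + norm z) ^ K * (1 + norm \<xi>) ^ K"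
proof -
  let ?E = "\<lambda>\<xi> x. \<psi> x * echar \<xi> x"
  have E: "schwartz (?E \<xi>)" for \<xi> by (intro schwartz_modulation test_fun_schwartz \<psi>)
  note Es = schwartz_smooth_fun[OF E]
  obtain D N where D: "D \<ge> 0" "\<And>f B. schwartz f \<Longrightarrow> sbd N f B \<Longrightarrow> norm (w f) \<le> D * B"
    using tempered_bound[OF w] by blast
  obtain C1 K1 where C1: "C1 \<ge> 0" "\<And>\<xi>. sbd (Suc N) (?E \<xi>) (C1 * (1 + norm \<xi>) ^ K1)"
    using lipfam_growth[OF lipfam_modulation[OF test_fun_schwartz[OF \<psi>]], of "Suc N"] by metis
  let ?K = "max K1 (Suc N)" and ?C = "D * (real DIM('a) * C1)"
  have pz: "(1 + norm z) ^ Suc N \<le> (1 + norm z) ^ ?K" "(1 + norm z) ^ N \<le> (1 + norm z) ^ ?K" for z :: 'a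
    by (intro power_increasing, simp, simp)+
  have px: "(1 + norm \<xi>) ^ K1 \<le> (1 + norm \<xi>) ^ ?K" for \<xi> :: 'a by (intro power_increasing) auto
  have dim: "1 \<le> real DIM('a)" by (simp add: Suc_leI)
  show ?thesis
  proof (rule that[of ?C ?K])
    show "?C \<ge> 0" using D C1 by simp
    fix \<xi> z
    have "sbd (Suc N) (\<lambda>y. ?E \<xi> (1 *\<^sub>R y + z)) (\<bar>1\<bar> ^ Suc N * ((C1 * (1 + norm \<xi>) ^ K1) * (1 + norm z) ^ Suc N))"
      by (intro sbd_affine Es C1) simp
    then have s: "sbd N (\<lambda>y. ?E \<xi> (y + z)) ((C1 * (1 + norm \<xi>) ^ K1) * (1 + norm z) ^ Suc N)"
      by (intro sbd_le[where k = N and N = "Suc N"]) (auto simp del: power_Suc)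
    have sch: "schwartz (\<lambda>y. ?E \<xi> (y + z))" for z by (rule schwartz_translate[OF E])
    have "norm (shifted w \<psi> \<xi> z) \<le> D * ((C1 * (1 + norm \<xi>) ^ K1) * (1 + norm z) ^ Suc N)"
      unfolding shifted_def by (rule D(2)[OF sch s])
    also have "\<dots> \<le> D * (((real DIM('a) * C1) * (1 + norm \<xi>) ^ ?K) * (1 + norm z) ^ ?K)"
      using D(1) C1(1) dim by (intro mult_left_mono mult_mono px pz) (auto simp: mult_le_cancel_right1)
    finally show "norm (shifted w \<psi> \<xi> z) \<le> ?C * (1 + norm z) ^ ?K * (1 + norm \<xi>) ^ ?K" by (simp only: mult_ac)
    have "norm (w (\<lambda>y. ?E \<xi> (y + z) - ?E \<xi> (y + 0))) \<le> D * (real DIM('a) * (C1 * (1 + norm \<xi>) ^ K1) * norm (z - 0) * (1 + norm z + norm (0::'a)) ^ N)"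
      by (rule D(2)[OF schwartz_diff[OF sch sch] sbd_translate_diff[OF Es C1(2)]])
    also have "w (\<lambda>y. ?E \<xi> (y + z) - ?E \<xi> (y + 0)) = shifted w \<psi> \<xi> z - shifted w \<psi> \<xi> 0"
      unfolding shifted_def by (rule tempered_diff[OF w sch sch])
    also have "D * (real DIM('a) * (C1 * (1 + norm \<xi>) ^ K1) * norm (z - 0) * (1 + norm z + norm (0::'a)) ^ N)
        \<le> D * (real DIM('a) * (C1 * (1 + norm \<xi>) ^ ?K) * norm z * (1 + norm z) ^ ?K)"
      using D(1) C1(1) px[of \<xi>] pz(2)[of z] by (intro mult_left_mono mult_mono) auto
    finally show "norm (shifted w \<psi> \<xi> z - shifted w \<psi> \<xi> 0) \<le> ?C * norm z * (1 + norm z) ^ ?K * (1 + norm \<xi>) ^ ?K"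
      by (simp only: mult_ac)
  qed
qed

text \<open>\<open>chi_gamma\<close> with the scale \<gamma>(l) replaced by a free real
  \<open>t\<close>; the prefactor preserves the integral for positive \<open>t\<close>.\<close>

definition rescale :: "real \<Rightarrow> ('a::euclidean_space \<Rightarrow> complex) \<Rightarrow> 'a \<Rightarrow> complex" where
  "rescale t f x = of_real (t ^ DIM('a)) * f (t *\<^sub>R x)"

lemma sbd_rescale:
  fixes f :: "'a::euclidean_space \<Rightarrow> complex"
  assumes "smooth_fun f" "sbd N f B" "1 \<le> t"
  shows "sbd N (rescale t f) (t ^ (DIM('a) + N) * B)"
proof -
  have "sbd N (\<lambda>x. f (t *\<^sub>R x + 0)) (\<bar>t\<bar> ^ N * (B * (1 + norm (0::'a)) ^ N))"
    by (rule sbd_affine) (use assms in auto)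
  from sbd_cmult[OF smooth_fun_compose_affine[OF assms(1)] this, of "of_real (t ^ DIM('a))"]
  show ?thesis using assms(3) by (simp add: rescale_def[abs_def] power_add mult_ac norm_power)
qed

lemma schwartz_rescale: "schwartz f \<Longrightarrow> 1 \<le> t \<Longrightarrow> schwartz (rescale t f)"
  using schwartz_cmult[OF schwartz_affine[of f t 0]] by (simp add: rescale_def[abs_def])

lemma ftconv_rescale:
  fixes f \<psi> :: "'a::euclidean_space \<Rightarrow> complex"
  assumes w: "tempered w" and \<psi>: "test_fun \<psi>" and f: "schwartz f" and t: "1 \<le> t"
  shows "ftconv w \<psi> (rescale t f) \<xi> = (\<integral>s. f s * shifted w \<psi> \<xi> ((1 / t) *\<^sub>R s) \<partial>lborel)"
proof -
  have [measurable]: "shifted w \<psi> \<xi> \<in> borel_measurable borel" "f \<in> borel_measurable borel"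
    by (intro shifted_measurable w \<psi> smooth_fun_borel_measurable schwartz_smooth_fun f)+
  have "ftconv w \<psi> (rescale t f) \<xi> = (\<integral>z. rescale t f z * shifted w \<psi> \<xi> z \<partial>lborel)"
    by (rule ftconv_shifted[OF w \<psi> schwartz_rescale[OF f t]])
  also have "\<dots> = (\<integral>z. \<bar>t\<bar> ^ DIM('a) *\<^sub>R (f (t *\<^sub>R z) * shifted w \<psi> \<xi> ((1 / t) *\<^sub>R (t *\<^sub>R z))) \<partial>lborel)"
    using t by (intro Bochner_Integration.integral_cong) (auto simp: rescale_def scaleR_conv_of_real)
  also have "\<dots> = (\<integral>s. f s * shifted w \<psi> \<xi> ((1 / t) *\<^sub>R s) \<partial>lborel)"
    by (rule integral_scale) (use t in auto)
  finally show ?thesis .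
qed

text \<open>Since \<theta> has integral 1, the limit value can be written under the same integral,
  with argument 0 in place of s/t. The Lipschitz bound on \<open>shifted\<close> then contributes
  the factor \<open>norm s / t\<close>, and the rapid decay of \<theta> absorbs the powers of
  \<open>norm s\<close>.\<close>

lemma ftconv_approx:
  fixes \<psi> \<theta> :: "'a::euclidean_space \<Rightarrow> complex"
  assumes w: "tempered w" and \<psi>: "test_fun \<psi>" and \<theta>: "schwartz \<theta>" "(\<integral>x. \<theta> x \<partial>lborel) = 1"
  obtains C K where "C \<ge> 0"
    "\<And>\<xi> t. 1 \<le> t \<Longrightarrow> norm (ftconv w \<psi> (rescale t \<theta>) \<xi> - w (\<lambda>x. \<psi> x * echar \<xi> x)) \<le> C / t * (1 + norm \<xi>) ^ K"
proof -
  obtain C K where C: "C \<ge> 0"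
    and b1: "\<And>\<xi> z. norm (shifted w \<psi> \<xi> z) \<le> C * (1 + norm z) ^ K * (1 + norm \<xi>) ^ K"
    and b2: "\<And>\<xi> z. norm (shifted w \<psi> \<xi> z - shifted w \<psi> \<xi> 0) \<le> C * norm z * (1 + norm z) ^ K * (1 + norm \<xi>) ^ K"
    using shifted_bounds[OF w \<psi>] by blast
  have rc: "rapid \<theta>" by (rule schwartz_rapid[OF \<theta>(1)])
  let ?I = "\<integral>s. norm (\<theta> s) * (1 + norm s) ^ Suc K \<partial>lborel"
  have "norm (ftconv w \<psi> (rescale t \<theta>) \<xi> - w (\<lambda>x. \<psi> x * echar \<xi> x)) \<le> (C * ?I) / t * (1 + norm \<xi>) ^ K" if t: "1 \<le> t" for \<xi> t
  proof -
    let ?S = "shifted w \<psi> \<xi>"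
    have [measurable]: "?S \<in> borel_measurable borel" by (intro shifted_measurable w \<psi>)
    have nle: "norm ((1 / t) *\<^sub>R s) \<le> norm s" for s :: 'a
      using t mult_left_le_one_le[of "norm s" "1 / t"] by simp
    have i: "integrable lborel (\<lambda>s. \<theta> s * ?S ((1 / t) *\<^sub>R s))"
    proof (rule rapid_integrable[OF rc, where C = "C * (1 + norm \<xi>) ^ K" and K = K])
      fix s
      have "norm (?S ((1 / t) *\<^sub>R s)) \<le> C * (1 + norm ((1 / t) *\<^sub>R s)) ^ K * (1 + norm \<xi>) ^ K" by (rule b1)
      also have "\<dots> \<le> C * (1 + norm s) ^ K * (1 + norm \<xi>) ^ K"
        using C nle[of s] by (intro mult_right_mono mult_left_mono power_mono) auto
      finally show "norm (?S ((1 / t) *\<^sub>R s)) \<le> C * (1 + norm \<xi>) ^ K * (1 + norm s) ^ K" by (simp only: mult_ac)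
    qed simp
    have i0: "integrable lborel (\<lambda>s. \<theta> s * ?S 0)" using schwartz_integrable[OF \<theta>(1)] by simp
    have "ftconv w \<psi> (rescale t \<theta>) \<xi> - w (\<lambda>x. \<psi> x * echar \<xi> x) = (\<integral>s. \<theta> s * ?S ((1 / t) *\<^sub>R s) \<partial>lborel) - (\<integral>s. \<theta> s * ?S 0 \<partial>lborel)"
      using \<theta>(2) by (simp add: ftconv_rescale[OF w \<psi> \<theta>(1) t] shifted_def)
    also have "\<dots> = (\<integral>s. \<theta> s * (?S ((1 / t) *\<^sub>R s) - ?S 0) \<partial>lborel)"
      using i i0 by (simp add: right_diff_distrib)
    also have "norm \<dots> \<le> (\<integral>s. (C / t * (1 + norm \<xi>) ^ K) * (norm (\<theta> s) * (1 + norm s) ^ Suc K) \<partial>lborel)"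
    proof (rule Bochner_Integration.integral_norm_bound_integral)
      show "integrable lborel (\<lambda>s. \<theta> s * (?S ((1 / t) *\<^sub>R s) - ?S 0))"
        using i i0 by (simp add: right_diff_distrib)
      show "integrable lborel (\<lambda>s. (C / t * (1 + norm \<xi>) ^ K) * (norm (\<theta> s) * (1 + norm s) ^ Suc K))"
        by (rule integrable_mult_right[OF rc[unfolded rapid_def, THEN conjunct2, THEN spec]])
      fix s
      have "norm (?S ((1 / t) *\<^sub>R s) - ?S 0) \<le> C * norm ((1 / t) *\<^sub>R s) * (1 + norm ((1 / t) *\<^sub>R s)) ^ K * (1 + norm \<xi>) ^ K"
        by (rule b2)
      also have "\<dots> \<le> C * ((1 + norm s) / t) * (1 + norm s) ^ K * (1 + norm \<xi>) ^ K"
        using C nle[of s] t by (intro mult_right_mono mult_mono power_mono mult_left_mono) (auto simp: divide_right_mono)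
      also have "\<dots> = (C / t * (1 + norm \<xi>) ^ K) * (1 + norm s) ^ Suc K" by simp
      finally have "norm (\<theta> s) * norm (?S ((1 / t) *\<^sub>R s) - ?S 0) \<le> norm (\<theta> s) * ((C / t * (1 + norm \<xi>) ^ K) * (1 + norm s) ^ Suc K)"
        by (rule mult_left_mono) simp
      then show "norm (\<theta> s * (?S ((1 / t) *\<^sub>R s) - ?S 0)) \<le> (C / t * (1 + norm \<xi>) ^ K) * (norm (\<theta> s) * (1 + norm s) ^ Suc K)"
        by (simp only: norm_mult mult_ac)
    qed
    also have "\<dots> = (C * ?I) / t * (1 + norm \<xi>) ^ K" by simp
    finally show ?thesis .
  qed
  moreover have "0 \<le> C * ?I" using C by (intro mult_nonneg_nonneg integral_nonneg_AE) auto
  ultimately show ?thesis using that[of "C * ?I" K] by blast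
qed

text \<open>The integration by parts takes place in x inside the Schwartz function to which
  \<open>w\<close> is applied; \<open>w\<close> itself is used only through linearity.\<close>

lemma ftconv_by_parts:
  assumes w: "tempered w" and \<psi>: "test_fun \<psi>" and f: "schwartz f"
  shows "(\<i> * of_real (b \<bullet> \<xi>)) * ftconv w \<psi> f \<xi> = ftconv w (ddir b \<psi>) f \<xi> + ftconv w \<psi> (ddir b f) \<xi>"
proof -
  let ?c = "\<lambda>\<psi> f. cint (\<lambda>x. \<psi> x * echar \<xi> x) (\<lambda>x y. f (x - y))"
  have ft: "?c \<psi> f y = ft (\<lambda>x. \<psi> x * f (x - y)) \<xi>" for \<psi> f y
    unfolding cint_def ft_def by (intro Bochner_Integration.integral_cong) (auto simp: mult_ac)
  have eq: "(\<i> * of_real (b \<bullet> \<xi>)) * ?c \<psi> f y = ?c (ddir b \<psi>) f y + ?c \<psi> (ddir b f) y" for y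
  proof -
    have "smooth_fun (\<lambda>x. f (x - y))" "ddir b (\<lambda>x. f (x - y)) = (\<lambda>x. ddir b f (x - y))"
      using smooth_fun_compose_affine[OF schwartz_smooth_fun[OF f], of 1 "- y"]
        ddir_compose_affine[OF schwartz_smooth_fun[OF f], of b 1 "- y"] by simp_all
    with ft_by_parts[OF \<psi>, of "\<lambda>x. f (x - y)" b \<xi>] show ?thesis by (simp add: ft)
  qed
  have s: "schwartz (?c \<psi> f)" if "test_fun \<psi>" "schwartz f" for \<psi> f
    by (rule schwartz_cint[OF rapid_modulation[OF that(1)] lipfam_reflect[OF that(2)]])
  have "(\<i> * of_real (b \<bullet> \<xi>)) * ftconv w \<psi> f \<xi> = w (\<lambda>y. (\<i> * of_real (b \<bullet> \<xi>)) * ?c \<psi> f y)"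
    unfolding ftconv_def by (rule tempered_cmult[OF w s[OF \<psi> f], symmetric])
  also have "\<dots> = w (\<lambda>y. ?c (ddir b \<psi>) f y + ?c \<psi> (ddir b f) y)" by (simp only: eq)
  also have "\<dots> = ftconv w (ddir b \<psi>) f \<xi> + ftconv w \<psi> (ddir b f) \<xi>"
    unfolding ftconv_def by (intro tempered_add w s test_fun_ddir schwartz_ddir \<psi> f)
  finally show ?thesis .
qed

text \<open>The loss \<open>N\<close> depends on \<open>w\<close> alone and is fixed before
  \<open>L\<close> and \<psi>: every power of \<open>norm \<xi>\<close> costs exactly one further
  seminorm of the kernel. This exact count decides the comparison of gain and loss for rescaled
  kernels.\<close>

lemma ftconv_decay:
  fixes w :: "('a::euclidean_space \<Rightarrow> complex) \<Rightarrow> complex"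
  assumes w: "tempered w"
  obtains N where "\<And>L \<psi>. test_fun \<psi> \<Longrightarrow>
    \<exists>C\<ge>0. \<forall>f B \<xi>. schwartz f \<longrightarrow> sbd (N + L) f B \<longrightarrow> norm \<xi> ^ L * norm (ftconv w \<psi> f \<xi>) \<le> C * B"
proof -
  obtain D N where D: "D \<ge> 0" "\<And>f B. schwartz f \<Longrightarrow> sbd N f B \<Longrightarrow> norm (w f) \<le> D * B"
    using tempered_bound[OF w] by blast
  have "\<exists>C\<ge>0. \<forall>f B \<xi>. schwartz f \<longrightarrow> sbd (N + L) f B \<longrightarrow> norm \<xi> ^ L * norm (ftconv w \<psi> f \<xi>) \<le> C * B"
    if "test_fun \<psi>" for L \<psi>
    using that
  proof (induction L arbitrary: \<psi>)
    case 0
    have rp: "rapid \<psi>" by (rule schwartz_rapid[OF test_fun_schwartz[OF 0]])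
    let ?I = "\<integral>x. norm (\<psi> x) * (1 + norm x) ^ N \<partial>lborel"
    have "norm (ftconv w \<psi> f \<xi>) \<le> (D * ?I) * B" if f: "schwartz f" and B: "sbd N f B" for f B \<xi>
    proof -
      obtain C K where CK: "\<And>x. norm (w (\<lambda>y. f (x - y))) \<le> C * (1 + norm x) ^ K"
        and cont: "continuous_on UNIV (\<lambda>x. w (\<lambda>y. f (x - y)))"
        using tempered_lipfam[OF w lipfam_reflect[OF f]] by blast
      have "norm (ftconv w \<psi> f \<xi>) \<le> (\<integral>x. (D * B) * (norm (\<psi> x) * (1 + norm x) ^ N) \<partial>lborel)"
        unfolding ftconv_eq[OF w 0 f]
      proof (rule Bochner_Integration.integral_norm_bound_integral)
        show "integrable lborel (\<lambda>x. (\<psi> x * echar \<xi> x) * w (\<lambda>y. f (x - y)))"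
          by (rule rapid_integrable[OF rapid_modulation[OF 0] borel_measurable_continuous_onI[OF cont] CK])
        show "integrable lborel (\<lambda>x. (D * B) * (norm (\<psi> x) * (1 + norm x) ^ N))"
          by (rule integrable_mult_right[OF rp[unfolded rapid_def, THEN conjunct2, THEN spec]])
        fix x
        have "sbd N (\<lambda>y. f ((-1) *\<^sub>R y + x)) (\<bar>-1\<bar> ^ N * (B * (1 + norm x) ^ N))"
          by (intro sbd_affine schwartz_smooth_fun f B) simp
        then have "sbd N (\<lambda>y. f (x - y)) (B * (1 + norm x) ^ N)" by simp
        then have "norm (w (\<lambda>y. f (x - y))) \<le> D * (B * (1 + norm x) ^ N)"
          by (intro D lipfam_schwartz[OF lipfam_reflect[OF f]])
        then have "norm (\<psi> x) * norm (w (\<lambda>y. f (x - y))) \<le> norm (\<psi> x) * (D * (B * (1 + norm x) ^ N))"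
          by (rule mult_left_mono) simp
        then show "norm ((\<psi> x * echar \<xi> x) * w (\<lambda>y. f (x - y))) \<le> (D * B) * (norm (\<psi> x) * (1 + norm x) ^ N)"
          by (simp add: norm_mult mult_ac)
      qed
      then show ?thesis by (simp add: mult_ac)
    qed
    moreover have "0 \<le> D * ?I" using D(1) by (intro mult_nonneg_nonneg integral_nonneg_AE) auto
    ultimately show ?case by (intro exI[of _ "D * ?I"]) simp
  next
    case (Suc L)
    let ?P = "\<lambda>\<psi> C. C \<ge> 0 \<and> (\<forall>f B \<xi>. schwartz f \<longrightarrow> sbd (N + L) f B \<longrightarrow> norm \<xi> ^ L * norm (ftconv w \<psi> f \<xi>) \<le> C * B)"
    have "\<forall>b\<in>Basis. \<exists>C. ?P (ddir b \<psi>) C" using Suc.IH[OF test_fun_ddir[OF Suc.prems]] by blast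
    from bchoice[OF this] obtain C where C: "\<forall>b\<in>Basis. ?P (ddir b \<psi>) (C b)" ..
    obtain C' where C': "?P \<psi> C'" using Suc.IH[OF Suc.prems] by blast
    let ?s = "\<lambda>b::'a. \<Sum>b'\<in>Basis. \<bar>b \<bullet> b'\<bar>"
    have "norm \<xi> ^ Suc L * norm (ftconv w \<psi> f \<xi>) \<le> (\<Sum>b\<in>Basis. C b + C' * ?s b) * B"
      if f: "schwartz f" and B: "sbd (N + Suc L) f B" for f B \<xi>
    proof -
      let ?F = "norm (ftconv w \<psi> f \<xi>)"
      have one: "norm \<xi> ^ L * (\<bar>\<xi> \<bullet> b\<bar> * ?F) \<le> (C b + C' * ?s b) * B" if b: "b \<in> Basis" for b
      proof -
        have B1: "sbd (N + L) f B" by (rule sbd_le[OF B]) simp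
        have B2: "sbd (N + L) (ddir b f) (?s b * B)" by (rule sbd_ddir[OF schwartz_smooth_fun[OF f]]) (use B in simp)
        have "\<bar>\<xi> \<bullet> b\<bar> * ?F = norm ((\<i> * of_real (b \<bullet> \<xi>)) * ftconv w \<psi> f \<xi>)"
          by (simp add: norm_mult inner_commute)
        also have "\<dots> \<le> norm (ftconv w (ddir b \<psi>) f \<xi>) + norm (ftconv w \<psi> (ddir b f) \<xi>)"
          unfolding ftconv_by_parts[OF w Suc.prems f] by (rule norm_triangle_ineq)
        finally have "norm \<xi> ^ L * (\<bar>\<xi> \<bullet> b\<bar> * ?F) \<le> norm \<xi> ^ L * (norm (ftconv w (ddir b \<psi>) f \<xi>) + norm (ftconv w \<psi> (ddir b f) \<xi>))"
          by (rule mult_left_mono) simp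
        also have "\<dots> \<le> C b * B + C' * (?s b * B)"
          unfolding distrib_left using C b C' f schwartz_ddir[OF f, of b] B1 B2 by (intro add_mono) blast+
        also have "\<dots> = (C b + C' * ?s b) * B" by (simp add: algebra_simps)
        finally show ?thesis .
      qed
      have "norm \<xi> ^ Suc L * ?F = norm \<xi> ^ L * (norm \<xi> * ?F)" by simp
      also have "\<dots> \<le> norm \<xi> ^ L * ((\<Sum>b\<in>Basis. \<bar>\<xi> \<bullet> b\<bar>) * ?F)"
        by (intro mult_left_mono mult_right_mono norm_le_l1) auto
      also have "\<dots> = (\<Sum>b\<in>Basis. norm \<xi> ^ L * (\<bar>\<xi> \<bullet> b\<bar> * ?F))"
        by (simp only: sum_distrib_left sum_distrib_right)
      also have "\<dots> \<le> (\<Sum>b\<in>Basis. (C b + C' * ?s b) * B)" by (intro sum_mono one)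
      finally show ?thesis by (simp only: sum_distrib_right)
    qed
    moreover have "0 \<le> (\<Sum>b\<in>Basis. C b + C' * ?s b)"
      using C C' by (intro sum_nonneg add_nonneg_nonneg mult_nonneg_nonneg) auto
    ultimately show ?case by blast
  qed
  then show ?thesis by (rule that)
qed

section \<open>Wave front sets\<close>

text \<open>On the unit direction of \<xi>0 the cone contains a ball; half of its radius is spent on
  the direction of \<xi>, the other half on a perturbation of relative size \<open>c\<close>.
  Keeping \<open>c\<close> at most 1/2 ensures that the perturbed frequency is still comparable to
  \<xi>.\<close>

lemma conic_nbhd_shrink:
  assumes "conic_nbhd \<Gamma> \<xi>0"
  obtains \<Gamma>' c where "conic_nbhd \<Gamma>' \<xi>0" "0 < c" "c \<le> 1 / 2"
    "\<And>\<xi> \<tau>. \<xi> \<in> \<Gamma>' \<Longrightarrow> norm \<tau> \<le> c * norm \<xi> \<Longrightarrow> \<xi> - \<tau> \<in> \<Gamma>"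
proof -
  have \<Gamma>: "open \<Gamma>" "\<xi>0 \<in> \<Gamma>" "0 \<notin> \<Gamma>" and scale: "\<And>\<xi> t. \<xi> \<in> \<Gamma> \<Longrightarrow> t > 0 \<Longrightarrow> t *\<^sub>R \<xi> \<in> \<Gamma>"
    using assms by (auto simp: conic_nbhd_def)
  have n0: "norm \<xi>0 > 0" using \<Gamma> by auto
  define e where "e = (1 / norm \<xi>0) *\<^sub>R \<xi>0"
  have e: "e \<in> \<Gamma>" "norm \<xi>0 *\<^sub>R e = \<xi>0" unfolding e_def using n0 \<Gamma>(2) scale by auto
  obtain d where d: "d > 0" "ball e (2 * d) \<subseteq> \<Gamma>"
  proof -
    obtain r where "r > 0" "ball e r \<subseteq> \<Gamma>" using \<Gamma>(1) e(1) open_contains_ball by blast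
    then show ?thesis using that[of "r / 2"] by simp
  qed
  \<comment> \<open>Homogeneous form of "direction within \<open>d\<close> of \<open>e\<close>",
    free of division, so that openness and invariance under scaling are immediate; the strict
    inequality also excludes 0.\<close>
  define \<Gamma>' where "\<Gamma>' = {\<xi>. norm (\<xi> - norm \<xi> *\<^sub>R e) < d * norm \<xi>}"
  have "conic_nbhd \<Gamma>' \<xi>0"
    unfolding conic_nbhd_def
  proof (intro conjI ballI allI impI)
    show "open \<Gamma>'" unfolding \<Gamma>'_def by (intro open_Collect_less continuous_intros)
    show "\<xi>0 \<in> \<Gamma>'" using d(1) n0 e(2) by (simp add: \<Gamma>'_def)
    show "0 \<notin> \<Gamma>'" by (simp add: \<Gamma>'_def)
    fix \<xi> and t :: real assume "\<xi> \<in> \<Gamma>'" "t > 0"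
    have "t *\<^sub>R \<xi> - norm (t *\<^sub>R \<xi>) *\<^sub>R e = t *\<^sub>R (\<xi> - norm \<xi> *\<^sub>R e)" using \<open>t > 0\<close> by (simp add: scaleR_diff_right)
    then have "norm (t *\<^sub>R \<xi> - norm (t *\<^sub>R \<xi>) *\<^sub>R e) = t * norm (\<xi> - norm \<xi> *\<^sub>R e)" using \<open>t > 0\<close> by (simp only: norm_scaleR abs_of_pos)
    also have "\<dots> < t * (d * norm \<xi>)" using \<open>\<xi> \<in> \<Gamma>'\<close> \<open>t > 0\<close> by (simp add: \<Gamma>'_def)
    finally show "t *\<^sub>R \<xi> \<in> \<Gamma>'" using \<open>t > 0\<close> by (simp add: \<Gamma>'_def mult_ac)
  qed
  moreover have "\<xi> - \<tau> \<in> \<Gamma>" if "\<xi> \<in> \<Gamma>'" "norm \<tau> \<le> min d (1 / 2) * norm \<xi>" for \<xi> \<tau>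
  proof -
    have lt: "norm (\<xi> - norm \<xi> *\<^sub>R e) < d * norm \<xi>" using that(1) by (simp add: \<Gamma>'_def)
    have "\<xi> \<noteq> 0" using lt by auto
    then have n: "norm \<xi> > 0" by simp
    have "norm \<tau> \<le> d * norm \<xi>"
      by (rule order_trans[OF that(2)]) (intro mult_right_mono, auto)
    have "norm (norm \<xi> *\<^sub>R e - (\<xi> - \<tau>)) \<le> norm (norm \<xi> *\<^sub>R e - \<xi>) + norm \<tau>"
      using norm_triangle_ineq[of "norm \<xi> *\<^sub>R e - \<xi>" \<tau>] by (simp add: algebra_simps)
    also have "\<dots> < 2 * d * norm \<xi>" using lt \<open>norm \<tau> \<le> d * norm \<xi>\<close> by (simp add: norm_minus_commute)
    finally have "norm (norm \<xi> *\<^sub>R e - (\<xi> - \<tau>)) < 2 * d * norm \<xi>" .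
    moreover have "norm \<xi> *\<^sub>R e - (\<xi> - \<tau>) = norm \<xi> *\<^sub>R (e - (1 / norm \<xi>) *\<^sub>R (\<xi> - \<tau>))"
      using n by (simp add: scaleR_diff_right)
    ultimately have "norm \<xi> * norm (e - (1 / norm \<xi>) *\<^sub>R (\<xi> - \<tau>)) < norm \<xi> * (2 * d)"
      by (simp add: mult_ac)
    then have "norm (e - (1 / norm \<xi>) *\<^sub>R (\<xi> - \<tau>)) < 2 * d" using n by (simp only: mult_less_cancel_left_pos)
    then have "(1 / norm \<xi>) *\<^sub>R (\<xi> - \<tau>) \<in> \<Gamma>" using d(2) by (auto simp: dist_norm)
    from scale[OF this n] show ?thesis using n by simp
  qed
  ultimately show ?thesis using that[of \<Gamma>' "min d (1 / 2)"] d(1) by auto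
qed

lemma schwartz_bounded_dderivs:
  assumes "schwartz v" "set vs \<subseteq> Basis"
  shows "bounded (range (dderivs vs v))"
proof -
  obtain B where B: "sbd (length vs) v B" using assms(1) unfolding schwartz_iff by blast
  have "norm (dderivs vs v x) \<le> B" for x
    by (rule sbd_deriv_norm[OF B]) (use assms(2) in \<open>simp add: dirs_upto_def\<close>)
  then show ?thesis by (auto simp: bounded_iff)
qed

text \<open>Here \<open>\<eta> = \<rho> \<psi>'(\<cdot> + h)\<close> is expanded into characters by Fourier inversion: the frequencies
  close to the cone use the decay hypothesis, the others the rapid decay of \<open>ft \<eta>\<close>.\<close>

lemma localized_decay:
  fixes w :: "('a::euclidean_space \<Rightarrow> complex) \<Rightarrow> complex"
  assumes w: "tempered w" and \<psi>: "test_fun \<psi>" and \<rho>: "test_fun \<rho>" and \<psi>': "test_fun \<psi>'"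
    and loc: "\<And>h y. norm h \<le> \<delta> \<Longrightarrow> \<psi> y * (\<rho> y * \<psi>' (y + h)) = \<psi>' (y + h)"
    and decay: "\<And>k::nat. \<exists>C. \<forall>\<xi>\<in>\<Gamma>. (1 + norm \<xi>) ^ k * norm (w (\<lambda>x. \<psi> x * echar \<xi> x)) \<le> C"
    and c: "0 < c" "c \<le> 1 / 2" and cone: "\<And>\<xi> \<tau>. \<xi> \<in> \<Gamma>' \<Longrightarrow> norm \<tau> \<le> c * norm \<xi> \<Longrightarrow> \<xi> - \<tau> \<in> \<Gamma>"
  shows "\<exists>C. \<forall>\<xi>\<in>\<Gamma>'. \<forall>h. norm h \<le> \<delta> \<longrightarrow> (1 + norm \<xi>) ^ k * norm (w (\<lambda>y. \<psi>' (y + h) * echar \<xi> y)) \<le> C"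
proof -
  define V where "V \<zeta> = w (\<lambda>y. \<psi> y * echar \<zeta> y)" for \<zeta>
  have lip: "lipfam (\<lambda>\<tau> y. \<psi> y * echar \<tau> y)" by (rule lipfam_modulation[OF test_fun_schwartz[OF \<psi>]])
  obtain C0 K where C0: "C0 \<ge> 0" "\<And>\<zeta>. norm (V \<zeta>) \<le> C0 * (1 + norm \<zeta>) ^ K" and Vc: "continuous_on UNIV V"
    using tempered_lipfam[OF w lip] unfolding V_def by metis
  obtain C1 where C1: "\<And>\<xi>. \<xi> \<in> \<Gamma> \<Longrightarrow> (1 + norm \<xi>) ^ k * norm (V \<xi>) \<le> C1" using decay[of k] by (auto simp: V_def)
  \<comment> \<open>For frequencies with \<open>norm \<tau> > c * norm \<xi>\<close> the K + k
    powers of \<open>1 + norm \<xi>\<close> are turned into powers of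
    \<open>1 + norm \<tau>\<close>, in addition to the K powers of the latter from the growth of
    \<open>V\<close>.\<close>
  define M where "M = 2 * K + k"
  define C3 where "C3 = 2 ^ k * \<bar>C1\<bar> + C0 * (1 / c) ^ (K + k)"
  have C3: "C3 \<ge> 0" using C0(1) c by (simp add: C3_def)
  have key: "(1 + norm \<xi>) ^ k * norm (V (\<xi> - \<tau>)) \<le> C3 * (1 + norm \<tau>) ^ M" if \<xi>: "\<xi> \<in> \<Gamma>'" for \<xi> \<tau>
  proof (cases "norm \<tau> \<le> c * norm \<xi>")
    case True
    have "norm \<tau> \<le> 1 / 2 * norm \<xi>" by (rule order_trans[OF True]) (intro mult_right_mono c, simp)
    then have "1 + norm \<xi> \<le> 2 * (1 + norm (\<xi> - \<tau>))" using norm_triangle_ineq2[of \<xi> \<tau>] by (simp add: distrib_left)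
    then have "(1 + norm \<xi>) ^ k \<le> (2 * (1 + norm (\<xi> - \<tau>))) ^ k" by (intro power_mono) auto
    then have "(1 + norm \<xi>) ^ k * norm (V (\<xi> - \<tau>)) \<le> (2 * (1 + norm (\<xi> - \<tau>))) ^ k * norm (V (\<xi> - \<tau>))" by (intro mult_right_mono) auto
    also have "\<dots> = 2 ^ k * ((1 + norm (\<xi> - \<tau>)) ^ k * norm (V (\<xi> - \<tau>)))" by (simp only: power_mult_distrib mult_ac)
    also have "\<dots> \<le> 2 ^ k * C1" by (intro mult_left_mono C1 cone[OF \<xi> True]) auto
    also have "\<dots> \<le> 2 ^ k * \<bar>C1\<bar>" by (intro mult_left_mono) auto
    also have "\<dots> \<le> C3" using C0(1) c by (simp add: C3_def)
    also have "C3 = C3 * 1" by simp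
    also have "\<dots> \<le> C3 * (1 + norm \<tau>) ^ M" by (intro mult_left_mono one_le_power C3) auto
    finally show ?thesis .
  next
    case False
    then have "norm \<xi> \<le> 1 / c * norm \<tau>" using c by (simp add: field_simps)
    moreover have "1 \<le> 1 / c" using c by (simp add: field_simps)
    ultimately have x: "1 + norm \<xi> \<le> 1 / c * (1 + norm \<tau>)" by (simp add: distrib_left)
    have "norm (V (\<xi> - \<tau>)) \<le> C0 * (1 + norm (\<xi> - \<tau>)) ^ K" by (rule C0)
    also have "\<dots> \<le> C0 * ((1 + norm \<xi>) * (1 + norm \<tau>)) ^ K"
      using one_plus_norm_add_le[of \<xi> "- \<tau>"] C0(1) by (intro mult_left_mono power_mono) auto
    finally have "(1 + norm \<xi>) ^ k * norm (V (\<xi> - \<tau>)) \<le> (1 + norm \<xi>) ^ k * (C0 * ((1 + norm \<xi>) * (1 + norm \<tau>)) ^ K)"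
      by (rule mult_left_mono) simp
    also have "\<dots> = C0 * ((1 + norm \<xi>) ^ (K + k) * (1 + norm \<tau>) ^ K)" by (simp only: power_mult_distrib power_add mult_ac)
    also have "\<dots> \<le> C0 * ((1 / c * (1 + norm \<tau>)) ^ (K + k) * (1 + norm \<tau>) ^ K)"
      by (intro mult_left_mono mult_right_mono power_mono x C0) auto
    also have "\<dots> = C0 * (1 / c) ^ (K + k) * ((1 + norm \<tau>) ^ (K + k) * (1 + norm \<tau>) ^ K)"
      by (simp only: power_mult_distrib mult_ac)
    also have "(1 + norm \<tau>) ^ (K + k) * (1 + norm \<tau>) ^ K = (1 + norm \<tau>) ^ M"
      by (simp add: M_def mult_2 add_ac flip: power_add)
    also have "C0 * (1 / c) ^ (K + k) * (1 + norm \<tau>) ^ M \<le> C3 * (1 + norm \<tau>) ^ M"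
      by (intro mult_right_mono) (auto simp: C3_def)
    finally show ?thesis .
  qed
  \<comment> \<open>M powers pay for the bound \<open>key\<close>, the remaining ones make the
    \<tau>-integral converge. The bound is uniform in \<open>h\<close>, which is what carries over
    to the conclusion.\<close>
  obtain B where B: "\<And>h \<tau>. (1 + norm \<tau>) ^ (DIM('a) + 2 + M) * norm (ft (\<lambda>x. \<rho> x * \<psi>' (x + h)) \<tau>) \<le> B"
    using ft_translate_decay[OF \<rho> test_fun_smooth_fun[OF \<psi>'] schwartz_bounded_dderivs[OF test_fun_schwartz[OF \<psi>']], of "DIM('a) + 2 + M"]
    by blast
  obtain \<kappa> :: complex where \<kappa>: "\<kappa> \<noteq> 0" and inv: "\<And>(\<eta>::'a \<Rightarrow> complex) y. test_fun \<eta> \<Longrightarrow> (\<integral>\<tau>. ft \<eta> \<tau> * echar \<tau> (- y) \<partial>lborel) = \<kappa> * \<eta> y"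
    using ft_inversion by blast
  let ?I = "\<integral>\<tau>. 1 / (1 + norm \<tau>) ^ (DIM('a) + 2) \<partial>(lborel :: 'a measure)"
  have "(1 + norm \<xi>) ^ k * norm (w (\<lambda>y. \<psi>' (y + h) * echar \<xi> y)) \<le> (C3 * B * ?I) / norm \<kappa>"
    if \<xi>: "\<xi> \<in> \<Gamma>'" and h: "norm h \<le> \<delta>" for \<xi> h
  proof -
    define \<eta> where "\<eta> x = \<rho> x * \<psi>' (x + h)" for x
    have sh: "schwartz (\<lambda>y. \<psi>' (y + h))" by (rule schwartz_translate[OF test_fun_schwartz[OF \<psi>']])
    have \<eta>: "test_fun \<eta>" unfolding \<eta>_def by (rule test_fun_mult[OF \<rho> schwartz_smooth_fun[OF sh]])
    have r: "rapid (ft \<eta>)" by (rule rapid_ft[OF \<eta>])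
    have g: "lipfam (\<lambda>\<tau> y. \<psi> y * echar (\<xi> - \<tau>) y)" using lipfam_affine[OF lip, of "-1" \<xi>] by simp
    \<comment> \<open>The translated cutoff equals \<psi> \<eta> by \<open>loc\<close>. Expanding
      only \<eta> into characters keeps the factor \<psi>, for which decay is known, and shifts its
      frequency to \<open>\<xi> - \<tau>\<close>.\<close>
    have "(\<lambda>y. \<kappa> * (\<psi>' (y + h) * echar \<xi> y)) = cint (ft \<eta>) (\<lambda>\<tau> y. \<psi> y * echar (\<xi> - \<tau>) y)"
    proof
      fix y
      have split: "ft \<eta> \<tau> * (\<psi> y * echar (\<xi> - \<tau>) y) = (\<psi> y * echar \<xi> y) * (ft \<eta> \<tau> * echar \<tau> (- y))" for \<tau>
        using echar_add_freq[of \<xi> "- \<tau>" y] echar_scaleR[of "-1" \<tau> y] by simp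
      have "cint (ft \<eta>) (\<lambda>\<tau> y. \<psi> y * echar (\<xi> - \<tau>) y) y = (\<psi> y * echar \<xi> y) * (\<integral>\<tau>. ft \<eta> \<tau> * echar \<tau> (- y) \<partial>lborel)"
        unfolding cint_def split by simp
      also have "\<dots> = \<kappa> * ((\<psi> y * \<eta> y) * echar \<xi> y)" by (simp add: inv[OF \<eta>])
      also have "\<psi> y * \<eta> y = \<psi>' (y + h)" unfolding \<eta>_def by (rule loc[OF h])
      finally show "\<kappa> * (\<psi>' (y + h) * echar \<xi> y) = cint (ft \<eta>) (\<lambda>\<tau> y. \<psi> y * echar (\<xi> - \<tau>) y) y" by simp
    qed
    then have "\<kappa> * w (\<lambda>y. \<psi>' (y + h) * echar \<xi> y) = w (cint (ft \<eta>) (\<lambda>\<tau> y. \<psi> y * echar (\<xi> - \<tau>) y))"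
      using tempered_cmult[OF w schwartz_modulation[OF sh], of \<kappa> \<xi>] by simp
    also have "\<dots> = (\<integral>\<tau>. ft \<eta> \<tau> * V (\<xi> - \<tau>) \<partial>lborel)"
      unfolding V_def by (rule tempered_cint[OF w r g])
    finally have eq: "(1 + norm \<xi>) ^ k * (norm \<kappa> * norm (w (\<lambda>y. \<psi>' (y + h) * echar \<xi> y)))
        = norm (\<integral>\<tau>. (1 + norm \<xi>) ^ k *\<^sub>R (ft \<eta> \<tau> * V (\<xi> - \<tau>)) \<partial>lborel)"
      by (simp flip: norm_mult)
    also have "\<dots> \<le> (C3 * B) * ?I"
    proof (rule integrable_decay(2))
      have "continuous_on UNIV (\<lambda>\<tau>. V (\<xi> - \<tau>))"
        by (rule continuous_on_compose2[OF Vc]) (auto intro!: continuous_intros)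
      then have [measurable]: "(\<lambda>\<tau>. V (\<xi> - \<tau>)) \<in> borel_measurable borel" by (rule borel_measurable_continuous_onI)
      have [measurable]: "ft \<eta> \<in> borel_measurable borel" by (rule rapid_measurable[OF r])
      show "(\<lambda>\<tau>. (1 + norm \<xi>) ^ k *\<^sub>R (ft \<eta> \<tau> * V (\<xi> - \<tau>))) \<in> borel_measurable borel" by measurable
      fix \<tau> :: 'a
      let ?X = "(1 + norm \<tau>) ^ (DIM('a) + 2)"
      have "?X * norm ((1 + norm \<xi>) ^ k *\<^sub>R (ft \<eta> \<tau> * V (\<xi> - \<tau>))) = ?X * norm (ft \<eta> \<tau>) * ((1 + norm \<xi>) ^ k * norm (V (\<xi> - \<tau>)))"
        by (simp add: norm_mult mult_ac)
      also have "\<dots> \<le> ?X * norm (ft \<eta> \<tau>) * (C3 * (1 + norm \<tau>) ^ M)" by (intro mult_left_mono key[OF \<xi>]) auto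
      also have "\<dots> = C3 * ((1 + norm \<tau>) ^ (DIM('a) + 2 + M) * norm (ft \<eta> \<tau>))" by (simp only: power_add mult_ac)
      also have "\<dots> \<le> C3 * B" using B[of \<tau> h] by (intro mult_left_mono C3) (simp add: \<eta>_def[abs_def])
      finally show "?X * norm ((1 + norm \<xi>) ^ k *\<^sub>R (ft \<eta> \<tau> * V (\<xi> - \<tau>))) \<le> C3 * B" .
    qed
    finally show ?thesis using \<kappa> by (simp add: field_simps)
  qed
  then show ?thesis by blast
qed

text \<open>\<rho> is a smooth, compactly supported substitute for 1/\<psi> near x0. The radius is
  halved so that a point moved by at most r/2 into the support region of the new cutoff still lies
  where \<psi> \<rho> = 1.\<close>

lemma localizing_functions:
  fixes \<psi> :: "'a::euclidean_space \<Rightarrow> complex"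
  assumes \<psi>: "test_fun \<psi>" and x0: "\<psi> x0 \<noteq> 0"
  obtains \<psi>' \<rho> \<delta> where "test_fun \<psi>'" "\<psi>' x0 \<noteq> 0" "test_fun \<rho>" "\<delta> > 0"
    "\<And>h y. norm h \<le> \<delta> \<Longrightarrow> \<psi> y * (\<rho> y * \<psi>' (y + h)) = \<psi>' (y + h)"
proof -
  note sm = test_fun_smooth_fun[OF \<psi>]
  have "open {y. \<psi> y \<noteq> 0}" by (intro open_Collect_neq smooth_fun_continuous_on sm continuous_on_const)
  then obtain r where r: "r > 0" "cball x0 r \<subseteq> {y. \<psi> y \<noteq> 0}" using x0 open_contains_cball by blast
  \<comment> \<open>The squared modulus of \<psi> plus a nonnegative function that vanishes exactly
    on the closed ball. It has no zeros, and on the ball it equals \<psi> times its conjugate, so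
    conj(\<psi>)/q inverts \<psi> there and inherits compact support.\<close>
  define q where "q y = \<psi> y * cnj (\<psi> y) + rad (-1) r x0 y" for y
  have out: "rad (-1) r x0 y = 0 \<longleftrightarrow> dist y x0 \<le> r" for y using rad_outside[OF r(1), of x0 y] by auto
  have q0: "q y \<noteq> 0" for y
  proof -
    have "q y = of_real ((norm (\<psi> y))\<^sup>2 + flat 0 (-1 * (r\<^sup>2 - (norm (y - x0))\<^sup>2)))"
      by (simp add: q_def rad_def complex_norm_square flip: of_real_power)
    moreover have "(norm (\<psi> y))\<^sup>2 + flat 0 (-1 * (r\<^sup>2 - (norm (y - x0))\<^sup>2)) \<noteq> 0"
    proof
      assume "(norm (\<psi> y))\<^sup>2 + flat 0 (-1 * (r\<^sup>2 - (norm (y - x0))\<^sup>2)) = 0"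
      then have "(norm (\<psi> y))\<^sup>2 = 0" "flat 0 (-1 * (r\<^sup>2 - (norm (y - x0))\<^sup>2)) = 0"
        using flat_nonneg[of 0 "-1 * (r\<^sup>2 - (norm (y - x0))\<^sup>2)"] zero_le_power2[of "norm (\<psi> y)"] by linarith+
      then have "\<psi> y = 0" "dist y x0 \<le> r" using out[of y] by (auto simp: rad_def)
      then show False using r(2) by (auto simp: dist_commute)
    qed
    ultimately show ?thesis by (simp only: of_real_eq_0_iff not_False_eq_True)
  qed
  have sc: "smooth_fun (\<lambda>y. cnj (\<psi> y))" by (rule smooth_fun_compose_linear[OF bounded_linear_cnj sm])
  have sq: "smooth_fun q" unfolding q_def by (intro smooth_fun_add smooth_fun_mult sm sc smooth_fun_rad)
  have tc: "test_fun (\<lambda>y. cnj (\<psi> y))" using \<psi> sc unfolding test_fun_iff by simp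
  define \<rho> where "\<rho> y = cnj (\<psi> y) * inverse (q y)" for y
  have t\<rho>: "test_fun \<rho>" unfolding \<rho>_def by (rule test_fun_mult[OF tc smooth_fun_inverse[OF sq q0]])
  have one: "\<psi> y * \<rho> y = 1" if "dist y x0 \<le> r" for y
    using that out[of y] q0[of y] by (simp add: \<rho>_def q_def field_simps)
  show ?thesis
  proof (rule that[of "rad 1 (r / 2) x0" \<rho> "r / 2"])
    show "test_fun (rad 1 (r / 2) x0)" by (rule test_fun_rad)
    show "rad 1 (r / 2) x0 x0 \<noteq> 0" using r(1) by (subst rad_inside) auto
    show "test_fun \<rho>" "r / 2 > 0" using t\<rho> r(1) by auto
    fix h y :: 'a assume h: "norm h \<le> r / 2"
    show "\<psi> y * (\<rho> y * rad 1 (r / 2) x0 (y + h)) = rad 1 (r / 2) x0 (y + h)"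
    proof (cases "rad 1 (r / 2) x0 (y + h) = 0")
      case False
      then have "dist (y + h) x0 < r / 2" using r(1) by (subst (asm) rad_inside) auto
      then have "dist y x0 \<le> r" using dist_triangle[of y x0 "y + h"] h by (simp add: dist_norm)
      from one[OF this] show ?thesis by (simp add: mult.assoc[symmetric])
    qed simp
  qed
qed

text \<open>The constant must not depend on \<open>t\<close>. Integration by parts alone loses
  powers of \<open>t\<close>, and the hypothesis alone covers only shifts s/t of norm at most
  \<delta>; on either side of 1 + |xi| = t^2 one of these two losses can be paid for.\<close>

lemma ftconv_rapid_decay:
  fixes w :: "('a::euclidean_space \<Rightarrow> complex) \<Rightarrow> complex"
  assumes w: "tempered w" and \<psi>: "test_fun \<psi>" and \<theta>: "schwartz \<theta>" and \<delta>: "\<delta> > 0"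
    and near: "\<And>k::nat. \<exists>C. \<forall>\<xi>\<in>\<Gamma>. \<forall>h. norm h \<le> \<delta> \<longrightarrow> (1 + norm \<xi>) ^ k * norm (w (\<lambda>y. \<psi> (y + h) * echar \<xi> y)) \<le> C"
  shows "\<exists>C. \<forall>t\<ge>2. \<forall>\<xi>\<in>\<Gamma>. (1 + norm \<xi>) ^ k * norm (ftconv w \<psi> (rescale t \<theta>) \<xi>) \<le> C"
proof -
  obtain C K where C: "C \<ge> 0"
    and b1: "\<And>\<xi> z. norm (shifted w \<psi> \<xi> z) \<le> C * (1 + norm z) ^ K * (1 + norm \<xi>) ^ K"
    and "\<And>\<xi> z. norm (shifted w \<psi> \<xi> z - shifted w \<psi> \<xi> 0) \<le> C * norm z * (1 + norm z) ^ K * (1 + norm \<xi>) ^ K"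
    using shifted_bounds[OF w \<psi>] by blast
  obtain Cn where Cn: "\<And>\<xi> h. \<xi> \<in> \<Gamma> \<Longrightarrow> norm h \<le> \<delta> \<Longrightarrow> (1 + norm \<xi>) ^ k * norm (w (\<lambda>y. \<psi> (y + h) * echar \<xi> y)) \<le> Cn"
    using near[of k] by blast
  \<comment> \<open>Translating the character only produces a phase of modulus 1, so the hypothesis
    on translated cutoffs with a fixed character is enough.\<close>
  have nearb: "(1 + norm \<xi>) ^ k * norm (shifted w \<psi> \<xi> z) \<le> Cn" if "\<xi> \<in> \<Gamma>" "norm z \<le> \<delta>" for \<xi> z
  proof -
    have s: "schwartz (\<lambda>y. \<psi> (y + z) * echar \<xi> y)"
      by (intro schwartz_modulation schwartz_translate test_fun_schwartz \<psi>)
    have "shifted w \<psi> \<xi> z = w (\<lambda>y. echar \<xi> z * (\<psi> (y + z) * echar \<xi> y))"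
      by (simp add: shifted_def echar_add mult_ac)
    also have "\<dots> = echar \<xi> z * w (\<lambda>y. \<psi> (y + z) * echar \<xi> y)" by (rule tempered_cmult[OF w s])
    finally show ?thesis using Cn[OF that] by (simp add: norm_mult)
  qed
  have rc: "rapid \<theta>" by (rule schwartz_rapid[OF \<theta>])
  \<comment> \<open>K + k powers of \<open>1 + norm \<xi>\<close> are at most t^J below the
    threshold, and far shifts satisfy \<open>t \<le> (1 / \<delta>) * (1 + norm s)\<close>; so J
    extra powers of s suffice.\<close>
  define J where "J = 2 * (K + k)"
  define D where "D = \<bar>Cn\<bar> + C * (1 / \<delta>) ^ J"
  let ?I = "\<integral>s. norm (\<theta> s) * (1 + norm s) ^ (K + J) \<partial>lborel"
  have low: "(1 + norm \<xi>) ^ k * norm (ftconv w \<psi> (rescale t \<theta>) \<xi>) \<le> D * ?I"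
    if t: "t \<ge> 2" and \<xi>: "\<xi> \<in> \<Gamma>" and small: "1 + norm \<xi> \<le> t\<^sup>2" for t \<xi>
  proof -
    let ?S = "\<lambda>s. shifted w \<psi> \<xi> ((1 / t) *\<^sub>R s)"
    have [measurable]: "shifted w \<psi> \<xi> \<in> borel_measurable borel" "\<theta> \<in> borel_measurable borel"
      by (intro shifted_measurable w \<psi> rapid_measurable rc)+
    have nle: "norm ((1 / t) *\<^sub>R s) \<le> norm s" for s :: 'a
      using t mult_left_le_one_le[of "norm s" "1 / t"] by simp
    have bound: "(1 + norm \<xi>) ^ k * norm (?S s) \<le> D * (1 + norm s) ^ (K + J)" for s
    proof (cases "norm ((1 / t) *\<^sub>R s) \<le> \<delta>")
      case True
      have "(1 + norm \<xi>) ^ k * norm (?S s) \<le> Cn" by (rule nearb[OF \<xi> True])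
      also have "\<dots> \<le> D * 1" using C \<delta> by (simp add: D_def add_increasing2)
      also have "\<dots> \<le> D * (1 + norm s) ^ (K + J)"
        using C \<delta> by (intro mult_left_mono one_le_power) (auto simp: D_def)
      finally show ?thesis .
    next
      case False
      then have "t \<le> (1 / \<delta>) * norm s" using t \<delta> by (simp add: field_simps)
      also have "\<dots> \<le> (1 / \<delta>) * (1 + norm s)" using \<delta> by (intro mult_left_mono) auto
      finally have ts: "t \<le> (1 / \<delta>) * (1 + norm s)" .
      have "(1 + norm \<xi>) ^ (K + k) \<le> (t\<^sup>2) ^ (K + k)" by (intro power_mono small) auto
      also have "\<dots> = t ^ J" by (simp add: J_def flip: power_mult)
      also have "\<dots> \<le> ((1 / \<delta>) * (1 + norm s)) ^ J" using t by (intro power_mono ts) auto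
      also have "\<dots> = (1 / \<delta>) ^ J * (1 + norm s) ^ J" by (rule power_mult_distrib)
      finally have xs: "(1 + norm \<xi>) ^ (K + k) \<le> (1 / \<delta>) ^ J * (1 + norm s) ^ J" .
      have "norm (?S s) \<le> C * (1 + norm ((1 / t) *\<^sub>R s)) ^ K * (1 + norm \<xi>) ^ K" by (rule b1)
      also have "\<dots> \<le> C * (1 + norm s) ^ K * (1 + norm \<xi>) ^ K"
        using C nle[of s] by (intro mult_right_mono mult_left_mono power_mono) auto
      finally have "(1 + norm \<xi>) ^ k * norm (?S s) \<le> (1 + norm \<xi>) ^ k * (C * (1 + norm s) ^ K * (1 + norm \<xi>) ^ K)"
        by (rule mult_left_mono) simp
      also have "\<dots> = C * (1 + norm s) ^ K * (1 + norm \<xi>) ^ (K + k)" by (simp only: power_add mult_ac)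
      also have "\<dots> \<le> C * (1 + norm s) ^ K * ((1 / \<delta>) ^ J * (1 + norm s) ^ J)"
        using C by (intro mult_left_mono xs) auto
      also have "\<dots> = (C * (1 / \<delta>) ^ J) * (1 + norm s) ^ (K + J)" by (simp only: power_add mult_ac)
      also have "\<dots> \<le> D * (1 + norm s) ^ (K + J)" by (intro mult_right_mono) (auto simp: D_def)
      finally show ?thesis .
    qed
    have "(1 + norm \<xi>) ^ k * norm (ftconv w \<psi> (rescale t \<theta>) \<xi>) = norm (\<integral>s. (1 + norm \<xi>) ^ k *\<^sub>R (\<theta> s * ?S s) \<partial>lborel)"
      using t by (simp add: ftconv_rescale[OF w \<psi> \<theta>])
    also have "\<dots> \<le> (\<integral>s. D * (norm (\<theta> s) * (1 + norm s) ^ (K + J)) \<partial>lborel)"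
    proof (rule Bochner_Integration.integral_norm_bound_integral)
      show "integrable lborel (\<lambda>s. (1 + norm \<xi>) ^ k *\<^sub>R (\<theta> s * ?S s))"
      proof (intro integrable_scaleR_right rapid_integrable[OF rc, where C = "C * (1 + norm \<xi>) ^ K" and K = K])
        fix s
        have "norm (?S s) \<le> C * (1 + norm ((1 / t) *\<^sub>R s)) ^ K * (1 + norm \<xi>) ^ K" by (rule b1)
        also have "\<dots> \<le> C * (1 + norm s) ^ K * (1 + norm \<xi>) ^ K"
          using C nle[of s] by (intro mult_right_mono mult_left_mono power_mono) auto
        finally show "norm (?S s) \<le> C * (1 + norm \<xi>) ^ K * (1 + norm s) ^ K" by (simp only: mult_ac)
      qed simp
      show "integrable lborel (\<lambda>s. D * (norm (\<theta> s) * (1 + norm s) ^ (K + J)))"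
        by (rule integrable_mult_right[OF rc[unfolded rapid_def, THEN conjunct2, THEN spec]])
      fix s
      have "norm (\<theta> s) * ((1 + norm \<xi>) ^ k * norm (?S s)) \<le> norm (\<theta> s) * (D * (1 + norm s) ^ (K + J))"
        by (intro mult_left_mono bound) simp
      then show "norm ((1 + norm \<xi>) ^ k *\<^sub>R (\<theta> s * ?S s)) \<le> D * (norm (\<theta> s) * (1 + norm s) ^ (K + J))"
        by (simp add: norm_mult mult_ac)
    qed
    also have "\<dots> = D * ?I" by simp
    finally show ?thesis .
  qed
  obtain N where N: "\<And>L \<psi>. test_fun \<psi> \<Longrightarrow>
    \<exists>C\<ge>0. \<forall>f B \<xi>. schwartz f \<longrightarrow> sbd (N + L) f B \<longrightarrow> norm \<xi> ^ L * norm (ftconv w \<psi> f \<xi>) \<le> C * B"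
    using ftconv_decay[OF w] by blast
  \<comment> \<open>With L = P + k the loss for the rescaled kernel is t^(m+N+L) = t^(2P), at most
    (1 + |xi|)^P above the threshold, while the gain is P + k powers: exactly k remain.\<close>
  define P where "P = DIM('a) + N + k"
  define L where "L = P + k"
  obtain E where E: "E \<ge> 0" "\<And>f B \<xi>. schwartz f \<Longrightarrow> sbd (N + L) f B \<Longrightarrow> norm \<xi> ^ L * norm (ftconv w \<psi> f \<xi>) \<le> E * B"
    using N[OF \<psi>, of L] by blast
  obtain B where B: "sbd (N + L) \<theta> B" using \<theta> unfolding schwartz_iff by blast
  have high: "(1 + norm \<xi>) ^ k * norm (ftconv w \<psi> (rescale t \<theta>) \<xi>) \<le> 2 ^ L * (E * B)"
    if t: "t \<ge> 2" and large: "t\<^sup>2 \<le> 1 + norm \<xi>" for t \<xi>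
  proof -
    let ?F = "norm (ftconv w \<psi> (rescale t \<theta>) \<xi>)" and ?x = "1 + norm \<xi>"
    \<comment> \<open>Here \<open>t \<ge> 2\<close> enters: \<xi> is then bounded away from 0, so
      the powers of \<open>norm \<xi>\<close> gained by parts can be exchanged for powers of
      \<open>1 + norm \<xi>\<close>.\<close>
    have "2\<^sup>2 \<le> t\<^sup>2" using t by (intro power_mono) auto
    then have "?x \<le> 2 * norm \<xi>" using large by simp
    then have "?x ^ L \<le> (2 * norm \<xi>) ^ L" by (intro power_mono) auto
    then have "?x ^ L * ?F \<le> (2 * norm \<xi>) ^ L * ?F" by (intro mult_right_mono) auto
    also have "\<dots> = 2 ^ L * (norm \<xi> ^ L * ?F)" by (simp only: power_mult_distrib mult_ac)
    also have "\<dots> \<le> 2 ^ L * (E * (t ^ (DIM('a) + (N + L)) * B))"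
      using t by (intro mult_left_mono E(2) schwartz_rescale sbd_rescale B \<theta> schwartz_smooth_fun[OF \<theta>]) auto
    also have "DIM('a) + (N + L) = 2 * P" by (simp add: L_def P_def)
    also have "t ^ (2 * P) = (t\<^sup>2) ^ P" by (rule power_mult)
    also have "2 ^ L * (E * ((t\<^sup>2) ^ P * B)) \<le> 2 ^ L * (E * (?x ^ P * B))"
      using E(1) sbd_nonneg[OF B] large by (intro mult_left_mono mult_right_mono power_mono) auto
    finally have "?x ^ P * (?x ^ k * ?F) \<le> ?x ^ P * (2 ^ L * (E * B))" by (simp only: L_def power_add mult_ac)
    moreover have "?x ^ P > 0" by (intro zero_less_power add_pos_nonneg) auto
    ultimately show ?thesis by (simp only: mult_le_cancel_left_pos)
  qed
  have "(1 + norm \<xi>) ^ k * norm (ftconv w \<psi> (rescale t \<theta>) \<xi>) \<le> max (D * ?I) (2 ^ L * (E * B))"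
    if "t \<ge> 2" "\<xi> \<in> \<Gamma>" for t \<xi>
    using low[OF that] high[OF that(1), of \<xi>] by (cases "1 + norm \<xi> \<le> t\<^sup>2") (auto simp: le_max_iff_disj)
  then show ?thesis by blast
qed

section \<open>The embedded distribution along the scaling\<close>

lemma embed_rep_eq:
  assumes "\<phi> \<in> mollA q" "\<epsilon> > 0"
  shows "embed_rep \<gamma> \<theta> w (dil \<epsilon> \<phi>) x = dconv w (rescale (\<gamma> (\<epsilon> * lsupp \<phi>)) \<theta>) x"
proof -
  have "chi_gamma \<gamma> \<theta> (dil \<epsilon> \<phi>) = rescale (\<gamma> (\<epsilon> * lsupp \<phi>)) \<theta>"
    by (simp add: chi_gamma_def rescale_def lsupp_dil[OF assms] fun_eq_iff)
  then show ?thesis by (simp add: embed_rep_def)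
qed

lemma fourier_embed_rep:
  assumes "tempered w" "test_fun \<psi>" "schwartz \<theta>" "\<phi> \<in> mollA q" "\<epsilon> > 0" "\<gamma> (\<epsilon> * lsupp \<phi>) \<ge> 1"
  shows "fourier (\<lambda>x. \<psi> x * embed_rep \<gamma> \<theta> w (dil \<epsilon> \<phi>) x) \<xi> = ftconv w \<psi> (rescale (\<gamma> (\<epsilon> * lsupp \<phi>)) \<theta>) \<xi>"
  unfolding embed_rep_eq[OF assms(4,5)] by (rule fourier_dconv[OF assms(1,2) schwartz_rescale[OF assms(3,6)]])

lemma admissible_scaling_large:
  assumes "admissible_scaling \<gamma>" "l > 0"
  obtains \<epsilon>0 where "\<epsilon>0 > 0" "\<And>\<epsilon>. 0 < \<epsilon> \<Longrightarrow> \<epsilon> < \<epsilon>0 \<Longrightarrow> \<gamma> (\<epsilon> * l) \<ge> c"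
proof -
  have "filterlim \<gamma> at_top (at_right 0)" using assms(1) by (simp add: admissible_scaling_def)
  then have "\<forall>\<^sub>F r in at_right 0. c \<le> \<gamma> r" by (simp add: filterlim_at_top)
  then obtain b where b: "b > 0" "\<And>r. 0 < r \<Longrightarrow> r < b \<Longrightarrow> c \<le> \<gamma> r"
    unfolding eventually_at_right_field by blast
  show ?thesis
  proof (rule that[of "b / l"])
    show "b / l > 0" using b assms by simp
    show "\<gamma> (\<epsilon> * l) \<ge> c" if "0 < \<epsilon>" "\<epsilon> < b / l" for \<epsilon>
      by (rule b(2)) (use that assms(2) in \<open>auto simp: field_simps\<close>)
  qed
qed

text \<open>The intermediate value theorem between a fixed point and a point near 0 where \<gamma>
  is already large. Exact values are wanted so that the scale can be prescribed as a function of the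
  frequency.\<close>

lemma admissible_scaling_attains:
  assumes \<gamma>: "admissible_scaling \<gamma>" and l: "l > 0" and \<epsilon>0: "\<epsilon>0 > 0"
  obtains \<Lambda> where "\<Lambda> \<ge> 1" "\<And>t. t \<ge> \<Lambda> \<Longrightarrow> \<exists>\<epsilon>. 0 < \<epsilon> \<and> \<epsilon> < \<epsilon>0 \<and> \<gamma> (\<epsilon> * l) = t"
proof -
  \<comment> \<open>Halving keeps the interval inside (0, 1), where \<gamma> is continuous, and
    makes \<open>r / l\<close> strictly smaller than \<epsilon>0.\<close>
  define r1 where "r1 = min (\<epsilon>0 * l) 1 / 2"
  have r1: "0 < r1" "r1 < 1" "r1 < \<epsilon>0 * l" using l \<epsilon>0 by (auto simp: r1_def min_def)
  show ?thesis
  proof (rule that[of "max 1 (\<gamma> r1)"])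
    fix t assume t: "t \<ge> max 1 (\<gamma> r1)"
    obtain e where e: "e > 0" "\<And>\<epsilon>. 0 < \<epsilon> \<Longrightarrow> \<epsilon> < e \<Longrightarrow> \<gamma> (\<epsilon> * 1) \<ge> t"
      using admissible_scaling_large[OF \<gamma>, of 1 t] by auto
    define r2 where "r2 = min e r1 / 2"
    have r2: "0 < r2" "r2 < e" "r2 \<le> r1" using e(1) r1 by (auto simp: r2_def min_def)
    have "continuous_on {r2..r1} \<gamma>"
      using \<gamma> r1 r2 by (auto simp: admissible_scaling_def intro: continuous_on_subset)
    then have "\<exists>r\<ge>r2. r \<le> r1 \<and> \<gamma> r = t"
      using e(2)[of r2] r2 t by (intro IVT2') auto
    then obtain r where "r2 \<le> r" "r \<le> r1" "\<gamma> r = t" by blast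
    then show "\<exists>\<epsilon>. 0 < \<epsilon> \<and> \<epsilon> < \<epsilon>0 \<and> \<gamma> (\<epsilon> * l) = t"
      using l r1 r2 by (intro exI[of _ "r / l"]) (auto simp: field_simps)
  qed simp
qed

text \<open>The estimate for rescaled kernels is uniform in the scale, so the definition is met with
  the exponent N = 0, and M = 0 for every k; only \<open>\<gamma> \<ge> 2\<close> has to be ensured
  by taking \<epsilon> small.\<close>

lemma not_in_Sigma_g_if_decay:
  fixes w :: "(real^'m \<Rightarrow> complex) \<Rightarrow> complex"
  assumes w: "tempered w" and \<gamma>: "admissible_scaling \<gamma>" and \<theta>: "schwartz \<theta>"
    and \<psi>: "test_fun \<psi>" "\<psi> x0 \<noteq> 0" and \<Gamma>: "conic_nbhd \<Gamma> \<xi>0"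
    and decay: "\<And>k::nat. \<exists>C. \<forall>\<xi>\<in>\<Gamma>. (1 + norm \<xi>) ^ k * norm (w (\<lambda>x. \<psi> x * echar \<xi> x)) \<le> C"
  shows "\<exists>\<psi>'. test_fun \<psi>' \<and> \<psi>' x0 \<noteq> 0 \<and> not_in_Sigma_g \<gamma> \<psi>' (embed_rep \<gamma> \<theta> w) \<xi>0"
proof -
  obtain \<psi>' \<rho> \<delta> where \<psi>': "test_fun \<psi>'" "\<psi>' x0 \<noteq> 0" and \<rho>: "test_fun \<rho>" and \<delta>: "\<delta> > 0"
    and loc: "\<And>h y. norm h \<le> \<delta> \<Longrightarrow> \<psi> y * (\<rho> y * \<psi>' (y + h)) = \<psi>' (y + h)"
    using localizing_functions[OF \<psi>] by blast
  obtain \<Gamma>' c where \<Gamma>': "conic_nbhd \<Gamma>' \<xi>0" and c: "0 < c" "c \<le> 1 / 2"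
    and cone: "\<And>\<xi> \<tau>. \<xi> \<in> \<Gamma>' \<Longrightarrow> norm \<tau> \<le> c * norm \<xi> \<Longrightarrow> \<xi> - \<tau> \<in> \<Gamma>"
    using conic_nbhd_shrink[OF \<Gamma>] by blast
  have near: "\<exists>C. \<forall>\<xi>\<in>\<Gamma>'. \<forall>h. norm h \<le> \<delta> \<longrightarrow> (1 + norm \<xi>) ^ k * norm (w (\<lambda>y. \<psi>' (y + h) * echar \<xi> y)) \<le> C" for k
    by (rule localized_decay[OF w \<psi>(1) \<rho> \<psi>'(1) loc decay c cone])
  have "\<exists>C \<epsilon>0. \<epsilon>0 > 0 \<and> (\<forall>\<epsilon>. 0 < \<epsilon> \<and> \<epsilon> < \<epsilon>0 \<longrightarrow> (\<forall>\<xi>\<in>\<Gamma>'. (1 + norm \<xi>) ^ k *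
      norm (fourier (\<lambda>x. \<psi>' x * embed_rep \<gamma> \<theta> w (dil \<epsilon> \<phi>) x) \<xi>) \<le> C * \<bar>\<gamma> (\<epsilon> * lsupp \<phi>)\<bar> ^ 0))"
    if \<phi>: "\<phi> \<in> mollA 0" for k \<phi>
  proof -
    obtain C where C: "\<And>t \<xi>. t \<ge> 2 \<Longrightarrow> \<xi> \<in> \<Gamma>' \<Longrightarrow> (1 + norm \<xi>) ^ k * norm (ftconv w \<psi>' (rescale t \<theta>) \<xi>) \<le> C"
      using ftconv_rapid_decay[OF w \<psi>'(1) \<theta> \<delta> near, of k] by blast
    obtain \<epsilon>0 where \<epsilon>0: "\<epsilon>0 > 0" "\<And>\<epsilon>. 0 < \<epsilon> \<Longrightarrow> \<epsilon> < \<epsilon>0 \<Longrightarrow> \<gamma> (\<epsilon> * lsupp \<phi>) \<ge> 2"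
      using admissible_scaling_large[OF \<gamma> lsupp_pos[OF \<phi>]] by blast
    show ?thesis
    proof (rule exI[of _ C], rule exI[of _ \<epsilon>0], intro conjI allI impI ballI)
      fix \<epsilon> \<xi> assume \<epsilon>: "0 < \<epsilon> \<and> \<epsilon> < \<epsilon>0" and \<xi>: "\<xi> \<in> \<Gamma>'"
      then have g: "\<gamma> (\<epsilon> * lsupp \<phi>) \<ge> 2" using \<epsilon>0(2) by blast
      have "fourier (\<lambda>x. \<psi>' x * embed_rep \<gamma> \<theta> w (dil \<epsilon> \<phi>) x) \<xi> = ftconv w \<psi>' (rescale (\<gamma> (\<epsilon> * lsupp \<phi>)) \<theta>) \<xi>"
        by (rule fourier_embed_rep[OF w \<psi>'(1) \<theta> \<phi>]) (use \<epsilon> g in auto)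
      then show "(1 + norm \<xi>) ^ k * norm (fourier (\<lambda>x. \<psi>' x * embed_rep \<gamma> \<theta> w (dil \<epsilon> \<phi>) x) \<xi>) \<le> C * \<bar>\<gamma> (\<epsilon> * lsupp \<phi>)\<bar> ^ 0"
        using C[OF g \<xi>] by simp
    qed (rule \<epsilon>0(1))
  qed
  then have "not_in_Sigma_g \<gamma> \<psi>' (embed_rep \<gamma> \<theta> w) \<xi>0"
    unfolding not_in_Sigma_g_def using \<Gamma>' by blast
  then show ?thesis using \<psi>' by blast
qed

text \<open>The estimate is uniform in \<epsilon> and in \<xi> from the cone, so \<epsilon> may be
  chosen depending on \<xi>. This trades the polynomial loss in \<gamma> against the arbitrary order
  of decay in \<xi>, which is possible because N is fixed before k.\<close>

lemma decay_if_not_in_Sigma_g: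
  fixes w :: "(real^'m \<Rightarrow> complex) \<Rightarrow> complex"
  assumes w: "tempered w" and \<gamma>: "admissible_scaling \<gamma>" and \<theta>: "schwartz \<theta>" "integral\<^sup>L lborel \<theta> = 1"
    and \<psi>: "test_fun \<psi>" and nin: "not_in_Sigma_g \<gamma> \<psi> (embed_rep \<gamma> \<theta> w) \<xi>0"
  shows "\<exists>\<Gamma>. conic_nbhd \<Gamma> \<xi>0 \<and> (\<forall>k::nat. \<exists>C. \<forall>\<xi>\<in>\<Gamma>. (1 + norm \<xi>) ^ k * norm (w (\<lambda>x. \<psi> x * echar \<xi> x)) \<le> C)"
proof -
  obtain \<Gamma> N where \<Gamma>: "conic_nbhd \<Gamma> \<xi>0"
    and N: "\<And>k::nat. \<exists>M::nat. \<forall>\<phi>0\<in>mollA M. (\<exists>C \<epsilon>0. \<epsilon>0 > 0 \<and> (\<forall>\<epsilon>. 0 < \<epsilon> \<and> \<epsilon> < \<epsilon>0 \<longrightarrow> (\<forall>\<xi>\<in>\<Gamma>.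
       (1 + norm \<xi>) ^ k * norm (fourier (\<lambda>x. \<psi> x * embed_rep \<gamma> \<theta> w (dil \<epsilon> \<phi>0) x) \<xi>) \<le> C * \<bar>\<gamma> (\<epsilon> * lsupp \<phi>0)\<bar> ^ N)))"
    using nin unfolding not_in_Sigma_g_def by blast
  obtain C K where C: "C \<ge> 0"
    and approx: "\<And>\<xi> t. 1 \<le> t \<Longrightarrow> norm (ftconv w \<psi> (rescale t \<theta>) \<xi> - w (\<lambda>x. \<psi> x * echar \<xi> x)) \<le> C / t * (1 + norm \<xi>) ^ K"
    using ftconv_approx[OF w \<psi> \<theta>] by blast
  have "\<exists>C. \<forall>\<xi>\<in>\<Gamma>. (1 + norm \<xi>) ^ k * norm (w (\<lambda>x. \<psi> x * echar \<xi> x)) \<le> C" for k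
  proof -
    \<comment> \<open>The scale will grow like the p-th power of \<open>1 + norm \<xi>\<close>:
      enough for the approximation error, of order K in \<xi>, to retain k powers of decay. The
      hypothesis is therefore used with the order k + p N, the surplus p N cancelling the N-th power
      of the scale.\<close>
    define p where "p = K + k"
    obtain M where M: "\<forall>\<phi>0\<in>mollA M. (\<exists>C \<epsilon>0. \<epsilon>0 > 0 \<and> (\<forall>\<epsilon>. 0 < \<epsilon> \<and> \<epsilon> < \<epsilon>0 \<longrightarrow> (\<forall>\<xi>\<in>\<Gamma>.
       (1 + norm \<xi>) ^ (k + p * N) * norm (fourier (\<lambda>x. \<psi> x * embed_rep \<gamma> \<theta> w (dil \<epsilon> \<phi>0) x) \<xi>) \<le> C * \<bar>\<gamma> (\<epsilon> * lsupp \<phi>0)\<bar> ^ N)))"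
      using N[of "k + p * N"] ..
    obtain \<phi> where \<phi>: "\<phi> \<in> mollA M" using mollA_nonempty by blast
    obtain C2 \<epsilon>0 where \<epsilon>0: "\<epsilon>0 > 0" and C2: "\<And>\<epsilon> \<xi>. 0 < \<epsilon> \<Longrightarrow> \<epsilon> < \<epsilon>0 \<Longrightarrow> \<xi> \<in> \<Gamma> \<Longrightarrow>
       (1 + norm \<xi>) ^ (k + p * N) * norm (fourier (\<lambda>x. \<psi> x * embed_rep \<gamma> \<theta> w (dil \<epsilon> \<phi>) x) \<xi>) \<le> C2 * \<bar>\<gamma> (\<epsilon> * lsupp \<phi>)\<bar> ^ N"
      using bspec[OF M \<phi>] by blast
    obtain \<Lambda> where \<Lambda>: "\<Lambda> \<ge> 1" "\<And>t. t \<ge> \<Lambda> \<Longrightarrow> \<exists>\<epsilon>. 0 < \<epsilon> \<and> \<epsilon> < \<epsilon>0 \<and> \<gamma> (\<epsilon> * lsupp \<phi>) = t"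
      using admissible_scaling_attains[OF \<gamma> lsupp_pos[OF \<phi>] \<epsilon>0] by blast
    have "(1 + norm \<xi>) ^ k * norm (w (\<lambda>x. \<psi> x * echar \<xi> x)) \<le> C2 * \<Lambda> ^ N + C" if \<xi>: "\<xi> \<in> \<Gamma>" for \<xi>
    proof -
      let ?x = "1 + norm \<xi>"
      \<comment> \<open>The factor \<Lambda> puts \<open>t\<close> in the range of values that
        \<gamma> attains for \<epsilon> < \<epsilon>0, for every \<xi> in the cone at once.\<close>
      define t where "t = \<Lambda> * ?x ^ p"
      have xp: "1 \<le> ?x ^ p" for p by (intro one_le_power) simp
      have x1: "?x \<noteq> 0" using norm_ge_zero[of \<xi>] by linarith
      have x0: "0 < ?x ^ p" for p using xp[of p] by linarith
      have "\<Lambda> * 1 \<le> t" unfolding t_def using \<Lambda>(1) xp by (intro mult_left_mono) auto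
      then have t: "\<Lambda> \<le> t" "1 \<le> t" using \<Lambda>(1) by linarith+
      obtain \<epsilon> where \<epsilon>: "0 < \<epsilon>" "\<epsilon> < \<epsilon>0" "\<gamma> (\<epsilon> * lsupp \<phi>) = t" using \<Lambda>(2)[OF t(1)] by blast
      let ?F = "ftconv w \<psi> (rescale t \<theta>) \<xi>" and ?W = "w (\<lambda>x. \<psi> x * echar \<xi> x)"
      have "fourier (\<lambda>x. \<psi> x * embed_rep \<gamma> \<theta> w (dil \<epsilon> \<phi>) x) \<xi> = ?F"
        using fourier_embed_rep[OF w \<psi> \<theta>(1) \<phi> \<epsilon>(1), of \<gamma> \<xi>] \<epsilon>(3) t(2) by simp
      then have "?x ^ (k + p * N) * norm ?F \<le> C2 * t ^ N"
        using C2[OF \<epsilon>(1,2) \<xi>] \<epsilon>(3) t(2) by simp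
      also have "C2 * t ^ N = ?x ^ (p * N) * (C2 * \<Lambda> ^ N)" by (simp add: t_def power_mult_distrib power_mult)
      finally have "?x ^ (p * N) * (?x ^ k * norm ?F) \<le> ?x ^ (p * N) * (C2 * \<Lambda> ^ N)" by (simp only: power_add mult_ac)
      then have 1: "?x ^ k * norm ?F \<le> C2 * \<Lambda> ^ N" using x0[of "p * N"] by (simp only: mult_le_cancel_left_pos)
      have "?x ^ k * norm (?F - ?W) \<le> ?x ^ k * (C / t * ?x ^ K)"
        by (intro mult_left_mono approx t) auto
      also have "\<dots> = C / t * ?x ^ p" by (simp only: p_def power_add mult_ac)
      also have "\<dots> = C / \<Lambda>" unfolding t_def using x1 \<Lambda>(1) by (simp add: field_simps)
      also have "\<dots> \<le> C" using C \<Lambda>(1) by (simp add: divide_le_eq mult_le_cancel_left1)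
      finally have 2: "?x ^ k * norm (?F - ?W) \<le> C" .
      have "norm ?W \<le> norm ?F + norm (?F - ?W)" using norm_triangle_ineq4[of ?F "?F - ?W"] by simp
      then have "?x ^ k * norm ?W \<le> ?x ^ k * (norm ?F + norm (?F - ?W))" by (rule mult_left_mono) simp
      then show ?thesis using 1 2 by (simp only: distrib_left)
    qed
    then show ?thesis by blast
  qed
  then show ?thesis using \<Gamma> by blast
qed

theorem mainTheorem6:
  fixes w :: "(real^'m \<Rightarrow> complex) \<Rightarrow> complex"
    and \<gamma> :: "real \<Rightarrow> real"
    and chi :: "real^'m \<Rightarrow> complex"
  assumes "tempered w"
    and "admissible_scaling \<gamma>"
    and "schwartz chi"
    and "integral\<^sup>L lborel chi = 1"
  shows "WF_gamma_g \<gamma> (embed_rep \<gamma> chi w) = WF w"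
proof -
  have echar: "exp (- \<i> * complex_of_real (x \<bullet> \<xi>)) = echar \<xi> x" for x \<xi> :: "real^'m"
    by (simp add: echar_def)
  \<comment> \<open>Both wave front sets are complements, so it suffices to compare the existence of
    a good cutoff at each point and direction. The cutoff may change from one side to the other, as
    it does in the second implication.\<close>
  have "(\<exists>\<psi>. test_fun \<psi> \<and> \<psi> x0 \<noteq> 0 \<and> not_in_Sigma_g \<gamma> \<psi> (embed_rep \<gamma> chi w) \<xi>0) \<longleftrightarrow>
    (\<exists>\<psi>. test_fun \<psi> \<and> \<psi> x0 \<noteq> 0 \<and> (\<exists>\<Gamma>. conic_nbhd \<Gamma> \<xi>0 \<and> (\<forall>k::nat. \<exists>C. \<forall>\<xi>\<in>\<Gamma>.
       (1 + norm \<xi>) ^ k * norm (w (\<lambda>x. \<psi> x * echar \<xi> x)) \<le> C)))" (is "?L \<longleftrightarrow> ?R") for x0 \<xi>0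
  proof
    assume ?L
    then show ?R using decay_if_not_in_Sigma_g[OF assms] by blast
  next
    assume ?R
    then obtain \<psi> \<Gamma> where "test_fun \<psi>" "\<psi> x0 \<noteq> 0" "conic_nbhd \<Gamma> \<xi>0"
      and "\<And>k::nat. \<exists>C. \<forall>\<xi>\<in>\<Gamma>. (1 + norm \<xi>) ^ k * norm (w (\<lambda>x. \<psi> x * echar \<xi> x)) \<le> C"
      by blast
    from not_in_Sigma_g_if_decay[OF assms(1-3) this] show ?L .
  qed
  then show ?thesis
    unfolding WF_gamma_g_def WF_def echar by blast
qed

end
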